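(* Let $\sigma$ be an automorphism of an algebra $A$, and let $\delta_1,\dots,\delta_n : A\to A$ be commuting $\sigma$-derivations. If $\tau:A\to\mathbb{C}$ is a $\sigma^n$-trace such that $\tau\circ\sigma=\tau$ and $\tau\circ\delta_j=0$ for $j=1,\dots,n$, then the linear functional $\mathrm{res}:\Psi(A,\sigma,\delta_1,\dots,\delta_n)\to\mathbb{C}$ defined by $$\mathrm{res}\Big(\sum a_{i_1,\dots,i_n}\,\xi_1^{i_1}\cdots\xi_n^{i_n}\Big)=\tau(a_{-1,\dots,-1})$$ is a trace.
   Context: Algebras are associative, unital, not necessarily commutative, over $\mathbb{C}$. A $\sigma$-derivation on $A$ is a linear map $\delta:A\to A$ with $\delta(ab)=\delta(a)b+\sigma(a)\delta(b)$. For an automorphism $\theta$ of an algebra $B$, a $\theta$-trace on $B$ is a linear map $\varphi:B\to\mathbb{C}$ with $\varphi(xy)=\varphi(\theta(y)x)$ for all $x,y\in B$; a trace is the case $\theta=\mathrm{id}$. Definition of $\Psi(A,\sigma,\delta_1,\dots,\delta_n)$. Let $\Psi_0(A,\sigma,\delta_1,\dots,\delta_n)$ be the set of all formal series $D$ in noncommuting invertible variables $\xi_1,\dots,\xi_n$ with coefficients in $A$ (written on the left), of the form $$D=\sum a_{i}\;\xi_1^{i_{1,1}}\xi_2^{i_{1,2}}\cdots\xi_n^{i_{1,n}}\;\xi_1^{i_{2,1}}\cdots\xi_n^{i_{2,n}}\cdots\xi_1^{i_{m,1}}\cdots\xi_n^{i_{m,n}},$$ where $m=m(D)$ is a positive integer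 and the sum is over all integer arrays $i=(i_{k,l})$ whose entries are all less than some $N=N(D)\in\mathbb{Z}$. Words are identified using $\xi_j^0=1$ and $\xi_j\xi_j^{-1}=\xi_j^{-1}\xi_j=1$ and multiplied by concatenation; the multiplication of $\Psi_0$ is determined by this together with $\xi_j a-\sigma(a)\xi_j=\delta_j(a)$ for $a\in A$, i.e. for $r\ge 1$ $$\xi_j^r a=\sum_{i=0}^{r}P_{i,r}(\sigma,\delta_j)(a)\xi_j^i,\qquad \xi_j^{-r}a=\sum_{i_1,\dots,i_r\ge0}(-1)^{i_1+\cdots+i_r}\sigma^{-1}(\delta_j\sigma^{-1})^{i_r}\cdots\sigma^{-1}(\delta_j\sigma^{-1})^{i_1}(a)\,\xi_j^{-r-i_1-\cdots-i_r},$$ where $P_{i,r}(\sigma,\delta_j)$ is the sum of all $\binom{r}{i}$ words of length $r$ in $\sigma,\delta_j$ containing $\sigma$ exactly $i$ times. Then $\Psi(A,\sigma,\delta_1,\dots,\delta_n)$ is the quotient of $\Psi_0$ by the two-sided ideal generated by all $\xi_k\xi_l-\xi_l\xi_k$. The functional $\mathrm{res}$ is the one induced on the quotient by the linear map $\mathrm{res}_0:\Psi_0\to\mathbb{C}$ sending a series to the (finite) sum of $\tau$ of the coefficients of those words in which, for every $j=1,\dots,n$, the total exponent of $\xi_j$ equals $-1$; on classes of series $\sum a_{i_1,\dots,i_n}\xi_1^{i_1}\cdots\xi_n^{i_n}$ (exponents bounded above) it is given by the formula in the claim. That $\mathrm{res}$ is well defined on the quotient is part of the assertion.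
   Formalization: For n ≥ 3 the σ-derivations δ_j are additionally assumed to commute with σ; if they commute only with one another, res can fail to be well defined (A = M_2(C), n = 3). For n = 1, 2 nothing is added. *)

theory Defs
  imports Complex_Main "HOL-Algebra.QuotRing"
begin

section \<open>Algebras over the complex numbers\<close>

text \<open>The sort \<open>{ring, monoid_mult}\<close> is that of unital associative rings in which
  \<open>1 = 0\<close> is not excluded, unlike in \<^class>\<open>ring_1\<close>.\<close>

locale complex_algebra = vector_space scale
  for scale :: "complex \<Rightarrow> 'a::{ring,monoid_mult} \<Rightarrow> 'a" +
  assumes scale_mult_left: "scale c (x * y) = scale c x * y"
    and scale_mult_right: "scale c (x * y) = x * scale c y"

definition algebra_automorphism ::
  "(complex \<Rightarrow> 'a::{ring,monoid_mult} \<Rightarrow> 'a) \<Rightarrow> ('a \<Rightarrow> 'a) \<Rightarrow> bool" where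
  "algebra_automorphism scale \<sigma> \<longleftrightarrow>
     Vector_Spaces.linear scale scale \<sigma> \<and> bij \<sigma> \<and> \<sigma> 1 = 1 \<and> (\<forall>x y. \<sigma> (x * y) = \<sigma> x * \<sigma> y)"

definition twisted_derivation ::
  "(complex \<Rightarrow> 'a::{ring,monoid_mult} \<Rightarrow> 'a) \<Rightarrow> ('a \<Rightarrow> 'a) \<Rightarrow> ('a \<Rightarrow> 'a) \<Rightarrow> bool" where
  "twisted_derivation scale \<sigma> \<delta> \<longleftrightarrow>
     Vector_Spaces.linear scale scale \<delta> \<and> (\<forall>x y. \<delta> (x * y) = \<delta> x * y + \<sigma> x * \<delta> y)"

definition twisted_trace ::
  "(complex \<Rightarrow> 'a::{ring,monoid_mult} \<Rightarrow> 'a) \<Rightarrow> ('a \<Rightarrow> 'a) \<Rightarrow> ('a \<Rightarrow> complex) \<Rightarrow> bool" where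
  "twisted_trace scale \<theta> \<phi> \<longleftrightarrow>
     Vector_Spaces.linear scale (*) \<phi> \<and> (\<forall>x y. \<phi> (x * y) = \<phi> (\<theta> y * x))"


section \<open>Words in the invertible variables\<close>

text \<open>An element of the free group on \<open>\<xi>\<^sub>1, \<dots>, \<xi>\<^sub>n\<close> is represented by its reduced word: the list of
  syllables \<open>(j, e)\<close>, standing for \<open>\<xi>\<^sub>j\<^sup>e\<close>, with all \<open>e \<noteq> 0\<close> and consecutive variables distinct.
  \<open>syl_cons\<close> multiplies a reduced word by a syllable from the left.\<close>

type_synonym word = "(nat \<times> int) list"

fun syl_cons :: "nat \<times> int \<Rightarrow> word \<Rightarrow> word" where
  "syl_cons (j, e) [] = (if e = 0 then [] else [(j, e)])"
| "syl_cons (j, e) ((k, f) # w) =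
     (if e = 0 then (k, f) # w
      else if j = k then (if e + f = 0 then w else (k, e + f) # w)
      else (j, e) # (k, f) # w)"

definition word_mult :: "word \<Rightarrow> word \<Rightarrow> word" where
  "word_mult u v = foldr syl_cons u v"

definition total_exponent :: "nat \<Rightarrow> word \<Rightarrow> int" where
  "total_exponent j w = (\<Sum>(k, e)\<leftarrow>w. if k = j then e else 0)"

text \<open>An array \<open>(i\<^sub>k\<^sub>,\<^sub>l)\<close> with \<open>m\<close> rows and \<open>n\<close> columns is given as the list of its rows.\<close>

definition is_array :: "nat \<Rightarrow> nat \<Rightarrow> int \<Rightarrow> int list list \<Rightarrow> bool" where
  "is_array n m N i \<longleftrightarrow>
     length i = m \<and> (\<forall>row \<in> set i. length row = n \<and> (\<forall>e \<in> set row. e < N))"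

definition array_word :: "nat \<Rightarrow> int list list \<Rightarrow> word" where
  "array_word n i = word_mult (concat (map (\<lambda>row. zip [1..<Suc n] row) i)) []"


section \<open>Formal series\<close>

text \<open>A formal series with coefficients written on the left is the function assigning to each
  reduced word its coefficient. \<open>array_series n a\<close> is the series given by the coefficient family
  \<open>a\<close>: coefficients of arrays that spell the same word are added up. When the arrays
  in the support of \<open>a\<close> have a fixed number of rows and entries bounded above, only finitely many of
  them spell a given word, since the word determines the sum of the exponents of each variable.\<close>

definition array_series ::
  "nat \<Rightarrow> (int list list \<Rightarrow> 'a::{ring,monoid_mult}) \<Rightarrow> word \<Rightarrow> 'a" where
  "array_series n a w = (\<Sum>i | a i \<noteq> 0 \<and> array_word n i = w. a i)"

definition Psi0_carrier :: "nat \<Rightarrow> (word \<Rightarrow> 'a::{ring,monoid_mult}) set" where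
  "Psi0_carrier n =
     {array_series n a | a. \<exists>m N. m > 0 \<and> (\<forall>i. a i \<noteq> 0 \<longrightarrow> is_array n m N i)}"

definition monomial :: "'a::{ring,monoid_mult} \<Rightarrow> word \<Rightarrow> word \<Rightarrow> 'a" where
  "monomial a w = (\<lambda>u. if u = w then a else 0)"

text \<open>\<open>P_sum \<sigma> \<delta> i r\<close> is the sum of the words of length \<open>r\<close> in \<open>\<sigma>, \<delta>\<close> (encoded as lists of Booleans,
  \<open>True\<close> standing for \<open>\<sigma>\<close>) that contain \<open>\<sigma>\<close> exactly \<open>i\<close> times.\<close>

definition P_sum ::
  "('a::{ring,monoid_mult} \<Rightarrow> 'a) \<Rightarrow> ('a \<Rightarrow> 'a) \<Rightarrow> nat \<Rightarrow> nat \<Rightarrow> 'a \<Rightarrow> 'a" where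
  "P_sum \<sigma> \<delta> i r a =
     (\<Sum>bs | length bs = r \<and> count_list bs True = i. foldr (\<lambda>b. if b then \<sigma> else \<delta>) bs a)"

text \<open>\<open>Q_sum \<sigma> \<delta> t r a\<close> is the coefficient of \<open>\<xi>\<^sup>-\<^sup>r\<^sup>-\<^sup>t\<close> in \<open>\<xi>\<^sup>-\<^sup>r a\<close>: the sum, over all
  \<open>i\<^sub>1, \<dots>, i\<^sub>r \<ge> 0\<close> with \<open>i\<^sub>1 + \<dots> + i\<^sub>r = t\<close>, of
  \<open>(-1)\<^sup>t \<sigma>\<^sup>-\<^sup>1 (\<delta> \<sigma>\<^sup>-\<^sup>1)\<close>\<open>^i\<^sub>r\<close> \<open>\<dots> \<sigma>\<^sup>-\<^sup>1 (\<delta> \<sigma>\<^sup>-\<^sup>1)\<close>\<open>^i\<^sub>1\<close> \<open>(a)\<close>.\<close>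

definition Q_sum ::
  "('a::{ring,monoid_mult} \<Rightarrow> 'a) \<Rightarrow> ('a \<Rightarrow> 'a) \<Rightarrow> nat \<Rightarrow> nat \<Rightarrow> 'a \<Rightarrow> 'a" where
  "Q_sum \<sigma> \<delta> t r a =
     (let \<rho> = inv_into UNIV \<sigma> in
      \<Sum>is | length is = r \<and> sum_list is = t.
        (-1) ^ t * fold (\<lambda>i x. \<rho> (((\<delta> \<circ> \<rho>) ^^ i) x)) is a)"

text \<open>The coefficient of \<open>\<xi>\<^sup>s\<close> in \<open>\<xi>\<^sup>e a\<close>, for arbitrary integers \<open>e\<close> and \<open>s\<close>.\<close>

definition xi_coeff ::
  "('a::{ring,monoid_mult} \<Rightarrow> 'a) \<Rightarrow> ('a \<Rightarrow> 'a) \<Rightarrow> int \<Rightarrow> int \<Rightarrow> 'a \<Rightarrow> 'a" where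
  "xi_coeff \<sigma> \<delta> e s a =
     (if 0 \<le> e then (if 0 \<le> s \<and> s \<le> e then P_sum \<sigma> \<delta> (nat s) (nat e) a else 0)
      else (if s \<le> e then Q_sum \<sigma> \<delta> (nat (e - s)) (nat (- e)) a else 0))"

text \<open>Moving \<open>a\<close> to the left through \<open>w = \<xi>\<^sub>j\<^sub>1\<^sup>e\<^sup>1 \<dots> \<xi>\<^sub>j\<^sub>k\<^sup>e\<^sup>k\<close>, one syllable at a time,
  \<open>word_coeff \<sigma> \<delta> w [s\<^sub>1, \<dots>, s\<^sub>k] a\<close> is the coefficient that appears
  in front of \<open>\<xi>\<^sub>j\<^sub>1\<^sup>s\<^sup>1 \<dots> \<xi>\<^sub>j\<^sub>k\<^sup>s\<^sup>k\<close>.\<close>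

definition word_coeff ::
  "('a::{ring,monoid_mult} \<Rightarrow> 'a) \<Rightarrow> (nat \<Rightarrow> 'a \<Rightarrow> 'a) \<Rightarrow> word \<Rightarrow> int list \<Rightarrow> 'a \<Rightarrow> 'a" where
  "word_coeff \<sigma> \<delta> w ss a =
     foldr (\<lambda>((j, e), s). xi_coeff \<sigma> (\<delta> j) e s) (zip w ss) a"

text \<open>Coefficient at \<open>u\<close> of the product of \<open>D = \<Sum> D\<^sub>w w\<close> and \<open>E = \<Sum> E\<^sub>v v\<close>. The index set is finite for
  \<open>D, E\<close> in \<^const>\<open>Psi0_carrier\<close>: numbers of syllables and exponents of \<open>w\<close> and \<open>v\<close> are bounded above, and
  \<open>u\<close> fixes, for each variable, the sum of the exponents occurring in \<open>ss\<close> and \<open>v\<close>.\<close>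

definition series_mult ::
  "('a::{ring,monoid_mult} \<Rightarrow> 'a) \<Rightarrow> (nat \<Rightarrow> 'a \<Rightarrow> 'a) \<Rightarrow>
     (word \<Rightarrow> 'a) \<Rightarrow> (word \<Rightarrow> 'a) \<Rightarrow> word \<Rightarrow> 'a" where
  "series_mult \<sigma> \<delta> D E u =
     (\<Sum>(w, ss, v) \<in> {(w, ss, v). D w \<noteq> 0 \<and> E v \<noteq> 0 \<and> list_all2 (\<lambda>(j, e) s. s \<le> e) w ss \<and>
                         word_mult (zip (map fst w) ss) v = u}.
        D w * word_coeff \<sigma> \<delta> w ss (E v))"

definition Psi0 ::
  "nat \<Rightarrow> ('a::{ring,monoid_mult} \<Rightarrow> 'a) \<Rightarrow> (nat \<Rightarrow> 'a \<Rightarrow> 'a) \<Rightarrow> (word \<Rightarrow> 'a) ring" where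
  "Psi0 n \<sigma> \<delta> =
     \<lparr>carrier = Psi0_carrier n, mult = series_mult \<sigma> \<delta>, one = monomial 1 [],
      zero = (\<lambda>w. 0), add = (\<lambda>D E w. D w + E w)\<rparr>"


section \<open>The quotient in which the variables commute\<close>

definition xi :: "nat \<Rightarrow> word \<Rightarrow> 'a::{ring,monoid_mult}" where
  "xi j = monomial 1 [(j, 1)]"

definition Psi_ideal ::
  "nat \<Rightarrow> ('a::{ring,monoid_mult} \<Rightarrow> 'a) \<Rightarrow> (nat \<Rightarrow> 'a \<Rightarrow> 'a) \<Rightarrow> (word \<Rightarrow> 'a) set" where
  "Psi_ideal n \<sigma> \<delta> =
     genideal (Psi0 n \<sigma> \<delta>)
       {xi k \<otimes>\<^bsub>Psi0 n \<sigma> \<delta>\<^esub> xi l \<ominus>\<^bsub>Psi0 n \<sigma> \<delta>\<^esub> xi l \<otimes>\<^bsub>Psi0 n \<sigma> \<delta>\<^esub> xi k | k l.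
          k \<in> {1..n} \<and> l \<in> {1..n}}"

definition Psi ::
  "nat \<Rightarrow> ('a::{ring,monoid_mult} \<Rightarrow> 'a) \<Rightarrow> (nat \<Rightarrow> 'a \<Rightarrow> 'a) \<Rightarrow> (word \<Rightarrow> 'a) set ring" where
  "Psi n \<sigma> \<delta> = Psi0 n \<sigma> \<delta> Quot Psi_ideal n \<sigma> \<delta>"

definition Psi_class ::
  "nat \<Rightarrow> ('a::{ring,monoid_mult} \<Rightarrow> 'a) \<Rightarrow> (nat \<Rightarrow> 'a \<Rightarrow> 'a) \<Rightarrow> (word \<Rightarrow> 'a) \<Rightarrow> (word \<Rightarrow> 'a) set" where
  "Psi_class n \<sigma> \<delta> D = Psi_ideal n \<sigma> \<delta> +>\<^bsub>Psi0 n \<sigma> \<delta>\<^esub> D"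

text \<open>Multiplication by a complex number on classes, in the style of \<^const>\<open>rcoset_mult\<close>.\<close>

definition Psi_scale ::
  "nat \<Rightarrow> (complex \<Rightarrow> 'a::{ring,monoid_mult} \<Rightarrow> 'a) \<Rightarrow> ('a \<Rightarrow> 'a) \<Rightarrow> (nat \<Rightarrow> 'a \<Rightarrow> 'a) \<Rightarrow>
     complex \<Rightarrow> (word \<Rightarrow> 'a) set \<Rightarrow> (word \<Rightarrow> 'a) set" where
  "Psi_scale n scale \<sigma> \<delta> c X = (\<Union>D\<in>X. Psi_class n \<sigma> \<delta> (\<lambda>w. scale c (D w)))"


section \<open>The residue\<close>

definition res0 :: "nat \<Rightarrow> ('a::{ring,monoid_mult} \<Rightarrow> complex) \<Rightarrow> (word \<Rightarrow> 'a) \<Rightarrow> complex" where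
  "res0 n \<tau> D = (\<Sum>w | D w \<noteq> 0 \<and> (\<forall>j\<in>{1..n}. total_exponent j w = -1). \<tau> (D w))"

text \<open>The common value of \<^const>\<open>res0\<close> on the representatives of a class; it is unspecified if
  \<^const>\<open>res0\<close> is not constant on the class.\<close>

definition res :: "nat \<Rightarrow> ('a::{ring,monoid_mult} \<Rightarrow> complex) \<Rightarrow> (word \<Rightarrow> 'a) set \<Rightarrow> complex" where
  "res n \<tau> X = the_elem (res0 n \<tau> ` X)"

end

theory Submission
  imports Defs
begin

text \<open>Left multiplication by \<open>\<xi>\<^sub>j\<^sup>e\<close> is an operator on formal series; the recursion for the coefficients of
  \<open>\<xi>\<^sub>j\<^sup>e a\<close> says that these operators are the powers of the invertible operator \<open>\<xi>\<^sub>j\<close>. Associativity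
  then only has to be checked for left multiplication by \<open>\<xi>\<^sub>j\<close>, where it is the twisted Leibniz rule.

  The residue vanishes on \<open>D(\<xi>\<^sub>k\<xi>\<^sub>l - \<xi>\<^sub>l\<xi>\<^sub>k)\<close>, because right multiplication by a word only shifts the
  total exponents. So everything follows from the trace property on series. Elements commuting with all
  series under the residue are closed under products and sums, so it suffices to consider
  \<open>\<xi>\<^sub>j\<^sup>\<plusminus>\<^sup>1\<close>, where \<open>\<tau>\<sigma> = \<tau>\<close> and \<open>\<tau>\<delta>\<^sub>j = 0\<close> are used, and coefficients \<open>b\<close>. In the latter case,
  the variables may be permuted in \<open>w b\<close> without changing the sums \<open>\<tau>(a c)\<close> of coefficients \<open>c\<close> with given
  total exponents, because \<open>\<sigma>\<close> and \<open>\<delta>\<^sub>j\<close> commute modulo the radical of \<open>\<tau>\<close> as soon as \<open>n \<ge> 2\<close>.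
  A power \<open>\<xi>\<^sub>j\<^sup>e\<close> with \<open>e \<noteq> -1\<close> never produces \<open>\<xi>\<^sub>j\<^sup>-\<^sup>1\<close>, so that only the leading term of words with all total
  exponents \<open>-1\<close> contributes.\<close>

section \<open>Reduced words\<close>

text \<open>The explicit sums for negative powers enter, apart from their additivity and their range
  of exponents, only through the recursion \<open>xi_coeff_add_one\<close>. All identities for
  negative powers then follow by cancelling xi_j: at the word xi_j v, the series xi_j G has the
  coefficient \<sigma>(G v) + \<delta>_j(G(xi_j v)), and as degrees are bounded above, G is
  recovered from the top degree downwards. The same descent works for sums seen through \<tau>.
  Degree also controls every infinite sum: a fixed word in a product only receives contributions
  from words of degree above some bound, and of these a series has finitely many. The twist
  \<sigma>^n is forced by the residue: moving b to the left through a word with all n total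
  exponents -1 produces \<sigma>^(-n)(b) in top degree. Commutation of \<sigma> and \<delta>_j
  modulo the radical has several sources: for n = 1 there is no pair of variables to permute, for n
  = 2 it comes from the \<sigma>^2-trace property, and for n \<ge> 3 it is the assumption
  \<open>\<delta>_\<sigma>\<close> of the locale.\<close>

text \<open>Series are functions on lists, so every group element needs one canonical list.
  \<open>syl_cons\<close> merges with the first syllable only and obeys the group laws just on these
  lists.\<close>

fun reduced :: "word \<Rightarrow> bool" where
  "reduced [] \<longleftrightarrow> True"
| "reduced ((j, e) # w) \<longleftrightarrow> e \<noteq> 0 \<and> reduced w \<and> (w \<noteq> [] \<longrightarrow> fst (hd w) \<noteq> j)"

definition reduced_words :: "nat \<Rightarrow> word set" where
  "reduced_words n = {w. reduced w \<and> fst ` set w \<subseteq> {1..n}}"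

definition deg :: "word \<Rightarrow> int" where
  "deg w = sum_list (map snd w)"

text \<open>Bounds on exponents are kept as a sum of positive parts: merging syllables may raise a
  single exponent, but this sum stays subadditive under multiplication.\<close>

definition pos_deg :: "word \<Rightarrow> int" where
  "pos_deg w = sum_list (map (\<lambda>(j, e). max e 0) w)"

lemma deg_simps [simp]: "deg [] = 0" "deg ((j, e) # w) = e + deg w"
  by (auto simp: deg_def)

lemma pos_deg_simps [simp]: "pos_deg [] = 0" "pos_deg ((j, e) # w) = max e 0 + pos_deg w"
  by (auto simp: pos_deg_def)

lemma total_exponent_simps [simp]:
  "total_exponent j [] = 0"
  "total_exponent j ((k, e) # w) = (if k = j then e else 0) + total_exponent j w"
  by (auto simp: total_exponent_def)

lemma word_mult_simps [simp]:
  "word_mult [] v = v" "word_mult (x # u) v = syl_cons x (word_mult u v)"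
  by (auto simp: word_mult_def)

lemma pos_deg_nonneg: "0 \<le> pos_deg w"
  by (induction w) auto

lemma deg_le_pos_deg: "deg w \<le> pos_deg w"
  by (induction w) auto

lemma reduced_syl_cons: "reduced w \<Longrightarrow> reduced (syl_cons (j, e) w)"
proof (cases w)
  case (Cons a w')
  then show "reduced w \<Longrightarrow> ?thesis"
    by (cases a; cases w') auto
qed auto

lemma set_syl_cons: "fst ` set (syl_cons (j, e) w) \<subseteq> insert j (fst ` set w)"
  by (cases "((j, e), w)" rule: syl_cons.cases) auto

lemma deg_syl_cons [simp]: "deg (syl_cons (j, e) w) = e + deg w"
  by (cases "((j, e), w)" rule: syl_cons.cases) auto

lemma total_exponent_syl_cons [simp]:
  "total_exponent k (syl_cons (j, e) w) = (if j = k then e else 0) + total_exponent k w"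
  by (cases "((j, e), w)" rule: syl_cons.cases) auto

lemma length_syl_cons: "length (syl_cons (j, e) w) \<le> Suc (length w)"
  by (cases "((j, e), w)" rule: syl_cons.cases) auto

lemma pos_deg_syl_cons: "pos_deg (syl_cons (j, e) w) \<le> max e 0 + pos_deg w"
  by (cases "((j, e), w)" rule: syl_cons.cases) auto

lemma syl_cons_zero [simp]: "syl_cons (j, 0) w = w"
  by (cases w) auto

text \<open>If the inner multiplication cancels the first syllable, the next one belongs to another
  variable, so the outer multiplication does not merge once more.\<close>

lemma syl_cons_syl_cons:
  "reduced w \<Longrightarrow> syl_cons (j, a) (syl_cons (j, b) w) = syl_cons (j, a + b) w"
proof (cases w)
  case (Cons x w')
  then show "reduced w \<Longrightarrow> ?thesis"
    by (cases x; cases w') auto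
qed auto

lemma syl_cons_eq_iff:
  assumes "reduced u" "reduced v"
  shows "syl_cons (j, s) v = u \<longleftrightarrow> v = syl_cons (j, - s) u"
  using assms syl_cons_syl_cons[of v j "-s" s] syl_cons_syl_cons[of u j s "-s"] by auto

lemma reduced_words_syl_cons:
  "w \<in> reduced_words n \<Longrightarrow> j \<in> {1..n} \<Longrightarrow> syl_cons (j, e) w \<in> reduced_words n"
  using set_syl_cons[of j e w] reduced_syl_cons[of w j e] unfolding reduced_words_def by blast

lemma word_mult_bounds:
  shows "reduced v \<Longrightarrow> reduced (word_mult u v)"
    and "fst ` set (word_mult u v) \<subseteq> fst ` set u \<union> fst ` set v"
    and "deg (word_mult u v) = deg u + deg v"
    and "total_exponent k (word_mult u v) = total_exponent k u + total_exponent k v"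
    and "length (word_mult u v) \<le> length u + length v"
    and "pos_deg (word_mult u v) \<le> pos_deg u + pos_deg v"
proof (induction u)
  case (Cons x u)
  obtain j e where x: "x = (j, e)" by (cases x)
  {
    case 1 then show ?case using Cons reduced_syl_cons x by auto
  next
    case 2
    then show ?case using Cons(2) set_syl_cons[of j e "word_mult u v"] unfolding x
      by (simp del: syl_cons.simps) blast
  next
    case 3 then show ?case using Cons x by auto
  next
    case 4 then show ?case using Cons x by auto
  next
    case 5 then show ?case using Cons(5) length_syl_cons[of j e "word_mult u v"] x by auto
  next
    case 6 then show ?case using Cons(6) pos_deg_syl_cons[of j e "word_mult u v"] x by auto
  }
qed auto

lemma word_mult_Nil_reduced: "reduced w \<Longrightarrow> word_mult w [] = w"
proof (induction w)
  case (Cons x w)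
  then show ?case by (cases x; cases w) auto
qed auto

lemma deg_eq_sum_total_exponent:
  "fst ` set w \<subseteq> {1..n} \<Longrightarrow> deg w = (\<Sum>j\<in>{1..n}. total_exponent j w)"
proof (induction w)
  case (Cons x w)
  obtain k e where x: "x = (k, e)" by (cases x)
  have "(\<Sum>j\<in>{1..n}. if k = j then e else 0) = e"
    using Cons(2) x by (subst sum.delta') auto
  then show ?case using Cons x by (auto simp: sum.distrib)
qed auto

lemma mem_le_pos_deg: "(j, e) \<in> set w \<Longrightarrow> e \<le> pos_deg w"
  using pos_deg_nonneg by (induction w) (auto simp: add_increasing max_def, smt (verit))

lemma mem_deg_ge: "(j, e) \<in> set w \<Longrightarrow> deg w - pos_deg w \<le> e"
  using deg_le_pos_deg by (induction w) (auto, smt (verit))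

text \<open>A single exponent is at most \<open>M\<close>, and at least \<open>K - M\<close> because
  the remaining exponents add up to at most \<open>M\<close>. Hence letters, exponents and lengths
  all range over finite sets.\<close>

lemma finite_words_bounded:
  "finite {w. fst ` set w \<subseteq> {1..n} \<and> length w \<le> L \<and> pos_deg w \<le> M \<and> K \<le> deg w}"
proof (rule finite_subset)
  show "{w. fst ` set w \<subseteq> {1..n} \<and> length w \<le> L \<and> pos_deg w \<le> M \<and> K \<le> deg w}
    \<subseteq> {w. set w \<subseteq> {1..n} \<times> {K - M..M} \<and> length w \<le> L}"
    using mem_le_pos_deg mem_deg_ge by clarsimp (smt (verit) atLeastAtMost_iff fst_conv imageI in_mono)
qed (rule finite_lists_length_le, auto)


section \<open>The carrier\<close>

definition bounded_series :: "nat \<Rightarrow> nat \<Rightarrow> int \<Rightarrow> (word \<Rightarrow> 'a::zero) \<Rightarrow> bool" where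
  "bounded_series n L M D \<longleftrightarrow>
     (\<forall>w. D w \<noteq> 0 \<longrightarrow> w \<in> reduced_words n \<and> length w \<le> L \<and> pos_deg w \<le> M)"

text \<open>The weaker size condition: it suffices for evaluating \<open>syl\<close> by finite sums,
  and its bound simply adds under products. \<open>bounded_series\<close> describes the carrier and
  is what makes supports finite above a given degree.\<close>

definition deg_bounded :: "nat \<Rightarrow> int \<Rightarrow> (word \<Rightarrow> 'a::zero) \<Rightarrow> bool" where
  "deg_bounded n d D \<longleftrightarrow> (\<forall>w. D w \<noteq> 0 \<longrightarrow> w \<in> reduced_words n \<and> deg w \<le> d)"

lemma bounded_series_deg_bounded: "bounded_series n L M D \<Longrightarrow> deg_bounded n M D"
  unfolding bounded_series_def deg_bounded_def using deg_le_pos_deg order_trans by blast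

lemma bounded_series_mono:
  "bounded_series n L M D \<Longrightarrow> L \<le> L' \<Longrightarrow> M \<le> M' \<Longrightarrow> bounded_series n L' M' D"
  unfolding bounded_series_def by fastforce

lemma deg_bounded_mono: "deg_bounded n d D \<Longrightarrow> d \<le> d' \<Longrightarrow> deg_bounded n d' D"
  unfolding deg_bounded_def by fastforce

lemma finite_support_deg_ge:
  assumes "bounded_series n L M D"
  shows "finite {w. D w \<noteq> 0 \<and> K \<le> deg w}"
  by (rule finite_subset[OF _ finite_words_bounded[of n L M K]])
    (use assms in \<open>auto simp: bounded_series_def reduced_words_def\<close>)

lemma zip_bounds:
  assumes "length xs = length row" "\<forall>e\<in>set row. e < N" "0 < N"
  shows "pos_deg (zip xs row) \<le> int (length row) * N"
  using assms
proof (induction xs row rule: list_induct2)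
  case (Cons x xs y ys)
  then have "max y 0 \<le> N" "0 \<le> N" "pos_deg (zip xs ys) \<le> int (length ys) * N" by auto
  then show ?case by (simp add: algebra_simps del: max.bounded_iff)
qed auto

lemma concat_rows_bounds:
  assumes "\<forall>row\<in>set i. length row = n \<and> (\<forall>e\<in>set row. e < N)" "0 < N"
  defines "u \<equiv> concat (map (\<lambda>row. zip [1..<Suc n] row) i)"
  shows "length u \<le> length i * n" "pos_deg u \<le> int (length i * n) * N" "fst ` set u \<subseteq> {1..n}"
  using assms(1) unfolding u_def
proof (induction i)
  case (Cons row i)
  have row: "pos_deg (zip [1..<Suc n] row) \<le> int n * N"
    if "length row = n \<and> (\<forall>e\<in>set row. e < N)"
    using zip_bounds[of "[1..<Suc n]" row N] that assms(2) by auto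
  have app: "pos_deg (a @ b) = pos_deg a + pos_deg b" for a b
    by (simp add: pos_deg_def)
  {
    case 1 then show ?case using Cons by auto
  next
    case 2
    then have "pos_deg (concat (map (zip [1..<Suc n]) i)) \<le> int (length i * n) * N"
      using Cons(2) by auto
    moreover have "pos_deg (zip [1..<Suc n] row) \<le> int n * N" using row 2 by auto
    ultimately show ?case by (simp add: app algebra_simps del: upt_Suc)
  next
    case 3
    then show ?case using Cons(3) by (auto dest!: set_zip_leftD simp del: upt_Suc)
  }
qed auto

definition unit_row :: "nat \<Rightarrow> nat \<times> int \<Rightarrow> int list" where
  "unit_row n x = map (\<lambda>k. if k = fst x then snd x else 0) [1..<Suc n]"

lemma word_mult_append: "word_mult (a @ b) v = word_mult a (word_mult b v)"
  by (simp add: word_mult_def)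

lemma word_mult_zero_syllables: "\<forall>x\<in>set u. snd x = 0 \<Longrightarrow> word_mult u v = v"
  by (induction u) auto

lemma word_mult_unit_row:
  assumes "j \<in> {1..n}"
  shows "word_mult (zip [1..<Suc n] (unit_row n (j, e))) v = syl_cons (j, e) v"
proof -
  define f where "f = (\<lambda>k. (k, if k = j then e else (0::int)))"
  have "[1..<Suc n] = [1..<j] @ j # [Suc j..<Suc n]"
    using assms upt_add_eq_append[of 1 j "Suc n - j"] upt_conv_Cons[of j "Suc n"] by auto
  moreover have "zip xs (map (\<lambda>k. if k = j then e else 0) xs) = map f xs" for xs
    by (simp add: f_def zip_map2 zip_same_conv_map)
  ultimately have "zip [1..<Suc n] (unit_row n (j, e)) = map f [1..<j] @ f j # map f [Suc j..<Suc n]"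
    unfolding unit_row_def fst_conv snd_conv by (metis list.simps(9) map_append)
  then show ?thesis
    by (simp add: word_mult_append word_mult_zero_syllables f_def)
qed

text \<open>One row per syllable, then zero rows, which spell the empty word; the padding gives all
  words of a series the same number of rows.\<close>

definition word_array :: "nat \<Rightarrow> nat \<Rightarrow> word \<Rightarrow> int list list" where
  "word_array n m w = map (unit_row n) w @ replicate (m - length w) (replicate n 0)"

lemma array_word_word_array:
  assumes "w \<in> reduced_words n"
  shows "array_word n (word_array n m w) = w"
proof -
  have zero: "word_mult (concat (map (\<lambda>row. zip [1..<Suc n] row) (replicate k (replicate n 0)))) v = v"
    for k v
    by (rule word_mult_zero_syllables) (auto dest: set_zip_rightD)
  have "word_mult (concat (map (\<lambda>row. zip [1..<Suc n] row) (map (unit_row n) u))) v = word_mult u v"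
    if "fst ` set u \<subseteq> {1..n}" for u v
    using that
  proof (induction u)
    case (Cons x u)
    then show ?case
      using word_mult_unit_row[of "fst x" n "snd x"] by (simp add: word_mult_append)
  qed simp
  then show ?thesis
    using assms unfolding array_word_def word_array_def reduced_words_def
    by (simp add: word_mult_append zero word_mult_Nil_reduced del: map_replicate upt_Suc One_nat_def)
qed

lemma is_array_word_array:
  assumes "pos_deg w \<le> M" "length w \<le> m"
  shows "is_array n m (M + 1) (word_array n m w)"
proof -
  have "e < M + 1" if "(j, e) \<in> set w" for j e
    using mem_le_pos_deg[OF that] assms by simp
  moreover have "0 < M + 1" using pos_deg_nonneg[of w] assms by simp
  ultimately show ?thesis
    using assms unfolding is_array_def word_array_def unit_row_def by auto
qed

text \<open>An array with \<open>m\<close> rows has \<open>m * n\<close> entries, which bounds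
  length and positive parts of the word it spells. Conversely, every word is spelled by its
  canonical array.\<close>

lemma Psi0_carrier_iff:
  fixes D :: "word \<Rightarrow> 'a::{ring,monoid_mult}"
  shows "D \<in> Psi0_carrier n \<longleftrightarrow> (\<exists>L M. bounded_series n L M D)"
proof
  assume "D \<in> Psi0_carrier n"
  then obtain a m N where D: "D = array_series n a"
    and N: "\<And>i. a i \<noteq> 0 \<Longrightarrow> is_array n m N i"
    unfolding Psi0_carrier_def by blast
  \<comment> \<open>The estimate of the positive parts needs a positive bound on the
    entries.\<close>
  define N' where "N' = max N 1"
  have "bounded_series n (m * n) (int (m * n) * N') D"
    unfolding bounded_series_def
  proof (intro allI impI)
    fix w assume "D w \<noteq> 0"
    then obtain i where i: "a i \<noteq> 0" "array_word n i = w"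
      unfolding D array_series_def by (metis (mono_tags, lifting) mem_Collect_eq sum.neutral)
    let ?u = "concat (map (\<lambda>row. zip [1..<Suc n] row) i)"
    have w: "w = word_mult ?u []" using i by (simp add: array_word_def)
    have rows: "length i = m" "\<forall>row\<in>set i. length row = n \<and> (\<forall>e\<in>set row. e < N')"
      using N[OF i(1)] unfolding is_array_def N'_def by force+
    have "0 < N'" by (simp add: N'_def)
    note b = concat_rows_bounds[OF rows(2) this]
    show "w \<in> reduced_words n \<and> length w \<le> m * n \<and> pos_deg w \<le> int (m * n) * N'"
      using b word_mult_bounds(1)[of "[]" ?u] word_mult_bounds(2,5,6)[of ?u "[]"] rows(1)
      unfolding w reduced_words_def by auto
  qed
  then show "\<exists>L M. bounded_series n L M D" by blast
next
  assume "\<exists>L M. bounded_series n L M D"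
  then obtain L M where b: "bounded_series n L M D" by blast
  \<comment> \<open>\<open>Suc L\<close> instead of \<open>L\<close>, since the number of rows must
    be positive.\<close>
  let ?m = "Suc L"
  \<comment> \<open>The family lives on canonical arrays only, so each word is spelled once and no
    coefficients are added up.\<close>
  define a where "a = (\<lambda>i. let w = array_word n i in if i = word_array n ?m w then D w else 0)"
  have "D w = array_series n a w" for w
  proof (cases "D w = 0")
    case True
    then have "{i. a i \<noteq> 0 \<and> array_word n i = w} = {}" by (auto simp: a_def Let_def)
    then show ?thesis using True unfolding array_series_def by (simp only: sum.empty)
  next
    case False
    then have "array_word n (word_array n ?m w) = w"
      using b array_word_word_array unfolding bounded_series_def by blast
    with False have "{i. a i \<noteq> 0 \<and> array_word n i = w} = {word_array n ?m w}"
      by (auto simp: a_def Let_def)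
    then show ?thesis
      using \<open>array_word n (word_array n ?m w) = w\<close> unfolding array_series_def by (simp add: a_def)
  qed
  moreover have "is_array n ?m (M + 1) i" if "a i \<noteq> 0" for i
  proof -
    define w where "w = array_word n i"
    have "i = word_array n ?m w" "D w \<noteq> 0"
      using that unfolding a_def w_def Let_def by (auto split: if_splits)
    then show ?thesis using b is_array_word_array[of w M ?m n] unfolding bounded_series_def by auto
  qed
  ultimately show "D \<in> Psi0_carrier n"
    unfolding Psi0_carrier_def by blast
qed

section \<open>Commutation coefficients\<close>

lemma additive_foldr:
  assumes "\<And>x. x \<in> set xs \<Longrightarrow> Modules.additive (f x)"
  shows "Modules.additive (foldr f xs)"
  using assms by (induction xs) (auto simp: Modules.additive_def)

lemma additive_fold:
  assumes "\<And>x. x \<in> set xs \<Longrightarrow> Modules.additive (f x)"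
  shows "Modules.additive (fold f xs)"
  using additive_foldr[of "rev xs" f] assms by (simp add: foldr_conv_fold)

lemma additive_funpow:
  fixes f :: "'a::ab_group_add \<Rightarrow> 'a"
  shows "Modules.additive f \<Longrightarrow> Modules.additive (f ^^ k)"
  by (induction k) (auto simp: Modules.additive_def)

lemma additive_sum_functions:
  "(\<And>x. x \<in> S \<Longrightarrow> Modules.additive (f x)) \<Longrightarrow> Modules.additive (\<lambda>a. \<Sum>x\<in>S. f x a)"
  by (auto simp: Modules.additive_def sum.distrib[symmetric] intro!: sum.cong)

lemma minus_one_power_Suc_mult:
  fixes x :: "'a::{ring,monoid_mult}"
  shows "(- 1) ^ Suc t * x = - ((- 1) ^ t * x)"
  by (simp add: mult.assoc)

text \<open>The signs are powers of the ring element -1, not scalars; additivity alone lets them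
  pass through \<sigma> and \<delta>.\<close>

lemma additive_minus_one_power_mult:
  fixes f :: "'a::{ring,monoid_mult} \<Rightarrow> 'a"
  assumes "Modules.additive f"
  shows "f ((- 1) ^ t * x) = (- 1) ^ t * f x"
  by (induction t) (simp_all only: minus_one_power_Suc_mult additive.minus[OF assms], simp_all)

lemma finite_lists_sum: "finite {is :: nat list. length is = r \<and> sum_list is = t}"
  by (rule finite_subset[OF _ finite_lists_length_eq[of "{..t}" r]])
    (auto dest: member_le_sum_list)

lemma finite_lists_count: "finite {bs :: bool list. length bs = r \<and> count_list bs True = i}"
  by (rule finite_subset[OF _ finite_lists_length_eq[of UNIV r]]) auto

context
  fixes \<sigma> \<delta> :: "'a::{ring,monoid_mult} \<Rightarrow> 'a"
  assumes add_\<sigma>: "Modules.additive \<sigma>" and add_\<delta>: "Modules.additive \<delta>" and bij_\<sigma>: "bij \<sigma>"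
begin

abbreviation "\<rho> \<equiv> inv_into UNIV \<sigma>"

lemma \<sigma>_\<rho> [simp]: "\<sigma> (\<rho> x) = x"
  using bij_\<sigma> by (simp add: bij_is_surj surj_f_inv_f)

lemma additive_\<rho>: "Modules.additive \<rho>"
  using bij_\<sigma> add_\<sigma> unfolding Modules.additive_def
  by (metis bij_inv_eq_iff)

lemma P_sum_0_0: "P_sum \<sigma> \<delta> 0 0 a = a"
proof -
  have "{bs::bool list. length bs = 0 \<and> count_list bs True = 0} = {[]}" by auto
  then show ?thesis unfolding P_sum_def by simp
qed

lemma P_sum_gt: "r < i \<Longrightarrow> P_sum \<sigma> \<delta> i r a = 0"
proof -
  assume "r < i"
  then have "{bs. length bs = r \<and> count_list bs True = i} = {}"
    using count_le_length[of _ True] by (auto simp: leD)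
  then show ?thesis unfolding P_sum_def by (simp only: sum.empty)
qed

lemma P_sum_0_Suc: "P_sum \<sigma> \<delta> 0 (Suc r) a = \<delta> (P_sum \<sigma> \<delta> 0 r a)"
proof -
  have *: "{bs. length bs = Suc r \<and> count_list bs True = 0}
      = (#) False ` {bs. length bs = r \<and> count_list bs True = 0}"
    by (auto simp: length_Suc_conv split: if_splits)
  show ?thesis unfolding P_sum_def *
    by (subst sum.reindex) (auto simp: additive.sum[OF add_\<delta>])
qed

text \<open>Words are split by their outermost letter, which is the head of the Boolean
  list.\<close>

lemma P_sum_Suc_Suc:
  "P_sum \<sigma> \<delta> (Suc i) (Suc r) a = \<sigma> (P_sum \<sigma> \<delta> i r a) + \<delta> (P_sum \<sigma> \<delta> (Suc i) r a)"
proof -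
  let ?S = "\<lambda>i. {bs. length bs = r \<and> count_list bs True = i}"
  have *: "{bs. length bs = Suc r \<and> count_list bs True = Suc i}
      = (#) True ` ?S i \<union> (#) False ` ?S (Suc i)" (is "_ = ?A \<union> ?B")
    by (auto simp: length_Suc_conv split: if_splits)
  show ?thesis unfolding P_sum_def *
    by (subst sum.union_disjoint)
      (auto simp: finite_lists_count sum.reindex additive.sum[OF add_\<delta>] additive.sum[OF add_\<sigma>])
qed

text \<open>Without the sign, the recursions below are plain decompositions of the index
  set.\<close>

definition unsigned_Q_sum :: "nat \<Rightarrow> nat \<Rightarrow> 'a \<Rightarrow> 'a" where
  "unsigned_Q_sum t r a =
     (\<Sum>is | length is = r \<and> sum_list is = t. fold (\<lambda>i x. \<rho> (((\<delta> \<circ> \<rho>) ^^ i) x)) is a)"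

lemma Q_sum_eq: "Q_sum \<sigma> \<delta> t r a = (-1) ^ t * unsigned_Q_sum t r a"
  by (simp add: Q_sum_def unsigned_Q_sum_def Let_def sum_distrib_left)

lemma unsigned_Q_sum_0: "unsigned_Q_sum t 0 a = (if t = 0 then a else 0)"
proof -
  have "{is :: nat list. length is = 0 \<and> sum_list is = t} = (if t = 0 then {[]} else {})" by auto
  then show ?thesis unfolding unsigned_Q_sum_def by simp
qed

lemma unsigned_Q_sum_0_Suc: "unsigned_Q_sum 0 (Suc r) a = \<rho> (unsigned_Q_sum 0 r a)"
proof -
  have *: "{is :: nat list. length is = Suc r \<and> sum_list is = 0}
      = (\<lambda>js. js @ [0]) ` {is. length is = r \<and> sum_list is = 0}"
    by (auto simp: length_Suc_conv_rev)
  show ?thesis unfolding unsigned_Q_sum_def *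
    by (subst sum.reindex) (auto simp: inj_on_def additive.sum[OF additive_\<rho>])
qed

text \<open>The last list entry belongs to the outermost factor. If it is 0, that factor is a bare
  \<open>\<rho>\<close>; if it is positive, one outer \<open>\<rho> \<circ> \<delta>\<close> can be
  split off, which lowers the entry by one.\<close>

lemma unsigned_Q_sum_Suc_Suc:
  "unsigned_Q_sum (Suc t) (Suc r) a =
     \<rho> (unsigned_Q_sum (Suc t) r a) + \<rho> (\<delta> (unsigned_Q_sum t (Suc r) a))"
proof -
  let ?S = "\<lambda>t r. {is :: nat list. length is = r \<and> sum_list is = t}"
  let ?g = "\<lambda>js. butlast js @ [Suc (last js)]"
  let ?f = "\<lambda>i x. \<rho> (((\<delta> \<circ> \<rho>) ^^ i) x)"
  have snoc: "\<exists>ls k. js = ls @ [k]" if "js \<in> ?S t (Suc r)" for js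
    using that by (cases js rule: rev_cases) auto
  have *: "?S (Suc t) (Suc r) = (\<lambda>js. js @ [0]) ` ?S (Suc t) r \<union> ?g ` ?S t (Suc r)"
  proof (intro equalityI subsetI)
    fix ks :: "nat list" assume A: "ks \<in> ?S (Suc t) (Suc r)"
    then obtain js i where js: "ks = js @ [i]" "length js = r"
      by (auto simp: length_Suc_conv_rev)
    show "ks \<in> (\<lambda>js. js @ [0]) ` ?S (Suc t) r \<union> ?g ` ?S t (Suc r)"
    proof (cases i)
      case 0
      then show ?thesis using A js by auto
    next
      case (Suc k)
      then have "ks = ?g (js @ [k])" "js @ [k] \<in> ?S t (Suc r)" using A js by auto
      then show ?thesis by blast
    qed
  next
    fix ks :: "nat list"
    assume "ks \<in> (\<lambda>js. js @ [0]) ` ?S (Suc t) r \<union> ?g ` ?S t (Suc r)"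
    then show "ks \<in> ?S (Suc t) (Suc r)" using snoc by fastforce
  qed
  have inj: "inj_on ?g (?S t (Suc r))"
    by (auto intro!: inj_on_inverseI[where g = "\<lambda>ks. butlast ks @ [last ks - 1]"]
        append_butlast_last_id)
  have step: "fold ?f (?g js) a = \<rho> (\<delta> (fold ?f js a))" if "js \<in> ?S t (Suc r)" for js
    using snoc[OF that] by auto
  have "(\<Sum>is\<in>?S (Suc t) (Suc r). fold ?f is a)
      = (\<Sum>js\<in>?S (Suc t) r. fold ?f (js @ [0]) a) + (\<Sum>js\<in>?S t (Suc r). fold ?f (?g js) a)"
    unfolding * by (subst sum.union_disjoint)
      (auto simp: finite_lists_sum sum.reindex[OF inj] sum.reindex inj_on_def)
  also have "(\<Sum>js\<in>?S t (Suc r). fold ?f (?g js) a)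
      = (\<Sum>js\<in>?S t (Suc r). \<rho> (\<delta> (fold ?f js a)))"
    by (rule sum.cong[OF refl]) (rule step)
  also have "(\<Sum>js\<in>?S (Suc t) r. fold ?f (js @ [0]) a) = (\<Sum>js\<in>?S (Suc t) r. \<rho> (fold ?f js a))"
    by (rule sum.cong[OF refl]) simp
  finally show ?thesis
    unfolding unsigned_Q_sum_def additive.sum[OF add_\<delta>] additive.sum[OF additive_\<rho>] .
qed

text \<open>This is xi xi^(-r-1) a = xi^(-r) a, read off at one power of xi. The sign turns the
  derivation term of the unsigned recursion over to the other side.\<close>

lemma Q_sum_Suc_Suc:
  "Q_sum \<sigma> \<delta> (Suc t) r a = \<sigma> (Q_sum \<sigma> \<delta> (Suc t) (Suc r) a) + \<delta> (Q_sum \<sigma> \<delta> t (Suc r) a)"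
proof -
  have "\<sigma> (unsigned_Q_sum (Suc t) (Suc r) a)
      = unsigned_Q_sum (Suc t) r a + \<delta> (unsigned_Q_sum t (Suc r) a)"
    by (simp add: unsigned_Q_sum_Suc_Suc additive.add[OF add_\<sigma>])
  then show ?thesis
    unfolding Q_sum_eq additive_minus_one_power_mult[OF add_\<sigma>]
      additive_minus_one_power_mult[OF add_\<delta>]
    by (simp only: minus_one_power_Suc_mult) (simp add: distrib_left)
qed

lemma Q_sum_0_Suc: "Q_sum \<sigma> \<delta> 0 r a = \<sigma> (Q_sum \<sigma> \<delta> 0 (Suc r) a)"
  unfolding Q_sum_eq by (simp add: unsigned_Q_sum_0_Suc)

lemma Q_sum_0: "Q_sum \<sigma> \<delta> t 0 a = (if t = 0 then a else 0)"
  unfolding Q_sum_eq unsigned_Q_sum_0 by simp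

lemma xi_coeff_0: "xi_coeff \<sigma> \<delta> 0 s a = (if s = 0 then a else 0)"
  by (auto simp: xi_coeff_def P_sum_0_0)

lemma xi_coeff_gt: "e < s \<Longrightarrow> xi_coeff \<sigma> \<delta> e s a = 0"
  by (simp add: xi_coeff_def)

text \<open>Coefficient comparison in xi^(e+1) a = xi (xi^e a), using xi b = \<sigma>(b) xi +
  \<delta>(b). It holds uniformly for all integers \<open>e\<close>, across the change of formula at
  0.\<close>

lemma xi_coeff_add_one:
  "xi_coeff \<sigma> \<delta> (e + 1) s a = \<sigma> (xi_coeff \<sigma> \<delta> e (s - 1) a) + \<delta> (xi_coeff \<sigma> \<delta> e s a)"
proof -
  note z = additive.zero[OF add_\<sigma>] additive.zero[OF add_\<delta>]
  consider "0 \<le> e" "s < 0" | "0 \<le> e" "s = 0" | "0 \<le> e" "0 < s"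
    | "e < 0" "s \<le> e" | "e < 0" "s = e + 1" | "e < 0" "e + 1 < s" by linarith
  then show ?thesis
  proof cases
    case 1 then show ?thesis by (simp add: xi_coeff_def z)
  next
    case 2
    then have "nat (e + 1) = Suc (nat e)" by simp
    with 2 show ?thesis by (simp add: xi_coeff_def z P_sum_0_Suc)
  next
    case 3
    then have e: "nat (e + 1) = Suc (nat e)" "nat s = Suc (nat (s - 1))" by simp_all
    show ?thesis
    proof (cases "s \<le> e + 1")
      case True
      then show ?thesis
        using 3 P_sum_Suc_Suc[of "nat (s - 1)" "nat e" a, folded e] P_sum_gt[of "nat e" "nat s" a]
        by (auto simp: xi_coeff_def z)
    qed (use 3 in \<open>simp add: xi_coeff_def z\<close>)
  next
    case 4
    define r where "r = nat (- e - 1)"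
    define t where "t = nat (e - s)"
    have e: "e = - int (Suc r)" and s: "s = - int (Suc r) - int t"
      using 4 unfolding r_def t_def by linarith+
    have "xi_coeff \<sigma> \<delta> (e + 1) s a = Q_sum \<sigma> \<delta> (Suc t) r a"
    \<comment> \<open>For \<open>r = 0\<close> we have \<open>e = - 1\<close>, so
      \<open>e + 1 = 0\<close> is governed by the formula for nonnegative powers; both sides vanish
      because \<open>s < 0\<close>.\<close>
    proof (cases r)
      case 0
      then show ?thesis unfolding e s by (simp add: xi_coeff_def Q_sum_0)
    next
      case (Suc k)
      then have "\<not> 0 \<le> e + 1" "s \<le> e + 1" "nat (- (e + 1)) = r" "nat (e + 1 - s) = Suc t"
        unfolding e s by linarith+
      then show ?thesis by (simp only: xi_coeff_def if_False if_True)
    qed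
    moreover have "xi_coeff \<sigma> \<delta> e (s - 1) a = Q_sum \<sigma> \<delta> (Suc t) (Suc r) a"
    proof -
      have "\<not> 0 \<le> e" "s - 1 \<le> e" "nat (- e) = Suc r" "nat (e - (s - 1)) = Suc t"
        unfolding e s by linarith+
      then show ?thesis by (simp only: xi_coeff_def if_False if_True)
    qed
    moreover have "xi_coeff \<sigma> \<delta> e s a = Q_sum \<sigma> \<delta> t (Suc r) a"
    proof -
      have "\<not> 0 \<le> e" "s \<le> e" "nat (- e) = Suc r" "nat (e - s) = t"
        unfolding e s by linarith+
      then show ?thesis by (simp only: xi_coeff_def if_False if_True)
    qed
    ultimately show ?thesis using Q_sum_Suc_Suc[of t r a] by (simp only:)
  next
    case 5
    define r where "r = nat (- e - 1)"
    have eqs: "nat (- e) = Suc r" "nat (- (e + 1)) = r" using 5 unfolding r_def by linarith+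
    have "xi_coeff \<sigma> \<delta> (e + 1) s a = Q_sum \<sigma> \<delta> 0 r a"
    \<comment> \<open>Here the change of formula affects the leading coefficient:
      \<open>P_sum\<close> and \<open>Q_sum\<close> both give \<open>a\<close> for the power
      0.\<close>
    proof (cases "e = -1")
      case True
      then show ?thesis using 5 by (simp add: xi_coeff_def r_def Q_sum_0 P_sum_0_0)
    next
      case False
      then show ?thesis using 5 unfolding xi_coeff_def eqs by simp
    qed
    moreover have "xi_coeff \<sigma> \<delta> e e a = Q_sum \<sigma> \<delta> 0 (Suc r) a" "xi_coeff \<sigma> \<delta> e s a = 0"
      using 5 unfolding xi_coeff_def eqs by simp_all
    ultimately show ?thesis using Q_sum_0_Suc[of r a, symmetric] 5 by (simp add: z)
  next
    case 6 then show ?thesis by (auto simp: xi_coeff_def z)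
  qed
qed

lemma additive_xi_coeff: "Modules.additive (xi_coeff \<sigma> \<delta> e s)"
proof -
  have "Modules.additive (P_sum \<sigma> \<delta> i r)" for i r
    unfolding P_sum_def[abs_def]
    by (intro additive_sum_functions additive_foldr) (auto simp: add_\<sigma> add_\<delta>)
  moreover have "Modules.additive (\<delta> \<circ> \<rho>)"
    using add_\<delta> additive_\<rho> by (auto simp: Modules.additive_def)
  then have "Modules.additive (\<lambda>x. \<rho> (((\<delta> \<circ> \<rho>) ^^ i) x))" for i
    using additive_funpow[of "\<delta> \<circ> \<rho>" i] additive_\<rho> by (auto simp: Modules.additive_def)
  then have "Modules.additive (unsigned_Q_sum t r)" for t r
    unfolding unsigned_Q_sum_def[abs_def]
    by (intro additive_sum_functions additive_fold) auto
  then have "Modules.additive (Q_sum \<sigma> \<delta> t r)" for t r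
    by (auto simp: Modules.additive_def Q_sum_eq[abs_def] distrib_left)
  ultimately show ?thesis
    by (auto simp: xi_coeff_def[abs_def] Modules.additive_def)
qed

end

section \<open>Words acting on series\<close>

locale twisted_system =
  fixes n :: nat and \<sigma> :: "'a::{ring,monoid_mult} \<Rightarrow> 'a" and \<delta> :: "nat \<Rightarrow> 'a \<Rightarrow> 'a"
  assumes \<sigma>_add: "\<sigma> (x + y) = \<sigma> x + \<sigma> y"
    and \<sigma>_mult: "\<sigma> (x * y) = \<sigma> x * \<sigma> y"
    and \<sigma>_one: "\<sigma> 1 = 1"
    and bij_\<sigma>: "bij \<sigma>"
    and \<delta>_add: "j \<in> {1..n} \<Longrightarrow> \<delta> j (x + y) = \<delta> j x + \<delta> j y"
    and \<delta>_mult: "j \<in> {1..n} \<Longrightarrow> \<delta> j (x * y) = \<delta> j x * y + \<sigma> x * \<delta> j y"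
begin

lemma additive_\<sigma>: "Modules.additive \<sigma>"
  by (simp add: Modules.additive_def \<sigma>_add)

lemma additive_\<delta>: "j \<in> {1..n} \<Longrightarrow> Modules.additive (\<delta> j)"
  by (simp add: Modules.additive_def \<delta>_add)

lemmas \<sigma>_0 [simp] = additive.zero[OF additive_\<sigma>]
lemmas \<delta>_0 [simp] = additive.zero[OF additive_\<delta>]
lemmas \<sigma>_sum = additive.sum[OF additive_\<sigma>]
lemmas \<delta>_sum = additive.sum[OF additive_\<delta>]
lemmas add_one_xi = xi_coeff_add_one[OF additive_\<sigma> additive_\<delta> bij_\<sigma>]
lemmas additive_xi = additive_xi_coeff[OF additive_\<sigma> additive_\<delta> bij_\<sigma>]
lemmas xi_0 [simp] = additive.zero[OF additive_xi]

lemma \<sigma>_eq_0_iff: "\<sigma> x = 0 \<longleftrightarrow> x = 0"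
  using bij_\<sigma> \<sigma>_0 by (metis bij_pointE)

lemma \<delta>_one: "j \<in> {1..n} \<Longrightarrow> \<delta> j 1 = 0"
  using \<delta>_mult[of j 1 1] by (simp add: \<sigma>_one)

text \<open>Left multiplication by \<open>\<xi>\<^sub>j\<^sup>e\<close>, where \<open>x = (j, e)\<close>.\<close>

definition syl :: "nat \<times> int \<Rightarrow> (word \<Rightarrow> 'a) \<Rightarrow> word \<Rightarrow> 'a" where
  "syl x G u = (if reduced u then
     \<Sum>s | s \<le> snd x \<and> G (syl_cons (fst x, - s) u) \<noteq> 0.
       xi_coeff \<sigma> (\<delta> (fst x)) (snd x) s (G (syl_cons (fst x, - s) u)) else 0)"

definition act :: "word \<Rightarrow> (word \<Rightarrow> 'a) \<Rightarrow> word \<Rightarrow> 'a" where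
  "act w = foldr syl w"

lemma act_simps [simp]: "act [] G = G" "act (x # w) G = syl x (act w G)"
  by (simp_all add: act_def)

text \<open>For \<open>s\<close> below \<open>deg u - d\<close> the argument of \<open>G\<close> has
  degree above \<open>d\<close>. The interval does not depend on the support of \<open>G\<close>, so
  sums for different series or exponents can share one index set.\<close>

lemma syl_eq_sum:
  assumes j: "j \<in> {1..n}" and G: "deg_bounded n d G" and u: "reduced u" and lo: "lo \<le> deg u - d"
  shows "syl (j, e) G u = (\<Sum>s\<in>{lo..e}. xi_coeff \<sigma> (\<delta> j) e s (G (syl_cons (j, - s) u)))"
proof -
  have "{s. s \<le> e \<and> G (syl_cons (j, - s) u) \<noteq> 0} \<subseteq> {lo..e}"
    using G lo unfolding deg_bounded_def by fastforce
  then show ?thesis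
    unfolding syl_def using u j by (auto intro!: sum.mono_neutral_left)
qed

lemma syl_nonzeroE:
  assumes "syl (j, e) G u \<noteq> 0"
  obtains s v where "s \<le> e" "G v \<noteq> 0" "v = syl_cons (j, - s) u" "reduced u"
    "xi_coeff \<sigma> (\<delta> j) e s (G v) \<noteq> 0"
proof -
  have "reduced u" using assms by (auto simp: syl_def split: if_splits)
  with assms have "(\<Sum>s | s \<le> e \<and> G (syl_cons (j, - s) u) \<noteq> 0.
       xi_coeff \<sigma> (\<delta> j) e s (G (syl_cons (j, - s) u))) \<noteq> 0"
    by (simp add: syl_def)
  then obtain s where "s \<in> {s. s \<le> e \<and> G (syl_cons (j, - s) u) \<noteq> 0}"
    "xi_coeff \<sigma> (\<delta> j) e s (G (syl_cons (j, - s) u)) \<noteq> 0"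
    by (rule sum.not_neutral_contains_not_neutral)
  then show ?thesis using that \<open>reduced u\<close> by auto
qed

lemma syl_deg_bounded:
  assumes "j \<in> {1..n}" "deg_bounded n d G"
  shows "deg_bounded n (d + e) (syl (j, e) G)"
  unfolding deg_bounded_def
proof (intro allI impI)
  fix u assume "syl (j, e) G u \<noteq> 0"
  then obtain s v where s: "s \<le> e" "G v \<noteq> 0" "v = syl_cons (j, - s) u" "reduced u"
    by (rule syl_nonzeroE)
  then have "u = syl_cons (j, s) v"
    using syl_cons_syl_cons[of u j s "-s"] by simp
  then show "u \<in> reduced_words n \<and> deg u \<le> d + e"
    using assms s reduced_words_syl_cons[of v n j s] unfolding deg_bounded_def by force
qed

lemma syl_bounded_series:
  assumes "j \<in> {1..n}" "bounded_series n L M G"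
  shows "bounded_series n (Suc L) (M + max e 0) (syl (j, e) G)"
  unfolding bounded_series_def
proof (intro allI impI)
  fix u assume "syl (j, e) G u \<noteq> 0"
  then obtain s v where s: "s \<le> e" "G v \<noteq> 0" "v = syl_cons (j, - s) u" "reduced u"
    by (rule syl_nonzeroE)
  then have u: "u = syl_cons (j, s) v"
    using syl_cons_syl_cons[of u j s "-s"] by simp
  have "v \<in> reduced_words n" "length v \<le> L" "pos_deg v \<le> M"
    using assms s unfolding bounded_series_def by auto
  then show "u \<in> reduced_words n \<and> length u \<le> Suc L \<and> pos_deg u \<le> M + max e 0"
    using reduced_words_syl_cons[of v n j s] length_syl_cons[of j s v] pos_deg_syl_cons[of j s v]
      assms(1) s(1) unfolding u by auto
qed

lemma syl_carrier:
  "j \<in> {1..n} \<Longrightarrow> G \<in> Psi0_carrier n \<Longrightarrow> syl (j, e) G \<in> Psi0_carrier n"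
  unfolding Psi0_carrier_iff using syl_bounded_series by blast

lemma act_carrier:
  "fst ` set w \<subseteq> {1..n} \<Longrightarrow> G \<in> Psi0_carrier n \<Longrightarrow> act w G \<in> Psi0_carrier n"
  by (induction w) (auto intro: syl_carrier)

lemma act_deg_bounded:
  "fst ` set w \<subseteq> {1..n} \<Longrightarrow> deg_bounded n d G \<Longrightarrow> deg_bounded n (d + deg w) (act w G)"
proof (induction w)
  case (Cons x w)
  then show ?case
    using syl_deg_bounded[of "fst x" "d + deg w" "act w G" "snd x"]
    by (cases x) (auto simp: algebra_simps)
qed simp

section \<open>Powers of one variable as invertible operators\<close>

lemma syl_one:
  assumes "j \<in> {1..n}" "deg_bounded n d G" "reduced u"
  shows "syl (j, 1) G u = \<sigma> (G (syl_cons (j, - 1) u)) + \<delta> j (G u)"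
proof -
  define lo where "lo = min 0 (deg u - d)"
  have 1: "xi_coeff \<sigma> (\<delta> j) 1 s a = (if s = 1 then \<sigma> a else if s = 0 then \<delta> j a else 0)" for s a
    using add_one_xi[OF assms(1), of 0 s a] assms(1)
    by (auto simp: xi_coeff_0[OF additive_\<sigma> additive_\<delta>[OF assms(1)] bij_\<sigma>])
  have "syl (j, 1) G u = (\<Sum>s\<in>{lo..1}. xi_coeff \<sigma> (\<delta> j) 1 s (G (syl_cons (j, - s) u)))"
    using assms by (intro syl_eq_sum) (auto simp: lo_def)
  also have "\<dots> = (\<Sum>s\<in>{0, 1}. xi_coeff \<sigma> (\<delta> j) 1 s (G (syl_cons (j, - s) u)))"
    by (rule sum.mono_neutral_right) (auto simp: lo_def 1)
  finally show ?thesis by (simp add: 1 add.commute)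
qed

lemma syl_not_reduced: "\<not> reduced u \<Longrightarrow> syl x G u = 0"
  by (simp add: syl_def)

lemma deg_bounded_not_reduced: "deg_bounded n d G \<Longrightarrow> \<not> reduced u \<Longrightarrow> G u = 0"
  unfolding deg_bounded_def reduced_words_def by blast

lemma syl_zero:
  assumes "j \<in> {1..n}" "deg_bounded n d G"
  shows "syl (j, 0) G = G"
proof
  fix u
  show "syl (j, 0) G u = G u"
  proof (cases "reduced u")
    case True
    define lo where "lo = min 0 (deg u - d)"
    have "syl (j, 0) G u = (\<Sum>s\<in>{lo..0}. xi_coeff \<sigma> (\<delta> j) 0 s (G (syl_cons (j, - s) u)))"
      using assms True by (intro syl_eq_sum) (auto simp: lo_def)
    also have "\<dots> = (\<Sum>s\<in>{lo..0}. if s = 0 then G u else 0)"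
      by (rule sum.cong) (auto simp: xi_coeff_0[OF additive_\<sigma> additive_\<delta>[OF assms(1)] bij_\<sigma>])
    finally show ?thesis by (simp add: lo_def)
  qed (use assms in \<open>simp_all add: syl_not_reduced deg_bounded_not_reduced\<close>)
qed

text \<open>After shifting the index of the \<sigma> part by one, both parts have the same range and
  combine by \<open>xi_coeff_add_one\<close>.\<close>

lemma syl_syl_one:
  assumes "j \<in> {1..n}" "deg_bounded n d G"
  shows "syl (j, 1) (syl (j, e) G) = syl (j, e + 1) G"
proof
  fix u
  show "syl (j, 1) (syl (j, e) G) u = syl (j, e + 1) G u"
  proof (cases "reduced u")
    case True
    define lo where "lo = min (e + 1) (deg u - d) - 1"
    define g where "g = (\<lambda>s. G (syl_cons (j, - s) u))"
    have red: "reduced (syl_cons (j, - 1) u)" using True by (rule reduced_syl_cons)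
    have g': "G (syl_cons (j, - s) (syl_cons (j, - 1) u)) = g (s + 1)" for s
      using True by (simp add: syl_cons_syl_cons g_def)
    have "syl (j, 1) (syl (j, e) G) u
        = \<sigma> (syl (j, e) G (syl_cons (j, - 1) u)) + \<delta> j (syl (j, e) G u)"
      using syl_one[OF assms(1) syl_deg_bounded[OF assms] True] .
    also have "syl (j, e) G u = (\<Sum>s\<in>{lo..e}. xi_coeff \<sigma> (\<delta> j) e s (g s))"
      unfolding g_def using assms True by (intro syl_eq_sum) (auto simp: lo_def)
    also have "\<dots> = (\<Sum>s\<in>{lo..e + 1}. xi_coeff \<sigma> (\<delta> j) e s (g s))"
      by (rule sum.mono_neutral_left) (auto simp: xi_coeff_def)
    also have "syl (j, e) G (syl_cons (j, - 1) u)
        = (\<Sum>s\<in>{lo - 1..e}. xi_coeff \<sigma> (\<delta> j) e s (g (s + 1)))"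
      using syl_eq_sum[OF assms red, of "lo - 1" e] by (simp add: g' lo_def)
    also have "\<dots> = (\<Sum>s\<in>{lo..e + 1}. xi_coeff \<sigma> (\<delta> j) e (s - 1) (g s))"
      by (rule sum.reindex_bij_witness[where i = "\<lambda>s. s - 1" and j = "\<lambda>s. s + 1"]) auto
    finally have "syl (j, 1) (syl (j, e) G) u = (\<Sum>s\<in>{lo..e + 1}. xi_coeff \<sigma> (\<delta> j) (e + 1) s (g s))"
      using assms(1) by (simp add: \<sigma>_sum \<delta>_sum add_one_xi sum.distrib)
    also have "\<dots> = syl (j, e + 1) G u"
      unfolding g_def using assms True by (intro syl_eq_sum[symmetric]) (auto simp: lo_def)
    finally show ?thesis .
  qed (simp add: syl_not_reduced)
qed

text \<open>Descending induction on degree. At the word xi_j v the \<delta>_j part involves only the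
  coefficient at xi_j v, of higher degree and already known, so \<sigma>(G v) is determined and
  \<sigma> is injective.\<close>

lemma syl_one_injective:
  assumes j: "j \<in> {1..n}" and G: "deg_bounded n d G" and H: "deg_bounded n d' H"
    and eq: "syl (j, 1) G = syl (j, 1) H"
  shows "G = H"
proof -
  \<comment> \<open>\<open>k\<close> measures how far \<open>v\<close> lies below the first degree
    in which both series vanish.\<close>
  have "G v = H v" if "k = nat (max d d' + 1 - deg v)" "reduced v" for k v
    using that
  proof (induction k arbitrary: v)
    case 0
    then have "d < deg v" "d' < deg v" by linarith+
    then have "G v = 0" "H v = 0" using G H unfolding deg_bounded_def by force+
    then show ?case by simp
  next
    case (Suc k)
    let ?u = "syl_cons (j, 1) v"
    have u: "reduced ?u" using Suc(3) by (rule reduced_syl_cons)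
    have v: "syl_cons (j, - 1) ?u = v" using Suc(3) by (simp add: syl_cons_syl_cons)
    have "G ?u = H ?u" by (rule Suc(1)) (use Suc(2) u in auto)
    then have "\<sigma> (G v) = \<sigma> (H v)"
      using fun_cong[OF eq, of ?u] syl_one[OF j G u] syl_one[OF j H u] by (simp add: v)
    then show ?case using bij_\<sigma> by (simp add: bij_is_inj inj_eq)
  qed
  then have "G v = H v" if "reduced v" for v
    using that by blast
  then show ?thesis
    using deg_bounded_not_reduced[OF G] deg_bounded_not_reduced[OF H] by fastforce
qed

text \<open>Upwards from 0 this is \<open>syl_syl_one\<close>. Downwards, both sides agree after one
  more xi_j, which is cancelled by injectivity.\<close>

lemma syl_syl:
  assumes "j \<in> {1..n}" "deg_bounded n d G"
  shows "syl (j, a) (syl (j, b) G) = syl (j, a + b) G"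
proof (induction a rule: int_induct[where k = 0])
  case base
  show ?case using syl_zero[OF assms(1) syl_deg_bounded[OF assms]] by simp
next
  case (step1 i)
  then show ?case
    using syl_syl_one[OF assms(1) syl_deg_bounded[OF assms], of i b] syl_syl_one[OF assms, of "i + b"]
    by (simp add: algebra_simps)
next
  case (step2 i)
  have b: "deg_bounded n (d + b + (i - 1)) (syl (j, i - 1) (syl (j, b) G))"
    by (intro syl_deg_bounded assms)
  have "syl (j, 1) (syl (j, i - 1) (syl (j, b) G)) = syl (j, 1) (syl (j, i - 1 + b) G)"
    using syl_syl_one[OF assms(1) syl_deg_bounded[OF assms], of "i - 1" b]
      syl_syl_one[OF assms, of "i - 1 + b"] step2 by (simp add: algebra_simps)
  then show ?case
    using syl_one_injective[OF assms(1) b syl_deg_bounded[OF assms]] by blast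
qed

lemma syl_closed_induct:
  assumes "j \<in> {1..n}" and carrier: "G \<in> Psi0_carrier n"
    and "P G"
    and one: "\<And>H. H \<in> Psi0_carrier n \<Longrightarrow> P H \<Longrightarrow> P (syl (j, 1) H)"
    and minus: "\<And>H. H \<in> Psi0_carrier n \<Longrightarrow> P H \<Longrightarrow> P (syl (j, - 1) H)"
  shows "P (syl (j, e) G)"
proof -
  obtain d where d: "deg_bounded n d G"
    using carrier Psi0_carrier_iff bounded_series_deg_bounded by blast
  show ?thesis
  proof (induction e rule: int_induct[where k = 0])
    case base then show ?case using assms(3) syl_zero[OF assms(1) d] by simp
  next
    case (step1 i)
    then show ?case
      using one[of "syl (j, i) G"] syl_carrier[OF assms(1) carrier] syl_syl[OF assms(1) d, of 1 i]
      by (simp add: add.commute)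
  next
    case (step2 i)
    then show ?case
      using minus[of "syl (j, i) G"] syl_carrier[OF assms(1) carrier] syl_syl[OF assms(1) d, of "-1" i]
      by simp
  qed
qed

text \<open>The action depends only on the free group element: merging or cancelling syllables
  corresponds to adding exponents of one operator.\<close>

lemma act_syl_cons:
  assumes "j \<in> {1..n}" "fst ` set w \<subseteq> {1..n}" "deg_bounded n d G"
  shows "act (syl_cons (j, e) w) G = syl (j, e) (act w G)"
proof (cases w)
  case Nil
  then show ?thesis using syl_zero[OF assms(1,3)] by simp
next
  case (Cons x v)
  obtain k f where x: "x = (k, f)" by (cases x)
  have v: "deg_bounded n (d + deg v) (act v G)"
    using assms Cons by (intro act_deg_bounded) auto
  have w: "deg_bounded n (d + deg w) (act w G)"
    using assms by (intro act_deg_bounded) auto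
  show ?thesis
    using syl_zero[OF assms(1) w] syl_zero[OF assms(1) v] syl_syl[OF assms(1) v, of e f]
    unfolding Cons x by auto
qed


section \<open>The ring of series\<close>

abbreviation series_prod (infixl "\<star>" 70) where
  "D \<star> E \<equiv> series_mult \<sigma> \<delta> D E"

text \<open>The slice of the index set of \<open>series_mult\<close> for a fixed left word.\<close>

definition moved_terms :: "word \<Rightarrow> (word \<Rightarrow> 'a) \<Rightarrow> word \<Rightarrow> (int list \<times> word) set" where
  "moved_terms w G u = {(ss, v). G v \<noteq> 0 \<and> list_all2 (\<lambda>(j, e) s. s \<le> e) w ss \<and>
     word_mult (zip (map fst w) ss) v = u}"

lemma moved_word_bounds:
  assumes "list_all2 (\<lambda>(j, e) s. s \<le> e) w ss"
  shows "length (zip (map fst w) ss) = length w" "map fst (zip (map fst w) ss) = map fst w"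
    "deg (zip (map fst w) ss) \<le> deg w" "pos_deg (zip (map fst w) ss) \<le> pos_deg w"
  using assms by (induction w ss rule: list_all2_induct) auto

text \<open>The exponent \<open>s\<close> of the first syllable is bounded below: the other moved
  exponents add up to at most \<open>deg w\<close>, and the right word has degree at most
  \<open>d\<close>.\<close>

lemma moved_terms_Cons:
  assumes "j \<in> {1..n}" "fst ` set w \<subseteq> {1..n}" "deg_bounded n d G" "reduced u"
    and lo: "lo \<le> deg u - d - deg w"
  shows "moved_terms ((j, e) # w) G u
    = (\<lambda>(s, ss, v). (s # ss, v)) ` (SIGMA s:{lo..e}. moved_terms w G (syl_cons (j, - s) u))"
proof -
  have red: "reduced v" if "G v \<noteq> 0" for v
    using that assms(3) deg_bounded_not_reduced by blast
  have lo_le: "lo \<le> s" if "G v \<noteq> 0" "list_all2 (\<lambda>(j, e) s. s \<le> e) w ss"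
    "word_mult (zip (map fst w) ss) v = syl_cons (j, - s) u" for s ss v
  proof -
    have "deg (zip (map fst w) ss) + deg v = deg u - s"
      using that(3) word_mult_bounds(3)[of "zip (map fst w) ss" v] by simp
    moreover have "deg v \<le> d" using that assms(3) unfolding deg_bounded_def by auto
    moreover have "deg (zip (map fst w) ss) \<le> deg w" by (rule moved_word_bounds(3)[OF that(2)])
    ultimately show ?thesis using lo by simp
  qed
  have iff: "syl_cons (j, s) (word_mult (zip (map fst w) ss) v) = u \<longleftrightarrow>
      word_mult (zip (map fst w) ss) v = syl_cons (j, - s) u" if "G v \<noteq> 0" for s ss v
    using syl_cons_eq_iff[OF assms(4) word_mult_bounds(1)[OF red[OF that]]] .
  show ?thesis
  proof (intro equalityI subsetI)
    fix t assume "t \<in> moved_terms ((j, e) # w) G u"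
    then obtain s ss v where t: "t = (s # ss, v)" and m: "G v \<noteq> 0" "s \<le> e"
      "list_all2 (\<lambda>(j, e) s. s \<le> e) w ss"
      and eq: "syl_cons (j, s) (word_mult (zip (map fst w) ss) v) = u"
      unfolding moved_terms_def by (cases t) (auto simp: list_all2_Cons1)
    have eq': "word_mult (zip (map fst w) ss) v = syl_cons (j, - s) u"
      using eq iff[OF m(1)] by blast
    have "(s, ss, v) \<in> (SIGMA s:{lo..e}. moved_terms w G (syl_cons (j, - s) u))"
      using m eq' lo_le[OF m(1,3) eq'] by (simp add: moved_terms_def)
    then show "t \<in> (\<lambda>(s, ss, v). (s # ss, v)) `
        (SIGMA s:{lo..e}. moved_terms w G (syl_cons (j, - s) u))"
      by (rule rev_image_eqI) (simp add: t)
  qed (use assms(4) in \<open>auto simp: moved_terms_def syl_cons_syl_cons\<close>)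
qed

text \<open>The bridge from the defining multi-index sum to composed operators. Peeling off one
  syllable turns the slice into a disjoint union over \<open>s\<close>, and additivity pulls the
  coefficient map out of the inner sum.\<close>

lemma act_eq_sum:
  assumes "fst ` set w \<subseteq> {1..n}" "deg_bounded n d G"
  shows "finite (moved_terms w G u) \<and>
    (\<Sum>(ss, v)\<in>moved_terms w G u. word_coeff \<sigma> \<delta> w ss (G v)) = act w G u"
  using assms(1)
proof (induction w arbitrary: u)
  case Nil
  have "moved_terms [] G u = (if G u = 0 then {} else {([], u)})"
    by (auto simp: moved_terms_def)
  then show ?case by (simp add: word_coeff_def)
next
  case (Cons x w)
  obtain j e where x: "x = (j, e)" by (cases x)
  have j: "j \<in> {1..n}" and w: "fst ` set w \<subseteq> {1..n}" using Cons(2) x by auto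
  show ?case
  proof (cases "reduced u")
    case False
    then have "moved_terms (x # w) G u = {}"
      using word_mult_bounds(1) deg_bounded_not_reduced[OF assms(2)]
      unfolding moved_terms_def by fastforce
    then show ?thesis using False by (simp add: syl_not_reduced)
  next
    case True
    define lo where "lo = deg u - d - deg w"
    let ?T = "\<lambda>s. moved_terms w G (syl_cons (j, - s) u)"
    let ?S = "SIGMA s:{lo..e}. ?T s"
    have T: "moved_terms (x # w) G u = (\<lambda>(s, ss, v). (s # ss, v)) ` ?S"
      unfolding x by (rule moved_terms_Cons[OF j w assms(2) True]) (simp add: lo_def)
    have fin: "finite (?T s)" for s using Cons(1)[OF w] by blast
    have inj: "inj_on (\<lambda>(s, ss, v). (s # ss, v)) ?S" by (auto simp: inj_on_def)
    have coeff: "word_coeff \<sigma> \<delta> (x # w) (s # ss) a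
        = xi_coeff \<sigma> (\<delta> j) e s (word_coeff \<sigma> \<delta> w ss a)" for s ss a
      by (simp add: word_coeff_def x)
    have "(\<Sum>(ss, v)\<in>moved_terms (x # w) G u. word_coeff \<sigma> \<delta> (x # w) ss (G v))
        = (\<Sum>(s, ss, v)\<in>?S. xi_coeff \<sigma> (\<delta> j) e s (word_coeff \<sigma> \<delta> w ss (G v)))"
      unfolding T by (subst sum.reindex[OF inj]) (auto simp: coeff intro!: sum.cong)
    also have "\<dots> = (\<Sum>s\<in>{lo..e}. \<Sum>(ss, v)\<in>?T s. xi_coeff \<sigma> (\<delta> j) e s (word_coeff \<sigma> \<delta> w ss (G v)))"
      using fin by (subst sum.Sigma) (auto simp: case_prod_beta)
    also have "\<dots> = (\<Sum>s\<in>{lo..e}. xi_coeff \<sigma> (\<delta> j) e s (act w G (syl_cons (j, - s) u)))"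
      using Cons(1)[OF w] by (auto simp: case_prod_beta additive.sum[OF additive_xi[OF j]]
          intro!: sum.cong simp flip: additive.sum[OF additive_xi[OF j]])
    also have "\<dots> = syl (j, e) (act w G) u"
      by (rule syl_eq_sum[symmetric, OF j act_deg_bounded[OF w assms(2)] True]) (simp add: lo_def)
    finally show ?thesis using fin T by (auto simp: x)
  qed
qed

text \<open>Moving coefficients never raises degree, so only words with degree at least
  \<open>deg u - d\<close> contribute. Allowing any finite superset \<open>W\<close> lets several
  products be expanded over the same set.\<close>

lemma mult_eq_sum:
  assumes D: "\<And>w. D w \<noteq> 0 \<Longrightarrow> fst ` set w \<subseteq> {1..n}" and E: "deg_bounded n d E"
    and W: "finite W" "\<And>w. D w \<noteq> 0 \<Longrightarrow> deg u - d \<le> deg w \<Longrightarrow> w \<in> W"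
  shows "(D \<star> E) u = (\<Sum>w\<in>W. D w * act w E u)"
proof -
  let ?W = "{w \<in> W. D w \<noteq> 0}"
  have deg: "deg u - d \<le> deg w" if "(ss, v) \<in> moved_terms w E u" for w ss v
  proof -
    have m: "E v \<noteq> 0" "list_all2 (\<lambda>(j, e) s. s \<le> e) w ss" "word_mult (zip (map fst w) ss) v = u"
      using that unfolding moved_terms_def by auto
    then show ?thesis
      using E moved_word_bounds(3)[OF m(2)] word_mult_bounds(3)[of "zip (map fst w) ss" v]
      unfolding deg_bounded_def by force
  qed
  have "{(w, ss, v). D w \<noteq> 0 \<and> E v \<noteq> 0 \<and> list_all2 (\<lambda>(j, e) s. s \<le> e) w ss \<and>
      word_mult (zip (map fst w) ss) v = u} = (SIGMA w:?W. moved_terms w E u)"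
    using deg W(2) by (fastforce simp: moved_terms_def)
  then have "(D \<star> E) u
      = (\<Sum>(w, ss, v)\<in>(SIGMA w:?W. moved_terms w E u). D w * word_coeff \<sigma> \<delta> w ss (E v))"
    unfolding series_mult_def by simp
  also have "\<dots> = (\<Sum>w\<in>?W. \<Sum>(ss, v)\<in>moved_terms w E u. D w * word_coeff \<sigma> \<delta> w ss (E v))"
    using W(1) act_eq_sum[OF D E] by (subst sum.Sigma) (auto simp: case_prod_beta)
  also have "\<dots> = (\<Sum>w\<in>?W. D w * act w E u)"
    using act_eq_sum[OF D E] by (auto simp: case_prod_beta simp flip: sum_distrib_left intro!: sum.cong)
  also have "\<dots> = (\<Sum>w\<in>W. D w * act w E u)"
    using W(1) by (intro sum.mono_neutral_left) auto
  finally show ?thesis .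
qed

lemma mult_nonzeroE:
  assumes "(D \<star> E) u \<noteq> 0"
  obtains w ss v where "D w \<noteq> 0" "E v \<noteq> 0" "list_all2 (\<lambda>(j, e) s. s \<le> e) w ss"
    "u = word_mult (zip (map fst w) ss) v"
proof -
  obtain t where "t \<in> {(w, ss, v). D w \<noteq> 0 \<and> E v \<noteq> 0 \<and> list_all2 (\<lambda>(j, e) s. s \<le> e) w ss \<and>
                         word_mult (zip (map fst w) ss) v = u}"
    using assms unfolding series_mult_def by (rule sum.not_neutral_contains_not_neutral)
  then show ?thesis using that by (cases t) auto
qed

lemma moved_word_reduced:
  assumes w: "fst ` set w \<subseteq> {1..n}" and ss: "list_all2 (\<lambda>(j, e) s. s \<le> e) w ss"
    and v: "v \<in> reduced_words n"
  shows "word_mult (zip (map fst w) ss) v \<in> reduced_words n"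
proof -
  let ?u = "zip (map fst w) ss"
  have "map fst ?u = map fst w" by (rule moved_word_bounds(2)[OF ss])
  then have "fst ` set ?u = fst ` set w" by (metis list.set_map)
  moreover have "fst ` set v \<subseteq> {1..n}" using v unfolding reduced_words_def by simp
  ultimately have "fst ` set (word_mult ?u v) \<subseteq> {1..n}"
    using word_mult_bounds(2)[of ?u v] w by (simp only:) (rule subset_trans, assumption, rule Un_least)
  then show ?thesis
    using v word_mult_bounds(1)[of v ?u] unfolding reduced_words_def by simp
qed

lemma mult_deg_bounded:
  assumes "deg_bounded n d D" "deg_bounded n d' E"
  shows "deg_bounded n (d + d') (D \<star> E)"
  unfolding deg_bounded_def
proof (intro allI impI)
  fix u assume "(D \<star> E) u \<noteq> 0"
  then obtain w ss v where m: "D w \<noteq> 0" "E v \<noteq> 0" "list_all2 (\<lambda>(j, e) s. s \<le> e) w ss"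
    "u = word_mult (zip (map fst w) ss) v" by (rule mult_nonzeroE)
  have "w \<in> reduced_words n" "deg w \<le> d" "v \<in> reduced_words n" "deg v \<le> d'"
    using assms m unfolding deg_bounded_def by auto
  moreover from this have "u \<in> reduced_words n"
    using moved_word_reduced[of w ss v] m unfolding reduced_words_def by auto
  ultimately show "u \<in> reduced_words n \<and> deg u \<le> d + d'"
    using moved_word_bounds(3)[OF m(3)] word_mult_bounds(3)[of "zip (map fst w) ss" v] m(4)
    by simp
qed

lemma mult_bounded_series:
  assumes "bounded_series n L M D" "bounded_series n L' M' E"
  shows "bounded_series n (L + L') (M + M') (D \<star> E)"
  unfolding bounded_series_def
proof (intro allI impI)
  fix u assume "(D \<star> E) u \<noteq> 0"
  then obtain w ss v where m: "D w \<noteq> 0" "E v \<noteq> 0" "list_all2 (\<lambda>(j, e) s. s \<le> e) w ss"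
    "u = word_mult (zip (map fst w) ss) v" by (rule mult_nonzeroE)
  have b: "w \<in> reduced_words n" "length w \<le> L" "pos_deg w \<le> M"
    "v \<in> reduced_words n" "length v \<le> L'" "pos_deg v \<le> M'"
    using assms m unfolding bounded_series_def by auto
  then have "u \<in> reduced_words n"
    using moved_word_reduced[of w ss v] m unfolding reduced_words_def by auto
  then show "u \<in> reduced_words n \<and> length u \<le> L + L' \<and> pos_deg u \<le> M + M'"
    using b moved_word_bounds(1,4)[OF m(3)] word_mult_bounds(5,6)[of "zip (map fst w) ss" v]
    unfolding m(4) by linarith
qed

lemma mult_carrier:
  "D \<in> Psi0_carrier n \<Longrightarrow> E \<in> Psi0_carrier n \<Longrightarrow> D \<star> E \<in> Psi0_carrier n"
  unfolding Psi0_carrier_iff using mult_bounded_series by blast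

lemma carrier_deg_bounded: "D \<in> Psi0_carrier n \<Longrightarrow> \<exists>d. deg_bounded n d D"
  using Psi0_carrier_iff bounded_series_deg_bounded by blast

lemma carrier_letters: "D \<in> Psi0_carrier n \<Longrightarrow> D w \<noteq> 0 \<Longrightarrow> fst ` set w \<subseteq> {1..n}"
  unfolding Psi0_carrier_iff bounded_series_def reduced_words_def by blast

lemma carrier_finite_support: "D \<in> Psi0_carrier n \<Longrightarrow> finite {w. D w \<noteq> 0 \<and> K \<le> deg w}"
  unfolding Psi0_carrier_iff using finite_support_deg_ge by blast

lemma mult_eq_truncated_sum:
  assumes "D \<in> Psi0_carrier n" "deg_bounded n d E" "K \<le> deg u - d"
  shows "(D \<star> E) u = (\<Sum>w | D w \<noteq> 0 \<and> K \<le> deg w. D w * act w E u)"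
  by (rule mult_eq_sum[OF carrier_letters[OF assms(1)] assms(2) carrier_finite_support[OF assms(1)]])
    (use assms(3) in auto)

section \<open>Distributivity and monomials\<close>

lemma deg_bounded_add:
  "deg_bounded n d G \<Longrightarrow> deg_bounded n d H \<Longrightarrow> deg_bounded n d (\<lambda>w. G w + H w :: 'a)"
  unfolding deg_bounded_def by (metis add.left_neutral)

lemma carrier_add:
  fixes D E :: "word \<Rightarrow> 'a"
  assumes "D \<in> Psi0_carrier n" "E \<in> Psi0_carrier n"
  shows "(\<lambda>w. D w + E w) \<in> Psi0_carrier n"
proof -
  obtain L M L' M' where "bounded_series n L M D" "bounded_series n L' M' E"
    using assms Psi0_carrier_iff by blast
  then have "bounded_series n (max L L') (max M M') D" "bounded_series n (max L L') (max M M') E"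
    by (auto elim: bounded_series_mono)
  then have "bounded_series n (max L L') (max M M') (\<lambda>w. D w + E w)"
    unfolding bounded_series_def by (metis add.left_neutral)
  then show ?thesis unfolding Psi0_carrier_iff by blast
qed

lemma carrier_support_subset:
  fixes D E :: "word \<Rightarrow> 'a"
  shows "D \<in> Psi0_carrier n \<Longrightarrow> (\<And>w. E w \<noteq> 0 \<Longrightarrow> D w \<noteq> 0) \<Longrightarrow> E \<in> Psi0_carrier n"
  unfolding Psi0_carrier_iff bounded_series_def by meson

lemma carrier_uminus: "D \<in> Psi0_carrier n \<Longrightarrow> (\<lambda>w. - D w :: 'a) \<in> Psi0_carrier n"
  by (erule carrier_support_subset) auto

lemma carrier_0: "(\<lambda>w. 0 :: 'a) \<in> Psi0_carrier n"
  by (auto simp: Psi0_carrier_iff bounded_series_def)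

lemma monomial_carrier:
  assumes "w \<in> reduced_words n"
  shows "(monomial a w :: word \<Rightarrow> 'a) \<in> Psi0_carrier n"
proof -
  have "bounded_series n (length w) (pos_deg w) (monomial a w :: word \<Rightarrow> 'a)"
    using assms by (auto simp: bounded_series_def monomial_def)
  then show ?thesis unfolding Psi0_carrier_iff by blast
qed

lemma monomial_deg_bounded:
  "w \<in> reduced_words n \<Longrightarrow> deg_bounded n (deg w) (monomial a w :: word \<Rightarrow> 'a)"
  by (auto simp: deg_bounded_def monomial_def)

lemma Nil_reduced_words [simp]: "[] \<in> reduced_words n"
  by (simp add: reduced_words_def)

lemma syl_add:
  assumes j: "j \<in> {1..n}" and G: "deg_bounded n d G" and H: "deg_bounded n d' H"
  shows "syl (j, e) (\<lambda>w. G w + H w) = (\<lambda>u. syl (j, e) G u + syl (j, e) H u)"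
proof
  fix u
  let ?d = "max d d'"
  have G': "deg_bounded n ?d G" and H': "deg_bounded n ?d H"
    using G H by (auto elim: deg_bounded_mono)
  show "syl (j, e) (\<lambda>w. G w + H w) u = syl (j, e) G u + syl (j, e) H u"
  proof (cases "reduced u")
    case True
    note eq = syl_eq_sum[OF j _ True, where d = ?d and lo = "deg u - ?d" and e = e]
    show ?thesis
      using eq[OF G'] eq[OF H'] eq[OF deg_bounded_add[OF G' H']]
      by (simp add: additive.add[OF additive_xi[OF j]] sum.distrib)
  qed (simp add: syl_not_reduced)
qed

lemma act_add:
  assumes "fst ` set w \<subseteq> {1..n}" and G: "deg_bounded n d G" and H: "deg_bounded n d' H"
  shows "act w (\<lambda>w. G w + H w) = (\<lambda>u. act w G u + act w H u)"
  using assms(1)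
proof (induction w)
  case (Cons x w)
  then show ?case
    using syl_add[OF _ act_deg_bounded[OF _ G] act_deg_bounded[OF _ H]] by (cases x) auto
qed simp

lemma mult_add_right:
  assumes D: "D \<in> Psi0_carrier n" and G: "deg_bounded n d G" and H: "deg_bounded n d' H"
  shows "D \<star> (\<lambda>w. G w + H w) = (\<lambda>u. (D \<star> G) u + (D \<star> H) u)"
proof
  fix u
  let ?d = "max d d'"
  have G': "deg_bounded n ?d G" and H': "deg_bounded n ?d H"
    using G H by (auto elim: deg_bounded_mono)
  note eq = mult_eq_truncated_sum[OF D, where d = ?d and K = "deg u - ?d" and u = u]
  show "(D \<star> (\<lambda>w. G w + H w)) u = (D \<star> G) u + (D \<star> H) u"
    unfolding eq[OF G' order_refl] eq[OF H' order_refl]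
      eq[OF deg_bounded_add[OF G' H'] order_refl] sum.distrib[symmetric]
    by (intro sum.cong refl) (auto simp: act_add[OF carrier_letters[OF D] G H] distrib_left)
qed

lemma mult_add_left:
  assumes D: "D \<in> Psi0_carrier n" and E: "E \<in> Psi0_carrier n" and G: "deg_bounded n d G"
  shows "(\<lambda>w. D w + E w) \<star> G = (\<lambda>u. (D \<star> G) u + (E \<star> G) u)"
proof
  fix u
  let ?W = "{w. D w \<noteq> 0 \<and> deg u - d \<le> deg w} \<union> {w. E w \<noteq> 0 \<and> deg u - d \<le> deg w}"
  have fin: "finite ?W" using carrier_finite_support D E by blast
  have "(D \<star> G) u = (\<Sum>w\<in>?W. D w * act w G u)"
    by (rule mult_eq_sum[OF carrier_letters[OF D] G fin]) auto
  moreover have "(E \<star> G) u = (\<Sum>w\<in>?W. E w * act w G u)"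
    by (rule mult_eq_sum[OF carrier_letters[OF E] G fin]) auto
  moreover have "((\<lambda>w. D w + E w) \<star> G) u = (\<Sum>w\<in>?W. (D w + E w) * act w G u)"
    by (rule mult_eq_sum[OF carrier_letters[OF carrier_add[OF D E]] G fin]) auto
  ultimately show "((\<lambda>w. D w + E w) \<star> G) u = (D \<star> G) u + (E \<star> G) u"
    by (simp add: sum.distrib distrib_right)
qed

lemma monomial_mult:
  assumes "w \<in> reduced_words n" "deg_bounded n d E"
  shows "monomial a w \<star> E = (\<lambda>u. a * act w E u)"
proof
  fix u
  have "(monomial a w \<star> E) u = (\<Sum>v\<in>{w}. monomial a w v * act v E u)"
    using assms by (intro mult_eq_sum) (auto simp: monomial_def reduced_words_def split: if_splits)
  then show "(monomial a w \<star> E) u = a * act w E u" by (simp add: monomial_def)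
qed

text \<open>Both sides are expanded over the words of \<open>E\<close> that can contribute, using
  \<open>\<xi>\<^sub>j (a G) = \<sigma>(a) \<xi>\<^sub>j G + \<delta>\<^sub>j(a) G\<close>.\<close>

lemma syl_one_mult:
  assumes j: "j \<in> {1..n}" and E: "E \<in> Psi0_carrier n" and F: "deg_bounded n f F"
  shows "syl (j, 1) (E \<star> F) = syl (j, 1) E \<star> F"
proof
  fix u
  obtain d where d: "deg_bounded n d E" using carrier_deg_bounded[OF E] by blast
  have EF: "deg_bounded n (d + f) (E \<star> F)" by (rule mult_deg_bounded[OF d F])
  have xE: "syl (j, 1) E \<in> Psi0_carrier n" by (rule syl_carrier[OF j E])
  show "syl (j, 1) (E \<star> F) u = (syl (j, 1) E \<star> F) u"
  proof (cases "reduced u")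
    case False
    then show ?thesis
      using deg_bounded_not_reduced[OF mult_deg_bounded[OF syl_deg_bounded[OF j d] F]]
      by (simp add: syl_not_reduced)
  next
    case True
    \<comment> \<open>The product is also evaluated at \<open>syl_cons (j, - 1) u\<close>, whose
      degree is one less than that of \<open>u\<close>.\<close>
    define K where "K = deg u - f - 1"
    define W where "W = {w. E w \<noteq> 0 \<and> K \<le> deg w}"
    \<comment> \<open>xi_j E can be nonzero only at words of E and at their translates by xi_j;
      \<open>V\<close> contains all of these that have degree at least
      \<open>deg u - f\<close>.\<close>
    define V where "V = W \<union> syl_cons (j, 1) ` W"
    have fin: "finite W" "finite V"
      unfolding V_def W_def using carrier_finite_support[OF E] by blast+
    have W: "reduced w" "fst ` set w \<subseteq> {1..n}" if "w \<in> W" for w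
      using that carrier_letters[OF E, of w] deg_bounded_not_reduced[OF d, of w]
      unfolding W_def by auto
    have V: "reduced v" "fst ` set v \<subseteq> {1..n}" if "v \<in> V" for v
    proof -
      from that consider "v \<in> W" | w where "w \<in> W" "v = syl_cons (j, 1) w" unfolding V_def by blast
      then have "v \<in> reduced_words n"
        using W reduced_words_syl_cons[OF _ j] by cases (auto simp: reduced_words_def)
      then show "reduced v" "fst ` set v \<subseteq> {1..n}" by (auto simp: reduced_words_def)
    qed
    have low: "act v F u = 0" if "v \<in> V" "deg v < deg u - f" for v
      using act_deg_bounded[OF V(2)[OF that(1)] F] that(2) unfolding deg_bounded_def by force
    have inj: "inj_on (syl_cons (j, 1)) W"
      by (rule inj_on_inverseI[where g = "syl_cons (j, - 1)"]) (simp add: W(1) syl_cons_syl_cons)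
    have sumE: "(E \<star> F) v = (\<Sum>w\<in>W. E w * act w F v)" if "deg u - 1 \<le> deg v" for v
      unfolding W_def by (rule mult_eq_truncated_sum[OF E F]) (use that in \<open>simp add: K_def\<close>)
    have "syl (j, 1) (E \<star> F) u = \<sigma> ((E \<star> F) (syl_cons (j, - 1) u)) + \<delta> j ((E \<star> F) u)"
      by (rule syl_one[OF j EF True])
    also have "\<dots> = (\<Sum>w\<in>W. \<sigma> (E w) * \<sigma> (act w F (syl_cons (j, - 1) u))
        + (\<delta> j (E w) * act w F u + \<sigma> (E w) * \<delta> j (act w F u)))"
      using j by (simp add: sumE \<sigma>_sum \<delta>_sum \<sigma>_mult \<delta>_mult sum.distrib)
    also have "\<dots> = (\<Sum>w\<in>W. \<sigma> (E w) * act (syl_cons (j, 1) w) F u + \<delta> j (E w) * act w F u)"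
    proof (rule sum.cong[OF refl])
      fix w assume "w \<in> W"
      then have "act (syl_cons (j, 1) w) F u
          = \<sigma> (act w F (syl_cons (j, - 1) u)) + \<delta> j (act w F u)"
        using act_syl_cons[OF j W(2) F] syl_one[OF j act_deg_bounded[OF W(2) F] True] by simp
      then show "\<sigma> (E w) * \<sigma> (act w F (syl_cons (j, - 1) u))
          + (\<delta> j (E w) * act w F u + \<sigma> (E w) * \<delta> j (act w F u))
          = \<sigma> (E w) * act (syl_cons (j, 1) w) F u + \<delta> j (E w) * act w F u"
        by (simp add: algebra_simps)
    qed
    also have "\<dots> = (\<Sum>w\<in>W. \<sigma> (E w) * act (syl_cons (j, 1) w) F u)
        + (\<Sum>w\<in>W. \<delta> j (E w) * act w F u)"
      by (rule sum.distrib)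
    also have "(\<Sum>w\<in>W. \<delta> j (E w) * act w F u) = (\<Sum>v\<in>V. \<delta> j (E v) * act v F u)"
    proof (rule sum.mono_neutral_left[OF fin(2)])
      show "\<forall>v\<in>V - W. \<delta> j (E v) * act v F u = 0"
      proof
        fix v assume v: "v \<in> V - W"
        then have "E v = 0 \<or> deg v < deg u - f" by (auto simp: W_def K_def)
        then show "\<delta> j (E v) * act v F u = 0" using low v j by auto
      qed
    qed (simp add: V_def)
    also have "(\<Sum>w\<in>W. \<sigma> (E w) * act (syl_cons (j, 1) w) F u)
        = (\<Sum>v\<in>syl_cons (j, 1) ` W. \<sigma> (E (syl_cons (j, - 1) v)) * act v F u)"
      by (subst sum.reindex[OF inj]) (simp add: W(1) syl_cons_syl_cons)
    also have "\<dots> = (\<Sum>v\<in>V. \<sigma> (E (syl_cons (j, - 1) v)) * act v F u)"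
    proof (rule sum.mono_neutral_left[OF fin(2)])
      show "\<forall>v\<in>V - syl_cons (j, 1) ` W. \<sigma> (E (syl_cons (j, - 1) v)) * act v F u = 0"
      proof
        fix v assume v: "v \<in> V - syl_cons (j, 1) ` W"
        then have "syl_cons (j, 1) (syl_cons (j, - 1) v) = v"
          using V(1) by (simp add: syl_cons_syl_cons)
        with v have "syl_cons (j, - 1) v \<notin> W" by force
        then have "E (syl_cons (j, - 1) v) = 0 \<or> deg v < deg u - f"
          by (auto simp: W_def K_def)
        then show "\<sigma> (E (syl_cons (j, - 1) v)) * act v F u = 0" using low v by auto
      qed
    qed (simp add: V_def)
    also have "(\<Sum>v\<in>V. \<sigma> (E (syl_cons (j, - 1) v)) * act v F u) + (\<Sum>v\<in>V. \<delta> j (E v) * act v F u)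
        = (\<Sum>v\<in>V. syl (j, 1) E v * act v F u)"
      unfolding sum.distrib[symmetric]
      by (rule sum.cong) (simp_all add: syl_one[OF j d] V(1) distrib_right)
    also have "\<dots> = (syl (j, 1) E \<star> F) u"
    proof (rule mult_eq_sum[symmetric, OF carrier_letters[OF xE] F fin(2)])
      fix v assume v: "syl (j, 1) E v \<noteq> 0" "deg u - f \<le> deg v"
      then have red: "reduced v" using syl_not_reduced by blast
      then have "E (syl_cons (j, - 1) v) \<noteq> 0 \<or> E v \<noteq> 0"
        using v syl_one[OF j d red] j by auto
      moreover have "v \<in> syl_cons (j, 1) ` W" if "E (syl_cons (j, - 1) v) \<noteq> 0"
        using that v(2) red
        by (intro image_eqI[where x = "syl_cons (j, - 1) v"]) (auto simp: W_def K_def syl_cons_syl_cons)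
      ultimately show "v \<in> V" using v(2) by (auto simp: V_def W_def K_def)
    qed
    finally show ?thesis .
  qed
qed

text \<open>Negative powers are reached by cancelling xi_j, without expanding their
  coefficients.\<close>

lemma syl_mult:
  assumes j: "j \<in> {1..n}" and E: "E \<in> Psi0_carrier n" and F: "F \<in> Psi0_carrier n"
  shows "syl (j, e) (E \<star> F) = syl (j, e) E \<star> F"
proof -
  obtain d f where d: "deg_bounded n d E" and f: "deg_bounded n f F"
    using carrier_deg_bounded E F by blast
  have EF: "deg_bounded n (d + f) (E \<star> F)" by (rule mult_deg_bounded[OF d f])
  show ?thesis
  proof (induction e rule: int_induct[where k = 0])
    case base
    show ?case by (simp add: syl_zero[OF j EF] syl_zero[OF j d])
  next
    case (step1 i)
    then show ?case
      using syl_one_mult[OF j syl_carrier[OF j E] f] syl_syl_one[OF j EF, of i]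
        syl_syl_one[OF j d, of i] by simp
  next
    case (step2 i)
    have "syl (j, 1) (syl (j, i - 1) (E \<star> F)) = syl (j, 1) (syl (j, i - 1) E \<star> F)"
      using syl_one_mult[OF j syl_carrier[OF j E] f, of "i - 1"] syl_syl_one[OF j EF, of "i - 1"]
        syl_syl_one[OF j d, of "i - 1"] step2 by simp
    then show ?case
      by (rule syl_one_injective[OF j syl_deg_bounded[OF j EF]
            mult_deg_bounded[OF syl_deg_bounded[OF j d] f]])
  qed
qed

lemma act_mult:
  "fst ` set w \<subseteq> {1..n} \<Longrightarrow> E \<in> Psi0_carrier n \<Longrightarrow> F \<in> Psi0_carrier n \<Longrightarrow>
    act w (E \<star> F) = act w E \<star> F"
proof (induction w)
  case (Cons x w)
  then show ?case using syl_mult act_carrier by (cases x) simp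
qed simp

lemma mult_assoc:
  assumes D: "D \<in> Psi0_carrier n" and E: "E \<in> Psi0_carrier n" and F: "F \<in> Psi0_carrier n"
  shows "(D \<star> E) \<star> F = D \<star> (E \<star> F)"
proof
  fix u
  obtain e f where e: "deg_bounded n e E" and f: "deg_bounded n f F"
    using carrier_deg_bounded E F by blast
  \<comment> \<open>A word of \<open>D\<close> reaches an intermediate word of degree at least
    \<open>deg u - f\<close> only from this degree on. \<open>V\<close> collects the intermediate
    words from both bracketings, so that the two sums can be interchanged.\<close>
  define W where "W = {w. D w \<noteq> 0 \<and> deg u - f - e \<le> deg w}"
  define V where "V = {v. (D \<star> E) v \<noteq> 0 \<and> deg u - f \<le> deg v}
    \<union> (\<Union>w\<in>W. {v. act w E v \<noteq> 0 \<and> deg u - f \<le> deg v})"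
  have W: "finite W" "w \<in> W \<Longrightarrow> fst ` set w \<subseteq> {1..n}" for w
    using carrier_finite_support[OF D] carrier_letters[OF D] unfolding W_def by blast+
  have actE: "w \<in> W \<Longrightarrow> act w E \<in> Psi0_carrier n" for w
    by (rule act_carrier[OF W(2) E])
  have V: "finite V"
    unfolding V_def
    using carrier_finite_support[OF mult_carrier[OF D E]] carrier_finite_support[OF actE] W(1) by blast
  have DE: "(D \<star> E) v * act v F u = (\<Sum>w\<in>W. D w * act w E v * act v F u)" if "v \<in> V" for v
  proof -
    have "deg u - f - e \<le> deg v - e" using that by (auto simp: V_def)
    then show ?thesis
      using mult_eq_truncated_sum[OF D e, of "deg u - f - e" v]
      unfolding W_def by (simp add: sum_distrib_right)
  qed
  have EF: "D w * act w (E \<star> F) u = (\<Sum>v\<in>V. D w * act w E v * act v F u)" if w: "w \<in> W" for w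
  proof -
    have "act w (E \<star> F) u = (\<Sum>v\<in>V. act w E v * act v F u)"
      unfolding act_mult[OF W(2)[OF w] E F]
      by (rule mult_eq_sum[OF carrier_letters[OF actE[OF w]] f V]) (use w in \<open>auto simp: V_def\<close>)
    then show ?thesis by (simp add: sum_distrib_left mult.assoc)
  qed
  have "((D \<star> E) \<star> F) u = (\<Sum>v\<in>V. (D \<star> E) v * act v F u)"
    by (rule mult_eq_sum[OF carrier_letters[OF mult_carrier[OF D E]] f V]) (auto simp: V_def)
  also have "\<dots> = (\<Sum>v\<in>V. \<Sum>w\<in>W. D w * act w E v * act v F u)"
    by (rule sum.cong[OF refl]) (rule DE)
  also have "\<dots> = (\<Sum>w\<in>W. \<Sum>v\<in>V. D w * act w E v * act v F u)"
    by (rule sum.swap)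
  also have "\<dots> = (\<Sum>w\<in>W. D w * act w (E \<star> F) u)"
    by (rule sum.cong[OF refl]) (simp add: EF)
  also have "\<dots> = (D \<star> (E \<star> F)) u"
    unfolding W_def by (rule mult_eq_truncated_sum[symmetric, OF D mult_deg_bounded[OF e f]]) simp
  finally show "((D \<star> E) \<star> F) u = (D \<star> (E \<star> F)) u" .
qed

text \<open>Since \<sigma> fixes 1 and \<delta>_j kills it, xi_j translates words without lower
  terms; negative powers follow by cancellation.\<close>

lemma syl_monomial_one:
  assumes j: "j \<in> {1..n}" and v: "v \<in> reduced_words n"
  shows "syl (j, e) (monomial 1 v) = monomial 1 (syl_cons (j, e) v)"
proof -
  let ?m = "\<lambda>v. monomial 1 v :: word \<Rightarrow> 'a"
  have red: "reduced v" using v by (simp add: reduced_words_def)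
  note b = monomial_deg_bounded[where a = 1]
  have one: "syl (j, 1) (?m v) = ?m (syl_cons (j, 1) v)" if v: "v \<in> reduced_words n" for v
  proof
    fix u
    have red: "reduced v" using v by (simp add: reduced_words_def)
    show "syl (j, 1) (?m v) u = ?m (syl_cons (j, 1) v) u"
    proof (cases "reduced u")
      case True
      have "u = syl_cons (j, 1) v \<longleftrightarrow> syl_cons (j, - 1) u = v"
        using syl_cons_eq_iff[OF True red, of j 1] by auto
      then show ?thesis
        using syl_one[OF j b[OF v] True] j by (simp add: monomial_def \<sigma>_one \<delta>_one)
    next
      case False
      then show ?thesis using reduced_syl_cons[OF red] by (auto simp: syl_not_reduced monomial_def)
    qed
  qed
  show ?thesis
  proof (induction e rule: int_induct[where k = 0])
    case base
    show ?case using syl_zero[OF j b[OF v]] by simp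
  next
    case (step1 i)
    then show ?case
      using syl_syl_one[OF j b[OF v], of i] one[OF reduced_words_syl_cons[OF v j, of i]]
      by (simp add: syl_cons_syl_cons[OF red] add.commute)
  next
    case (step2 i)
    have "syl (j, 1) (syl (j, i - 1) (?m v)) = syl (j, 1) (?m (syl_cons (j, i - 1) v))"
      using syl_syl_one[OF j b[OF v], of "i - 1"] one[OF reduced_words_syl_cons[OF v j, of "i - 1"]]
        step2 by (simp add: syl_cons_syl_cons[OF red])
    then show ?case
      by (rule syl_one_injective[OF j syl_deg_bounded[OF j b[OF v]]
            b[OF reduced_words_syl_cons[OF v j]]])
  qed
qed

lemma word_mult_reduced_words:
  "fst ` set w \<subseteq> {1..n} \<Longrightarrow> v \<in> reduced_words n \<Longrightarrow> word_mult w v \<in> reduced_words n"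
  using word_mult_bounds(1)[of v w] order_trans[OF word_mult_bounds(2)[of w v], of "{1..n}"]
  by (simp add: reduced_words_def)

lemma act_monomial_one:
  "fst ` set w \<subseteq> {1..n} \<Longrightarrow> v \<in> reduced_words n \<Longrightarrow>
    act w (monomial 1 v) = monomial 1 (word_mult w v)"
proof (induction w)
  case (Cons x w)
  then show ?case using syl_monomial_one word_mult_reduced_words by (cases x) simp
qed simp

lemma mult_monomial_one:
  assumes "D \<in> Psi0_carrier n" "v \<in> reduced_words n" "finite W"
    "\<And>w. D w \<noteq> 0 \<Longrightarrow> deg u - deg v \<le> deg w \<Longrightarrow> w \<in> W"
  shows "(D \<star> monomial 1 v) u = (\<Sum>w\<in>W. if u = word_mult w v then D w else 0)"
proof -
  have "(D \<star> monomial 1 v) u = (\<Sum>w\<in>W. D w * act w (monomial 1 v) u)"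
    using mult_eq_sum[OF carrier_letters[OF assms(1)] monomial_deg_bounded[OF assms(2)] assms(3,4)] .
  also have "\<dots> = (\<Sum>w\<in>W. if u = word_mult w v then D w else 0)"
  proof (rule sum.cong[OF refl])
    fix w
    show "D w * act w (monomial 1 v) u = (if u = word_mult w v then D w else 0)"
      using act_monomial_one[OF carrier_letters[OF assms(1)] assms(2), of w]
      by (cases "D w = 0") (auto simp: monomial_def)
  qed
  finally show ?thesis .
qed

lemma mult_one:
  assumes "D \<in> Psi0_carrier n"
  shows "D \<star> monomial 1 [] = D"
proof
  fix u
  have "(D \<star> monomial 1 []) u = (\<Sum>w\<in>{w. D w \<noteq> 0 \<and> deg u \<le> deg w}. if u = word_mult w [] then D w else 0)"
    using assms carrier_finite_support by (intro mult_monomial_one) auto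
  also have "\<dots> = (\<Sum>w\<in>{w. D w \<noteq> 0 \<and> deg u \<le> deg w}. if w = u then D w else 0)"
  proof (rule sum.cong[OF refl])
    fix w assume "w \<in> {w. D w \<noteq> 0 \<and> deg u \<le> deg w}"
    then have "reduced w" using assms carrier_deg_bounded deg_bounded_not_reduced by blast
    then show "(if u = word_mult w [] then D w else 0) = (if w = u then D w else 0)"
      by (auto simp: word_mult_Nil_reduced)
  qed
  also have "\<dots> = D u" using carrier_finite_support[OF assms] by (simp add: sum.delta')
  finally show "(D \<star> monomial 1 []) u = D u" .
qed

lemma ring_Psi0: "ring (Psi0 n \<sigma> \<delta>)"
proof (rule ringI)
  show "abelian_group (Psi0 n \<sigma> \<delta>)"
  proof (rule abelian_groupI)
    fix D assume "D \<in> carrier (Psi0 n \<sigma> \<delta>)"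
    then show "\<exists>E\<in>carrier (Psi0 n \<sigma> \<delta>). E \<oplus>\<^bsub>Psi0 n \<sigma> \<delta>\<^esub> D = \<zero>\<^bsub>Psi0 n \<sigma> \<delta>\<^esub>"
      using carrier_uminus by (intro bexI[where x = "\<lambda>w. - D w"]) (auto simp: Psi0_def)
  qed (auto simp: Psi0_def carrier_0 carrier_add algebra_simps)
  show "monoid (Psi0 n \<sigma> \<delta>)"
  proof (rule monoidI)
    fix D assume "D \<in> carrier (Psi0 n \<sigma> \<delta>)"
    then have D: "D \<in> Psi0_carrier n" by (simp add: Psi0_def)
    then obtain d where "deg_bounded n d D" using carrier_deg_bounded by blast
    then show "\<one>\<^bsub>Psi0 n \<sigma> \<delta>\<^esub> \<otimes>\<^bsub>Psi0 n \<sigma> \<delta>\<^esub> D = D"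
      using monomial_mult[of "[]" d D 1] by (simp add: Psi0_def)
    show "D \<otimes>\<^bsub>Psi0 n \<sigma> \<delta>\<^esub> \<one>\<^bsub>Psi0 n \<sigma> \<delta>\<^esub> = D"
      using mult_one[OF D] by (simp add: Psi0_def)
  qed (auto simp: Psi0_def mult_carrier mult_assoc monomial_carrier)
next
  fix D E F assume "D \<in> carrier (Psi0 n \<sigma> \<delta>)" "E \<in> carrier (Psi0 n \<sigma> \<delta>)" "F \<in> carrier (Psi0 n \<sigma> \<delta>)"
  then have c: "D \<in> Psi0_carrier n" "E \<in> Psi0_carrier n" "F \<in> Psi0_carrier n"
    by (simp_all add: Psi0_def)
  then obtain d e f where "deg_bounded n d D" "deg_bounded n e E" "deg_bounded n f F"
    using carrier_deg_bounded by metis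
  with c show "(D \<oplus>\<^bsub>Psi0 n \<sigma> \<delta>\<^esub> E) \<otimes>\<^bsub>Psi0 n \<sigma> \<delta>\<^esub> F
      = D \<otimes>\<^bsub>Psi0 n \<sigma> \<delta>\<^esub> F \<oplus>\<^bsub>Psi0 n \<sigma> \<delta>\<^esub> E \<otimes>\<^bsub>Psi0 n \<sigma> \<delta>\<^esub> F"
    "F \<otimes>\<^bsub>Psi0 n \<sigma> \<delta>\<^esub> (D \<oplus>\<^bsub>Psi0 n \<sigma> \<delta>\<^esub> E)
      = F \<otimes>\<^bsub>Psi0 n \<sigma> \<delta>\<^esub> D \<oplus>\<^bsub>Psi0 n \<sigma> \<delta>\<^esub> F \<otimes>\<^bsub>Psi0 n \<sigma> \<delta>\<^esub> E"
    by (simp_all add: Psi0_def mult_add_left mult_add_right)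
qed


section \<open>Sums over words with prescribed total exponents\<close>

text \<open>The words with the same image in commuting variables xi_1, ..., xi_n. Other letters are
  not excluded here, which is why \<open>deg_level\<close> asks for the letters separately.\<close>

definition level :: "(nat \<Rightarrow> int) \<Rightarrow> word set" where
  "level \<alpha> = {u. \<forall>j\<in>{1..n}. total_exponent j u = \<alpha> j}"

definition level_sum :: "('a \<Rightarrow> complex) \<Rightarrow> (nat \<Rightarrow> int) \<Rightarrow> (word \<Rightarrow> 'a) \<Rightarrow> complex" where
  "level_sum \<phi> \<alpha> G = (\<Sum>u | G u \<noteq> 0 \<and> u \<in> level \<alpha>. \<phi> (G u))"

lemma res0_eq_level_sum: "res0 n \<tau> G = level_sum \<tau> (\<lambda>_. - 1) G"
  by (simp add: res0_def level_sum_def level_def)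

lemma deg_level: "u \<in> level \<alpha> \<Longrightarrow> fst ` set u \<subseteq> {1..n} \<Longrightarrow> deg u = (\<Sum>j\<in>{1..n}. \<alpha> j)"
  using deg_eq_sum_total_exponent[of u n] by (simp add: level_def)

lemma finite_level: "G \<in> Psi0_carrier n \<Longrightarrow> finite {u. G u \<noteq> 0 \<and> u \<in> level \<alpha>}"
  by (rule finite_subset[OF _ carrier_finite_support[of G "\<Sum>j\<in>{1..n}. \<alpha> j"]])
    (auto simp: deg_level dest: carrier_letters)

lemma level_sum_eq:
  assumes "\<phi> 0 = 0" "finite U" "\<And>u. G u \<noteq> 0 \<Longrightarrow> u \<in> level \<alpha> \<Longrightarrow> u \<in> U"
  shows "level_sum \<phi> \<alpha> G = (\<Sum>u\<in>U. if u \<in> level \<alpha> then \<phi> (G u) else 0)"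
proof -
  have "level_sum \<phi> \<alpha> G = (\<Sum>u | G u \<noteq> 0 \<and> u \<in> level \<alpha>. if u \<in> level \<alpha> then \<phi> (G u) else 0)"
    unfolding level_sum_def by (rule sum.cong) auto
  also have "\<dots> = (\<Sum>u\<in>U. if u \<in> level \<alpha> then \<phi> (G u) else 0)"
    using assms by (intro sum.mono_neutral_left) auto
  finally show ?thesis .
qed

lemma level_sum_low:
  assumes "deg_bounded n d G" "d < (\<Sum>j\<in>{1..n}. \<alpha> j)"
  shows "level_sum \<phi> \<alpha> G = 0"
proof -
  have "{u. G u \<noteq> 0 \<and> u \<in> level \<alpha>} = {}"
    using assms deg_level unfolding deg_bounded_def reduced_words_def by force
  then show ?thesis unfolding level_sum_def by (simp only: sum.empty)
qed

lemma level_sum_add: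
  assumes \<phi>: "Modules.additive \<phi>" and G: "G \<in> Psi0_carrier n" and H: "H \<in> Psi0_carrier n"
  shows "level_sum \<phi> \<alpha> (\<lambda>w. G w + H w) = level_sum \<phi> \<alpha> G + level_sum \<phi> \<alpha> H"
proof -
  let ?U = "{u. G u \<noteq> 0 \<and> u \<in> level \<alpha>} \<union> {u. H u \<noteq> 0 \<and> u \<in> level \<alpha>}"
  have fin: "finite ?U" using finite_level G H by blast
  note eq = level_sum_eq[where \<phi> = \<phi>, OF additive.zero[OF \<phi>] fin]
  have "level_sum \<phi> \<alpha> (\<lambda>w. G w + H w) = (\<Sum>u\<in>?U. if u \<in> level \<alpha> then \<phi> (G u + H u) else 0)"
    by (rule eq) auto
  also have "\<dots> = (\<Sum>u\<in>?U. if u \<in> level \<alpha> then \<phi> (G u) else 0)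
      + (\<Sum>u\<in>?U. if u \<in> level \<alpha> then \<phi> (H u) else 0)"
    unfolding sum.distrib[symmetric] by (rule sum.cong) (auto simp: additive.add[OF \<phi>])
  also have "\<dots> = level_sum \<phi> \<alpha> G + level_sum \<phi> \<alpha> H"
    by (intro arg_cong2[where f = "(+)"] eq[symmetric]) auto
  finally show ?thesis .
qed

lemma level_sum_lmult:
  assumes "\<phi> 0 = 0" "G \<in> Psi0_carrier n"
  shows "level_sum \<phi> \<alpha> (\<lambda>u. a * G u) = level_sum (\<lambda>x. \<phi> (a * x)) \<alpha> G"
proof -
  have "level_sum \<phi> \<alpha> (\<lambda>u. a * G u)
      = (\<Sum>u\<in>{u. G u \<noteq> 0 \<and> u \<in> level \<alpha>}. if u \<in> level \<alpha> then \<phi> (a * G u) else 0)"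
    using assms finite_level by (intro level_sum_eq) auto
  also have "\<dots> = level_sum (\<lambda>x. \<phi> (a * x)) \<alpha> G"
    unfolding level_sum_def by (rule sum.cong) auto
  finally show ?thesis .
qed

lemma level_sum_monomial:
  "\<phi> 0 = 0 \<Longrightarrow> level_sum \<phi> \<alpha> (monomial a v) = (if v \<in> level \<alpha> then \<phi> a else 0)"
  by (subst level_sum_eq[where U = "{v}"]) (auto simp: monomial_def split: if_splits)

lemma sum_fun_upd:
  "j \<in> {1..n} \<Longrightarrow> (\<Sum>k\<in>{1..n}. (\<alpha>(j := \<alpha> j + c)) k) = (\<Sum>k\<in>{1..n}. \<alpha> k) + (c::int)"
  by (subst (1 2) sum.remove[of _ j]) auto

text \<open>In the \<sigma> part, the substitution u = xi_j w lowers the j-th prescribed exponent by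
  one; the \<delta>_j part keeps the word.\<close>

lemma level_sum_syl_one:
  assumes \<phi>: "Modules.additive \<phi>" and j: "j \<in> {1..n}" and G: "G \<in> Psi0_carrier n"
  shows "level_sum \<phi> \<alpha> (syl (j, 1) G)
    = level_sum (\<lambda>x. \<phi> (\<sigma> x)) (\<alpha>(j := \<alpha> j - 1)) G + level_sum (\<lambda>x. \<phi> (\<delta> j x)) \<alpha> G"
proof -
  obtain d where d: "deg_bounded n d G" using carrier_deg_bounded[OF G] by blast
  note \<phi>0 = additive.zero[OF \<phi>]
  let ?\<beta> = "\<alpha>(j := \<alpha> j - 1)"
  define W where "W = {w. G w \<noteq> 0 \<and> w \<in> level ?\<beta>}"
  define U where "U = {w. G w \<noteq> 0 \<and> w \<in> level \<alpha>} \<union> syl_cons (j, 1) ` W"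
  have fin: "finite W" "finite U"
    unfolding U_def W_def using finite_level[OF G] by blast+
  have red: "reduced w" if "G w \<noteq> 0" for w
    using that d deg_bounded_not_reduced by blast
  have red_U: "reduced u" if "u \<in> U" for u
    using that red reduced_syl_cons unfolding U_def W_def by blast
  have inj: "inj_on (syl_cons (j, 1)) W"
    by (rule inj_on_inverseI[where g = "syl_cons (j, - 1)"]) (simp add: W_def red syl_cons_syl_cons)
  have shift: "syl_cons (j, 1) w \<in> level \<alpha> \<longleftrightarrow> w \<in> level ?\<beta>" for w
    unfolding level_def by (auto split: if_splits)
  have supp: "u \<in> U" if u: "reduced u" "u \<in> level \<alpha>" "G (syl_cons (j, - 1) u) \<noteq> 0 \<or> G u \<noteq> 0" for u
  proof (cases "G u = 0")
    case True
    have "u = syl_cons (j, 1) (syl_cons (j, - 1) u)" using u by (simp add: syl_cons_syl_cons)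
    moreover from this have "syl_cons (j, - 1) u \<in> W"
      using u(2,3) True shift[of "syl_cons (j, - 1) u"] by (simp add: W_def)
    ultimately show ?thesis unfolding U_def by blast
  qed (use u in \<open>auto simp: U_def\<close>)
  have "level_sum \<phi> \<alpha> (syl (j, 1) G) = (\<Sum>u\<in>U. if u \<in> level \<alpha> then \<phi> (syl (j, 1) G u) else 0)"
  proof (rule level_sum_eq[where \<phi> = \<phi>, OF \<phi>0 fin(2)])
    fix u assume u: "syl (j, 1) G u \<noteq> 0" "u \<in> level \<alpha>"
    then have "reduced u" using syl_not_reduced by blast
    then show "u \<in> U" using u syl_one[OF j d] j by (intro supp) auto
  qed
  also have "\<dots> = (\<Sum>u\<in>U. if u \<in> level \<alpha> then \<phi> (\<sigma> (G (syl_cons (j, - 1) u))) else 0)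
      + (\<Sum>u\<in>U. if u \<in> level \<alpha> then \<phi> (\<delta> j (G u)) else 0)"
    unfolding sum.distrib[symmetric]
    by (rule sum.cong) (auto simp: syl_one[OF j d red_U] additive.add[OF \<phi>])
  also have "(\<Sum>u\<in>U. if u \<in> level \<alpha> then \<phi> (\<delta> j (G u)) else 0)
      = level_sum (\<lambda>x. \<phi> (\<delta> j x)) \<alpha> G"
    by (rule level_sum_eq[symmetric]) (use j fin in \<open>auto simp: \<phi>0 U_def\<close>)
  also have "(\<Sum>u\<in>U. if u \<in> level \<alpha> then \<phi> (\<sigma> (G (syl_cons (j, - 1) u))) else 0)
      = (\<Sum>u\<in>syl_cons (j, 1) ` W. if u \<in> level \<alpha> then \<phi> (\<sigma> (G (syl_cons (j, - 1) u))) else 0)"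
  proof (rule sum.mono_neutral_right[OF fin(2)])
    show "\<forall>u\<in>U - syl_cons (j, 1) ` W.
        (if u \<in> level \<alpha> then \<phi> (\<sigma> (G (syl_cons (j, - 1) u))) else 0) = 0"
    proof
      fix u assume u: "u \<in> U - syl_cons (j, 1) ` W"
      then have u': "u = syl_cons (j, 1) (syl_cons (j, - 1) u)"
        using red_U by (simp add: syl_cons_syl_cons)
      with u have "syl_cons (j, - 1) u \<notin> W" by blast
      then have "u \<in> level \<alpha> \<Longrightarrow> G (syl_cons (j, - 1) u) = 0"
        using shift[of "syl_cons (j, - 1) u"] u' by (auto simp: W_def)
      then show "(if u \<in> level \<alpha> then \<phi> (\<sigma> (G (syl_cons (j, - 1) u))) else 0) = 0"
        by (simp add: \<phi>0)
    qed
  qed (simp add: U_def)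
  also have "\<dots> = (\<Sum>w\<in>W. \<phi> (\<sigma> (G w)))"
    by (subst sum.reindex[OF inj]) (auto simp: W_def red syl_cons_syl_cons shift)
  also have "\<dots> = level_sum (\<lambda>x. \<phi> (\<sigma> x)) ?\<beta> G"
    by (simp add: level_sum_def W_def)
  finally show ?thesis .
qed

lemma level_sum_mult:
  assumes \<phi>: "Modules.additive \<phi>" and D: "D \<in> Psi0_carrier n" and E: "E \<in> Psi0_carrier n"
    and d: "deg_bounded n d E"
    and W: "finite W" "\<And>w. D w \<noteq> 0 \<Longrightarrow> (\<Sum>j\<in>{1..n}. \<alpha> j) - d \<le> deg w \<Longrightarrow> w \<in> W"
      "\<And>w. w \<in> W \<Longrightarrow> fst ` set w \<subseteq> {1..n}"
  shows "level_sum \<phi> \<alpha> (D \<star> E) = (\<Sum>w\<in>W. level_sum (\<lambda>x. \<phi> (D w * x)) \<alpha> (act w E))"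
proof -
  define U where "U = {u. (D \<star> E) u \<noteq> 0 \<and> u \<in> level \<alpha>} \<union> (\<Union>w\<in>W. {u. act w E u \<noteq> 0 \<and> u \<in> level \<alpha>})"
  have act: "act w E \<in> Psi0_carrier n" if "w \<in> W" for w
    by (rule act_carrier[OF W(3)[OF that] E])
  have fin: "finite U"
    unfolding U_def using finite_level[OF mult_carrier[OF D E]] finite_level[OF act] W(1) by blast
  have deg: "deg u = (\<Sum>j\<in>{1..n}. \<alpha> j)" if "u \<in> U" for u
    using that deg_level carrier_letters[OF mult_carrier[OF D E]] carrier_letters[OF act]
    unfolding U_def by blast
  have DE: "(D \<star> E) u = (\<Sum>w\<in>W. D w * act w E u)" if "u \<in> U" for u
    by (rule mult_eq_sum[OF carrier_letters[OF D] d W(1)]) (auto simp: W(2) deg[OF that])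
  have "level_sum \<phi> \<alpha> (D \<star> E) = (\<Sum>u\<in>U. if u \<in> level \<alpha> then \<phi> ((D \<star> E) u) else 0)"
    by (rule level_sum_eq[where \<phi> = \<phi>, OF additive.zero[OF \<phi>] fin]) (auto simp: U_def)
  also have "\<dots> = (\<Sum>u\<in>U. \<Sum>w\<in>W. if u \<in> level \<alpha> then \<phi> (D w * act w E u) else 0)"
    by (rule sum.cong) (auto simp: DE additive.sum[OF \<phi>])
  also have "\<dots> = (\<Sum>w\<in>W. \<Sum>u\<in>U. if u \<in> level \<alpha> then \<phi> (D w * act w E u) else 0)"
    by (rule sum.swap)
  also have "\<dots> = (\<Sum>w\<in>W. level_sum (\<lambda>x. \<phi> (D w * x)) \<alpha> (act w E))"
    by (intro sum.cong refl level_sum_eq[symmetric])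
      (use fin in \<open>auto simp: U_def additive.zero[OF \<phi>]\<close>)
  finally show ?thesis .
qed

text \<open>A word with coefficient 1 on the right creates no commutation terms, and total exponents
  add. Only the total exponents of \<open>v\<close> matter, which makes commutators of variables
  invisible.\<close>

lemma level_sum_mult_monomial_one:
  assumes \<phi>: "Modules.additive \<phi>" and D: "D \<in> Psi0_carrier n" and v: "v \<in> reduced_words n"
  shows "level_sum \<phi> \<alpha> (D \<star> monomial 1 v) = level_sum \<phi> (\<lambda>j. \<alpha> j - total_exponent j v) D"
proof -
  let ?K = "(\<Sum>j\<in>{1..n}. \<alpha> j) - deg v" and ?\<beta> = "\<lambda>j. \<alpha> j - total_exponent j v"
  define W where "W = {w. D w \<noteq> 0 \<and> ?K \<le> deg w}"
  have letters: "fst ` set w \<subseteq> {1..n}" if "w \<in> W" for w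
    using that carrier_letters[OF D] by (simp add: W_def)
  have fin: "finite W" unfolding W_def by (rule carrier_finite_support[OF D])
  have K: "?K = (\<Sum>j\<in>{1..n}. ?\<beta> j)"
    using v deg_eq_sum_total_exponent[of v n] by (simp add: reduced_words_def sum_subtractf)
  have shift: "word_mult w v \<in> level \<alpha> \<longleftrightarrow> w \<in> level ?\<beta>" for w
    by (auto simp: level_def word_mult_bounds(4) eq_diff_eq)
  have "level_sum \<phi> \<alpha> (D \<star> monomial 1 v)
      = (\<Sum>w\<in>W. level_sum (\<lambda>x. \<phi> (D w * x)) \<alpha> (act w (monomial 1 v)))"
    by (rule level_sum_mult[OF \<phi> D monomial_carrier[OF v] monomial_deg_bounded[OF v] fin])
      (use letters in \<open>auto simp: W_def\<close>)
  also have "\<dots> = (\<Sum>w\<in>W. if w \<in> level ?\<beta> then \<phi> (D w) else 0)"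
    by (rule sum.cong)
      (simp_all add: act_monomial_one[OF letters v] level_sum_monomial additive.zero[OF \<phi>] shift)
  also have "\<dots> = level_sum \<phi> ?\<beta> D"
    by (rule level_sum_eq[where \<phi> = \<phi>, symmetric, OF additive.zero[OF \<phi>] fin])
      (use K deg_level[OF _ carrier_letters[OF D]] in \<open>auto simp: W_def\<close>)
  finally show ?thesis .
qed


section \<open>Leading coefficients\<close>

definition \<sigma>_power :: "int \<Rightarrow> 'a \<Rightarrow> 'a" where
  "\<sigma>_power e = (if 0 \<le> e then \<sigma> ^^ nat e else inv_into UNIV \<sigma> ^^ nat (- e))"

lemma \<sigma>_power_add_one: "\<sigma>_power (e + 1) a = \<sigma> (\<sigma>_power e a)"
proof (cases "0 \<le> e")
  case True
  then have "nat (e + 1) = Suc (nat e)" by simp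
  with True show ?thesis by (simp add: \<sigma>_power_def)
next
  case False
  then have e: "nat (- e) = Suc (nat (- (e + 1)))" by linarith
  have "\<sigma> (inv_into UNIV \<sigma> x) = x" for x
    using bij_\<sigma> by (simp add: bij_is_surj surj_f_inv_f)
  then have "\<sigma> (\<sigma>_power e a) = (inv_into UNIV \<sigma> ^^ nat (- (e + 1))) a"
    using False by (simp add: \<sigma>_power_def e del: funpow.simps(2)) (simp add: e)
  also have "\<dots> = \<sigma>_power (e + 1) a"
    using False by (cases "e = - 1") (auto simp: \<sigma>_power_def)
  finally show ?thesis ..
qed

lemma \<sigma>_power_add: "\<sigma>_power (e + f) a = \<sigma>_power e (\<sigma>_power f a)"
proof (induction e rule: int_induct[where k = 0])
  case base
  show ?case by (simp add: \<sigma>_power_def)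
next
  case (step1 i)
  then show ?case
    using \<sigma>_power_add_one[of "i + f" a] \<sigma>_power_add_one[of i "\<sigma>_power f a"] by (simp add: algebra_simps)
next
  case (step2 i)
  have "\<sigma> (\<sigma>_power (i - 1 + f) a) = \<sigma> (\<sigma>_power (i - 1) (\<sigma>_power f a))"
    using step2 \<sigma>_power_add_one[of "i - 1 + f" a] \<sigma>_power_add_one[of "i - 1" "\<sigma>_power f a"]
    by (simp add: algebra_simps)
  then show ?case using bij_\<sigma> by (simp add: bij_is_inj inj_eq)
qed

lemma \<sigma>_power_0 [simp]: "\<sigma>_power e 0 = 0"
proof (induction e rule: int_induct[where k = 0])
  case base
  show ?case by (simp add: \<sigma>_power_def)
next
  case (step1 i)
  then show ?case by (simp add: \<sigma>_power_add_one)
next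
  case (step2 i)
  then show ?case using \<sigma>_power_add_one[of "i - 1" 0] by (simp add: \<sigma>_eq_0_iff)
qed

lemma xi_coeff_top:
  assumes j: "j \<in> {1..n}"
  shows "xi_coeff \<sigma> (\<delta> j) e e a = \<sigma>_power e a"
proof -
  have step: "xi_coeff \<sigma> (\<delta> j) (i + 1) (i + 1) a = \<sigma> (xi_coeff \<sigma> (\<delta> j) i i a)" for i
    using add_one_xi[OF j, of i "i + 1" a] j by (simp add: xi_coeff_gt[OF additive_\<sigma> additive_\<delta> bij_\<sigma>])
  show ?thesis
  proof (induction e rule: int_induct[where k = 0])
    case base
    show ?case by (simp add: xi_coeff_0[OF additive_\<sigma> additive_\<delta>[OF j] bij_\<sigma>] \<sigma>_power_def)
  next
    case (step1 i)
    then show ?case by (simp add: step \<sigma>_power_add_one)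
  next
    case (step2 i)
    have "\<sigma> (xi_coeff \<sigma> (\<delta> j) (i - 1) (i - 1) a) = \<sigma> (\<sigma>_power (i - 1) a)"
      using step2 step[of "i - 1"] \<sigma>_power_add_one[of "i - 1" a] by simp
    then show ?case using bij_\<sigma> by (simp add: bij_is_inj inj_eq)
  qed
qed

text \<open>In the highest possible degree the range of \<open>s\<close> shrinks to the single value
  \<open>e\<close>.\<close>

lemma syl_top:
  assumes j: "j \<in> {1..n}" and G: "deg_bounded n d G" and u: "reduced u" "deg u = d + e"
  shows "syl (j, e) G u = \<sigma>_power e (G (syl_cons (j, - e) u))"
proof -
  have "syl (j, e) G u = (\<Sum>s\<in>{e..e}. xi_coeff \<sigma> (\<delta> j) e s (G (syl_cons (j, - s) u)))"
    by (rule syl_eq_sum[OF j G u(1)]) (simp add: u)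
  then show ?thesis by (simp add: xi_coeff_top[OF j])
qed

text \<open>Every term other than the leading one loses degree, so in degree \<open>deg w\<close>
  only the reduced form of \<open>w\<close> survives, with one power of \<sigma> per unit of
  exponent.\<close>

lemma act_top:
  assumes "fst ` set w \<subseteq> {1..n}" "deg u = deg w"
  shows "act w (monomial b []) u = (if u = word_mult w [] then \<sigma>_power (deg w) b else 0)"
  using assms
proof (induction w arbitrary: u)
  case Nil
  show ?case by (simp add: monomial_def \<sigma>_power_def)
next
  case (Cons x w)
  obtain j e where x: "x = (j, e)" by (cases x)
  have j: "j \<in> {1..n}" and w: "fst ` set w \<subseteq> {1..n}" using Cons(2) x by auto
  have bound: "deg_bounded n (deg w) (act w (monomial b []))"
    using act_deg_bounded[OF w monomial_deg_bounded[of "[]" b]] by simp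
  have red: "reduced (word_mult w [])" by (rule word_mult_bounds(1)) simp
  show ?case
  proof (cases "reduced u")
    case True
    have "act (x # w) (monomial b []) u = \<sigma>_power e (act w (monomial b []) (syl_cons (j, - e) u))"
      using syl_top[OF j bound True, of e] Cons(3) x by simp
    also have "\<dots> = (if syl_cons (j, - e) u = word_mult w [] then \<sigma>_power e (\<sigma>_power (deg w) b) else 0)"
      using Cons(1)[OF w, of "syl_cons (j, - e) u"] Cons(3) x by simp
    also have "\<dots> = (if u = word_mult (x # w) [] then \<sigma>_power (deg (x # w)) b else 0)"
      using syl_cons_eq_iff[OF True red, of j e] by (auto simp: x \<sigma>_power_add)
    finally show ?thesis .
  next
    case False
    then show ?thesis using reduced_syl_cons[OF red] by (auto simp: syl_not_reduced x)
  qed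
qed

lemma act_total_exponent:
  assumes "\<And>x. x \<in> set w \<Longrightarrow> fst x \<noteq> j" "\<And>v. G v \<noteq> 0 \<Longrightarrow> total_exponent j v = c"
    "act w G u \<noteq> 0"
  shows "total_exponent j u = c"
  using assms(1,3)
proof (induction w arbitrary: u)
  case Nil
  then show ?case using assms(2) by simp
next
  case (Cons x w)
  obtain k e where x: "x = (k, e)" by (cases x)
  have "syl (k, e) (act w G) u \<noteq> 0" using Cons(3) x by simp
  then obtain s v where "act w G v \<noteq> 0" "v = syl_cons (k, - s) u"
    by (rule syl_nonzeroE)
  moreover have "k \<noteq> j" using Cons(2)[of x] x by simp
  ultimately show ?case using Cons(1)[of v] Cons(2) by auto
qed

end


section \<open>The trace property\<close>

locale twisted_trace_system = twisted_system n \<sigma> \<delta>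
  for n and \<sigma> :: "'a::{ring,monoid_mult} \<Rightarrow> 'a" and \<delta> +
  fixes \<tau> :: "'a \<Rightarrow> complex"
  assumes \<tau>_add: "\<tau> (x + y) = \<tau> x + \<tau> y"
    and \<tau>_trace: "\<tau> (x * y) = \<tau> ((\<sigma> ^^ n) y * x)"
    and \<tau>_\<sigma>: "\<tau> (\<sigma> x) = \<tau> x"
    and \<tau>_\<delta>: "j \<in> {1..n} \<Longrightarrow> \<tau> (\<delta> j x) = 0"
    and \<delta>_comm: "j \<in> {1..n} \<Longrightarrow> k \<in> {1..n} \<Longrightarrow> \<delta> j (\<delta> k x) = \<delta> k (\<delta> j x)"
    and \<delta>_\<sigma>: "3 \<le> n \<Longrightarrow> j \<in> {1..n} \<Longrightarrow> \<delta> j (\<sigma> x) = \<sigma> (\<delta> j x)"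
begin

section \<open>Moving \<sigma> and \<delta>_j across \<tau>\<close>

lemma additive_\<tau>: "Modules.additive \<tau>"
  by (simp add: Modules.additive_def \<tau>_add)

lemmas \<tau>_0 [simp] = additive.zero[OF additive_\<tau>]

lemma additive_\<tau>_mult: "Modules.additive (\<lambda>x. \<tau> (a * x))"
  by (simp add: Modules.additive_def \<tau>_add distrib_left)

lemma \<tau>_mult_\<sigma>: "\<tau> (\<sigma> a * \<sigma> x) = \<tau> (a * x)"
  using \<tau>_\<sigma>[of "a * x"] by (simp add: \<sigma>_mult)

text \<open>Integration by parts: \<tau> kills \<delta>_j of a product, and the twisted Leibniz rule
  splits it.\<close>

lemma \<tau>_\<sigma>_mult_\<delta>: "j \<in> {1..n} \<Longrightarrow> \<tau> (\<sigma> a * \<delta> j x) = - \<tau> (\<delta> j a * x)"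
  using \<tau>_\<delta>[of j "a * x"] by (simp add: \<delta>_mult \<tau>_add add_eq_0_iff)

text \<open>For \<open>n = 2\<close> the maps \<open>\<sigma>\<close> and \<open>\<delta>\<^sub>k\<close> need not commute, but their commutator takes values in the
  radical of \<open>\<tau>\<close>: moving \<open>\<delta>\<^sub>k\<close> to the other factor once before and once after applying the
  \<open>\<sigma>\<^sup>2\<close>-trace property gives two expressions for the same number.\<close>

lemma \<tau>_mult_\<sigma>_\<delta>:
  assumes "2 \<le> n" and k: "k \<in> {1..n}"
  shows "\<tau> (a * \<sigma> (\<delta> k x)) = \<tau> (a * \<delta> k (\<sigma> x))"
proof (cases "3 \<le> n")
  case True
  then show ?thesis using \<delta>_\<sigma> k by simp
next
  case False
  with assms(1) have n: "n = 2" by simp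
  have tr: "\<tau> (x * y) = \<tau> (\<sigma> (\<sigma> y) * x)" for x y
    using \<tau>_trace[of x y] by (simp add: n numeral_2_eq_2)
  have "\<tau> (\<sigma> (\<sigma> (\<delta> k y)) * \<sigma> c) = \<tau> (\<sigma> (\<delta> k (\<sigma> y)) * \<sigma> c)" for c y
  proof -
    have "\<tau> (\<sigma> (\<sigma> (\<delta> k y)) * \<sigma> c) = \<tau> (\<sigma> c * \<delta> k y)" by (rule tr[symmetric])
    also have "\<dots> = - \<tau> (\<delta> k c * y)" by (rule \<tau>_\<sigma>_mult_\<delta>[OF k])
    also have "\<dots> = - \<tau> (\<sigma> (\<sigma> y) * \<delta> k c)" using tr by simp
    also have "\<dots> = \<tau> (\<delta> k (\<sigma> y) * c)" using \<tau>_\<sigma>_mult_\<delta>[OF k, of "\<sigma> y" c] by simp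
    also have "\<dots> = \<tau> (\<sigma> (\<delta> k (\<sigma> y)) * \<sigma> c)" by (rule \<tau>_mult_\<sigma>[symmetric])
    finally show ?thesis .
  qed
  then have *: "\<tau> (\<sigma> (\<delta> k y) * c) = \<tau> (\<delta> k (\<sigma> y) * c)" for c y
    unfolding \<tau>_mult_\<sigma> .
  \<comment> \<open>Writing the left factor as \<sigma>^2(a') lets the trace property carry it to
    the right, where the identity just proved applies.\<close>
  obtain a' where a': "a = \<sigma> (\<sigma> a')" using bij_\<sigma> by (metis bij_pointE)
  have "\<tau> (a * z) = \<tau> (z * a')" for z
    using tr[of a z] by (simp add: a' \<tau>_mult_\<sigma>)
  then show ?thesis using * by simp
qed

text \<open>Equality after letting the variables commute, with coefficients taken modulo the radical
  of \<tau>. The test element \<open>a\<close> is what makes the relation stable under xi_j, which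
  replaces \<open>a\<close> by elements such as \<open>\<delta> j a\<close>.\<close>

definition res_equiv :: "(word \<Rightarrow> 'a) \<Rightarrow> (word \<Rightarrow> 'a) \<Rightarrow> bool" (infix "\<approx>" 50) where
  "G \<approx> H \<longleftrightarrow> (\<forall>\<alpha> a. level_sum (\<lambda>x. \<tau> (a * x)) \<alpha> G = level_sum (\<lambda>x. \<tau> (a * x)) \<alpha> H)"

lemma res_equiv_refl: "G \<approx> G"
  and res_equiv_sym: "G \<approx> H \<Longrightarrow> H \<approx> G"
  and res_equiv_trans [trans]: "G \<approx> H \<Longrightarrow> H \<approx> K \<Longrightarrow> G \<approx> K"
  by (auto simp: res_equiv_def)

lemma level_sum_uminus: "level_sum (\<lambda>x. - \<phi> x) \<alpha> G = - level_sum \<phi> \<alpha> G"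
  by (simp add: level_sum_def sum_negf)

text \<open>\<sigma> and \<delta>_j are moved onto the test element, so sums for xi_j G are
  expressed by sums for G. Since \<sigma> is surjective, the test elements \<open>\<sigma> a\<close>
  are all elements.\<close>

lemma level_sum_\<tau>_syl_one:
  assumes j: "j \<in> {1..n}" and G: "G \<in> Psi0_carrier n"
  shows "level_sum (\<lambda>x. \<tau> (\<sigma> a * x)) \<alpha> (syl (j, 1) G)
    = level_sum (\<lambda>x. \<tau> (a * x)) (\<alpha>(j := \<alpha> j - 1)) G - level_sum (\<lambda>x. \<tau> (\<delta> j a * x)) \<alpha> G"
  using level_sum_syl_one[OF additive_\<tau>_mult j G, of "\<sigma> a" \<alpha>]
  by (simp add: \<tau>_mult_\<sigma> \<tau>_\<sigma>_mult_\<delta>[OF j] level_sum_uminus)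

lemma \<sigma>_surjE: obtains b where "a = \<sigma> b"
  using bij_\<sigma> by (metis bij_pointE)

lemma res_equiv_syl_one:
  assumes j: "j \<in> {1..n}" and G: "G \<in> Psi0_carrier n" and H: "H \<in> Psi0_carrier n" and "G \<approx> H"
  shows "syl (j, 1) G \<approx> syl (j, 1) H"
  unfolding res_equiv_def
proof (intro allI)
  fix \<alpha> a
  obtain b where "a = \<sigma> b" by (rule \<sigma>_surjE)
  then show "level_sum (\<lambda>x. \<tau> (a * x)) \<alpha> (syl (j, 1) G) = level_sum (\<lambda>x. \<tau> (a * x)) \<alpha> (syl (j, 1) H)"
    using \<open>G \<approx> H\<close> by (simp add: level_sum_\<tau>_syl_one[OF j G] level_sum_\<tau>_syl_one[OF j H] res_equiv_def)
qed

text \<open>Descending induction on the total degree, since the sums vanish in high degree.\<close>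

lemma res_equiv_syl_one_cancel:
  assumes j: "j \<in> {1..n}" and G: "G \<in> Psi0_carrier n" and H: "H \<in> Psi0_carrier n"
    and eq: "syl (j, 1) G \<approx> syl (j, 1) H"
  shows "G \<approx> H"
proof -
  obtain d d' where d: "deg_bounded n d G" "deg_bounded n d' H"
    using carrier_deg_bounded G H by blast
  let ?L = "\<lambda>a. level_sum (\<lambda>x. \<tau> (a * x))"
  have "?L a \<alpha> G = ?L a \<alpha> H" if "k = nat (max d d' + 1 - (\<Sum>j\<in>{1..n}. \<alpha> j))" for k \<alpha> a
    using that
  proof (induction k arbitrary: \<alpha> a)
    case 0
    then show ?case using level_sum_low[OF d(1)] level_sum_low[OF d(2)] by simp
  next
    case (Suc k)
    \<comment> \<open>Raising the exponent makes the \<sigma> part of xi_j G the wanted sum at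
      \<open>\<alpha>\<close>; the \<delta>_j part sits one degree higher, where the induction
      hypothesis applies.\<close>
    let ?\<beta> = "\<alpha>(j := \<alpha> j + 1)"
    have "?L (\<delta> j a) ?\<beta> G = ?L (\<delta> j a) ?\<beta> H"
      by (rule Suc(1)) (use Suc(2) sum_fun_upd[OF j, of \<alpha> 1] in linarith)
    moreover have "?\<beta>(j := ?\<beta> j - 1) = \<alpha>" by auto
    ultimately show ?case
      using eq level_sum_\<tau>_syl_one[OF j G, of a ?\<beta>] level_sum_\<tau>_syl_one[OF j H, of a ?\<beta>]
      unfolding res_equiv_def by simp
  qed
  then show ?thesis unfolding res_equiv_def by blast
qed

lemma syl_syl_carrier:
  "j \<in> {1..n} \<Longrightarrow> G \<in> Psi0_carrier n \<Longrightarrow> syl (j, a) (syl (j, b) G) = syl (j, a + b) G"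
  using syl_syl carrier_deg_bounded by blast

lemma syl_zero_carrier: "j \<in> {1..n} \<Longrightarrow> G \<in> Psi0_carrier n \<Longrightarrow> syl (j, 0) G = G"
  using syl_zero carrier_deg_bounded by blast

lemma res_equiv_syl:
  assumes j: "j \<in> {1..n}" and G: "G \<in> Psi0_carrier n" and H: "H \<in> Psi0_carrier n" and eq: "G \<approx> H"
  shows "syl (j, e) G \<approx> syl (j, e) H"
proof (induction e rule: int_induct[where k = 0])
  case base
  show ?case using eq by (simp add: syl_zero_carrier[OF j G] syl_zero_carrier[OF j H])
next
  case (step1 i)
  then show ?case
    using res_equiv_syl_one[OF j syl_carrier[OF j G] syl_carrier[OF j H], of i i]
    by (simp add: syl_syl_carrier[OF j G] syl_syl_carrier[OF j H] add.commute)
next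
  case (step2 i)
  then show ?case
    using res_equiv_syl_one_cancel[OF j syl_carrier[OF j G] syl_carrier[OF j H], of "i - 1" "i - 1"]
    by (simp add: syl_syl_carrier[OF j G] syl_syl_carrier[OF j H])
qed

lemma syl_one_commute:
  assumes j: "j \<in> {1..n}" and k: "k \<in> {1..n}" and "j \<noteq> k" and G: "G \<in> Psi0_carrier n"
  shows "syl (j, 1) (syl (k, 1) G) \<approx> syl (k, 1) (syl (j, 1) G)"
proof -
  have "2 \<le> n" using assms(1-3) by auto
  have add: "Modules.additive (\<lambda>x. \<tau> (a * \<sigma> x))" "i \<in> {1..n} \<Longrightarrow> Modules.additive (\<lambda>x. \<tau> (a * \<delta> i x))"
    for a i by (simp_all add: Modules.additive_def \<sigma>_add \<delta>_add \<tau>_add distrib_left)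
  \<comment> \<open>The term with \<open>\<sigma> (\<delta> k x)\<close> is already rewritten to
    \<open>\<delta> k (\<sigma> x)\<close>, which makes the formula symmetric in \<open>j\<close>
    and \<open>k\<close> up to the order of the two derivations.\<close>
  have expand: "level_sum (\<lambda>x. \<tau> (a * x)) \<alpha> (syl (j, 1) (syl (k, 1) G))
      = level_sum (\<lambda>x. \<tau> (a * \<sigma> (\<sigma> x))) ((\<alpha>(j := \<alpha> j - 1))(k := \<alpha> k - 1)) G
        + level_sum (\<lambda>x. \<tau> (a * \<delta> k (\<sigma> x))) (\<alpha>(j := \<alpha> j - 1)) G
        + level_sum (\<lambda>x. \<tau> (a * \<delta> j (\<sigma> x))) (\<alpha>(k := \<alpha> k - 1)) G
        + level_sum (\<lambda>x. \<tau> (a * \<delta> j (\<delta> k x))) \<alpha> G"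
    if "j \<in> {1..n}" "k \<in> {1..n}" "j \<noteq> k" for j k a \<alpha>
    unfolding level_sum_syl_one[OF additive_\<tau>_mult that(1) syl_carrier[OF that(2) G]]
      level_sum_syl_one[OF add(1) that(2) G] level_sum_syl_one[OF add(2)[OF that(1)] that(2) G]
    using that(3) \<tau>_mult_\<sigma>_\<delta>[OF \<open>2 \<le> n\<close> that(2)] by simp
  show ?thesis
    unfolding res_equiv_def expand[OF j k \<open>j \<noteq> k\<close>] expand[OF k j \<open>j \<noteq> k\<close>[symmetric]]
    using \<open>j \<noteq> k\<close> by (simp add: fun_upd_twist \<delta>_comm[OF j k])
qed

text \<open>Upwards the exchange is carried out below one more xi_k; downwards xi_k is put in front
  and cancelled. \<open>syl_commute\<close> applies this twice, first for \<open>e = 1\<close> and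
  then with the two variables interchanged.\<close>

lemma syl_commute_extend:
  assumes j: "j \<in> {1..n}" and k: "k \<in> {1..n}" and G: "G \<in> Psi0_carrier n"
    and comm: "\<And>H. H \<in> Psi0_carrier n \<Longrightarrow> syl (j, e) (syl (k, 1) H) \<approx> syl (k, 1) (syl (j, e) H)"
  shows "syl (j, e) (syl (k, f) G) \<approx> syl (k, f) (syl (j, e) G)"
proof (induction f rule: int_induct[where k = 0])
  case base
  show ?case
    by (simp add: syl_zero_carrier[OF k G] syl_zero_carrier[OF k syl_carrier[OF j G]] res_equiv_refl)
next
  case (step1 i)
  note c = syl_carrier[OF k G, of i] syl_carrier[OF j G, of e]
  have "syl (j, e) (syl (k, 1) (syl (k, i) G)) \<approx> syl (k, 1) (syl (j, e) (syl (k, i) G))"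
    by (rule comm[OF c(1)])
  also have "\<dots> \<approx> syl (k, 1) (syl (k, i) (syl (j, e) G))"
    by (rule res_equiv_syl[OF k syl_carrier[OF j c(1)] syl_carrier[OF k c(2)] step1(2)])
  finally show ?case
    by (simp add: syl_syl_carrier[OF k G] syl_syl_carrier[OF k c(2)] add.commute)
next
  case (step2 i)
  note c = syl_carrier[OF k G, of "i - 1"] syl_carrier[OF j G, of e]
  have "syl (k, 1) (syl (j, e) (syl (k, i - 1) G)) \<approx> syl (j, e) (syl (k, 1) (syl (k, i - 1) G))"
    by (rule res_equiv_sym[OF comm[OF c(1)]])
  also have "\<dots> \<approx> syl (k, 1) (syl (k, i - 1) (syl (j, e) G))"
    using step2(2) by (simp add: syl_syl_carrier[OF k G] syl_syl_carrier[OF k c(2)])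
  finally show ?case
    by (rule res_equiv_syl_one_cancel[OF k syl_carrier[OF j c(1)] syl_carrier[OF k c(2)]])
qed

lemma syl_commute:
  assumes j: "j \<in> {1..n}" and k: "k \<in> {1..n}" and jk: "j \<noteq> k" and G: "G \<in> Psi0_carrier n"
  shows "syl (j, e) (syl (k, f) G) \<approx> syl (k, f) (syl (j, e) G)"
proof -
  have *: "syl (j, 1) (syl (k, f) H) \<approx> syl (k, f) (syl (j, 1) H)" if "H \<in> Psi0_carrier n" for H
    by (rule syl_commute_extend[OF j k that]) (rule syl_one_commute[OF j k jk])
  have "syl (k, f) (syl (j, e) G) \<approx> syl (j, e) (syl (k, f) G)"
    by (rule syl_commute_extend[OF k j G]) (rule res_equiv_sym, rule *)
  then show ?thesis by (rule res_equiv_sym)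
qed

text \<open>By induction on the word, the collected power of xi_j absorbs a new xi_j in front, and
  any other new syllable is exchanged with it.\<close>

lemma act_collect:
  assumes j: "j \<in> {1..n}" and w: "fst ` set w \<subseteq> {1..n}" and G: "G \<in> Psi0_carrier n"
  shows "act w G \<approx> syl (j, total_exponent j w) (act (filter (\<lambda>x. fst x \<noteq> j) w) G)"
  using w
proof (induction w)
  case Nil
  show ?case by (simp add: syl_zero_carrier[OF j G] res_equiv_refl)
next
  case (Cons x w)
  obtain k e where x: "x = (k, e)" by (cases x)
  have k: "k \<in> {1..n}" and w: "fst ` set w \<subseteq> {1..n}" using Cons(2) x by auto
  let ?w = "filter (\<lambda>x. fst x \<noteq> j) w" and ?t = "total_exponent j w"
  have c: "act w G \<in> Psi0_carrier n" "act ?w G \<in> Psi0_carrier n"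
    by (rule act_carrier[OF _ G], use w in fastforce)+
  have IH: "syl (k, e) (act w G) \<approx> syl (k, e) (syl (j, ?t) (act ?w G))"
    by (rule res_equiv_syl[OF k c(1) syl_carrier[OF j c(2)] Cons(1)[OF w]])
  show ?case
  proof (cases "k = j")
    case True
    then show ?thesis using IH by (simp add: x syl_syl_carrier[OF j c(2)])
  next
    case False
    then show ?thesis
      using res_equiv_trans[OF IH syl_commute[OF k j False c(2)]] by (simp add: x)
  qed
qed

text \<open>Collecting the powers of \<open>\<xi>\<^sub>j\<close> on the left in \<open>w b\<close>, no \<open>\<xi>\<^sub>j\<^sup>-\<^sup>1\<close> can appear
  unless the total exponent of \<open>\<xi>\<^sub>j\<close> in \<open>w\<close> is \<open>-1\<close>; if this holds for all \<open>j\<close>, only the term of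
  highest degree \<open>\<sigma>\<^sup>-\<^sup>n(b) w\<close> contributes.\<close>

lemma level_sum_act_monomial:
  assumes w: "fst ` set w \<subseteq> {1..n}"
  shows "level_sum (\<lambda>x. \<tau> (a * x)) (\<lambda>_. - 1) (act w (monomial b []))
    = (if w \<in> level (\<lambda>_. - 1) then \<tau> (b * a) else 0)"
proof (cases "w \<in> level (\<lambda>_. - 1)")
  case True
  have "level_sum (\<lambda>x. \<tau> (a * x)) (\<lambda>_. - 1) (act w (monomial b []))
      = (\<Sum>u\<in>{word_mult w []}.
          if u \<in> level (\<lambda>_. - 1) then \<tau> (a * act w (monomial b []) u) else 0)"
  proof (rule level_sum_eq)
    fix u assume u: "act w (monomial b []) u \<noteq> 0" "u \<in> level (\<lambda>_. - 1)"
    \<comment> \<open>Prescribed total exponents fix the degree, here -n, so only the top degree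
      part of w b is seen.\<close>
    have "deg u = deg w"
      using deg_level[OF True w] deg_level[OF u(2) carrier_letters[OF act_carrier[OF w] u(1)]]
      by (simp add: monomial_carrier)
    then show "u \<in> {word_mult w []}" using act_top[OF w] u(1) by (auto split: if_splits)
  qed auto
  also have "\<dots> = \<tau> (a * act w (monomial b []) (word_mult w []))"
    using True by (simp add: level_def word_mult_bounds(4))
  also have "\<dots> = \<tau> (a * \<sigma>_power (- int n) b)"
    using deg_level[OF True w] by (simp add: act_top[OF w] word_mult_bounds(3))
  \<comment> \<open>The twist of the trace undoes exactly the \<sigma>^(-n) acquired by
    \<open>b\<close>.\<close>
  also have "\<dots> = \<tau> ((\<sigma> ^^ n) (\<sigma>_power (- int n) b) * a)" by (rule \<tau>_trace)
  also have "(\<sigma> ^^ n) (\<sigma>_power (- int n) b) = b"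
    using \<sigma>_power_add[of "int n" "- int n" b] by (simp add: \<sigma>_power_def[of "int n"] \<sigma>_power_def[of 0])
  finally show ?thesis using True by simp
next
  case False
  then obtain j where j: "j \<in> {1..n}" and t: "total_exponent j w \<noteq> - 1"
    by (auto simp: level_def)
  let ?t = "total_exponent j w" and ?G = "act (filter (\<lambda>x. fst x \<noteq> j) w) (monomial b [])"
  have m: "monomial b [] \<in> Psi0_carrier n" by (rule monomial_carrier) simp
  have G: "total_exponent j v = 0" if "?G v \<noteq> 0" for v
    by (rule act_total_exponent[OF _ _ that]) (auto simp: monomial_def split: if_splits)
  have "{u. syl (j, ?t) ?G u \<noteq> 0 \<and> u \<in> level (\<lambda>_. - 1)} = {}"
  proof (intro equals0I)
    fix u assume "u \<in> {u. syl (j, ?t) ?G u \<noteq> 0 \<and> u \<in> level (\<lambda>_. - 1)}"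
    then have u: "syl (j, ?t) ?G u \<noteq> 0" "total_exponent j u = - 1"
      using j by (auto simp: level_def)
    from u(1) obtain s v where s: "s \<le> ?t" "?G v \<noteq> 0" "v = syl_cons (j, - s) u"
      "xi_coeff \<sigma> (\<delta> j) ?t s (?G v) \<noteq> 0" by (rule syl_nonzeroE)
    \<comment> \<open>\<open>?G\<close> has no xi_j, so all of the exponent -1 stems from the
      collected power. A nonnegative power yields nonnegative exponents only, and a power below -1
      only exponents below -1.\<close>
    then have "s = - 1" using G[of v] u(2) by simp
    then show False using s(1,4) t by (auto simp: xi_coeff_def split: if_splits)
  qed
  then have "level_sum (\<lambda>x. \<tau> (a * x)) (\<lambda>_. - 1) (syl (j, ?t) ?G) = 0"
    unfolding level_sum_def by (simp only: sum.empty)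
  then show ?thesis
    using act_collect[OF j w m] False by (simp add: res_equiv_def)
qed

section \<open>Series commuting with all others under the residue\<close>

abbreviation res0' :: "(word \<Rightarrow> 'a) \<Rightarrow> complex" where
  "res0' \<equiv> res0 n \<tau>"

definition res_central :: "(word \<Rightarrow> 'a) set" where
  "res_central = {E \<in> Psi0_carrier n. \<forall>D\<in>Psi0_carrier n. res0' (D \<star> E) = res0' (E \<star> D)}"

lemma res0_add:
  "D \<in> Psi0_carrier n \<Longrightarrow> E \<in> Psi0_carrier n \<Longrightarrow> res0' (\<lambda>w. D w + E w) = res0' D + res0' E"
  unfolding res0_eq_level_sum by (rule level_sum_add[OF additive_\<tau>])

lemma mult_add_right_carrier:
  "D \<in> Psi0_carrier n \<Longrightarrow> G \<in> Psi0_carrier n \<Longrightarrow> H \<in> Psi0_carrier n \<Longrightarrow>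
    D \<star> (\<lambda>w. G w + H w) = (\<lambda>u. (D \<star> G) u + (D \<star> H) u)"
  using mult_add_right[of D _ G _ H] carrier_deg_bounded[of G] carrier_deg_bounded[of H] by blast

lemma mult_add_left_carrier:
  "D \<in> Psi0_carrier n \<Longrightarrow> G \<in> Psi0_carrier n \<Longrightarrow> H \<in> Psi0_carrier n \<Longrightarrow>
    (\<lambda>w. G w + H w) \<star> D = (\<lambda>u. (G \<star> D) u + (H \<star> D) u)"
  using mult_add_left[of G H _ D] carrier_deg_bounded[of D] by blast

lemma res_central_add:
  assumes "E \<in> res_central" "F \<in> res_central"
  shows "(\<lambda>w. E w + F w) \<in> res_central"
  using assms unfolding res_central_def
  by (auto simp: carrier_add mult_add_left_carrier mult_add_right_carrier res0_add mult_carrier)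

text \<open>First \<open>F\<close> is moved around the cycle, then \<open>E\<close>: DEF, FDE,
  EFD.\<close>

lemma res_central_mult:
  assumes "E \<in> res_central" "F \<in> res_central"
  shows "E \<star> F \<in> res_central"
proof -
  have c: "E \<in> Psi0_carrier n" "F \<in> Psi0_carrier n" using assms by (auto simp: res_central_def)
  have "res0' (D \<star> (E \<star> F)) = res0' (E \<star> F \<star> D)" if D: "D \<in> Psi0_carrier n" for D
  proof -
    have "res0' (D \<star> (E \<star> F)) = res0' (D \<star> E \<star> F)" by (simp add: mult_assoc[OF D c])
    also have "\<dots> = res0' (F \<star> (D \<star> E))"
      using assms(2) mult_carrier[OF D c(1)] by (auto simp: res_central_def)
    also have "\<dots> = res0' (F \<star> D \<star> E)" by (simp add: mult_assoc[OF c(2) D c(1)])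
    also have "\<dots> = res0' (E \<star> (F \<star> D))"
      using assms(1) mult_carrier[OF c(2) D] by (auto simp: res_central_def)
    also have "\<dots> = res0' (E \<star> F \<star> D)" by (simp add: mult_assoc[OF c D])
    finally show ?thesis .
  qed
  then show ?thesis using mult_carrier[OF c] by (simp add: res_central_def)
qed

lemma letter_reduced: "j \<in> {1..n} \<Longrightarrow> e \<noteq> 0 \<Longrightarrow> [(j, e)] \<in> reduced_words n"
  by (simp add: reduced_words_def)

lemma letter_mult:
  "j \<in> {1..n} \<Longrightarrow> e \<noteq> 0 \<Longrightarrow> D \<in> Psi0_carrier n \<Longrightarrow> monomial 1 [(j, e)] \<star> D = syl (j, e) D"
  using monomial_mult[OF letter_reduced, of j e _ D 1] carrier_deg_bounded by fastforce

text \<open>Both orders give the sum at exponent -2 for xi_j and -1 otherwise: on the right by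
  translating words, on the left because \<tau> ignores \<sigma> and kills \<delta>_j.\<close>

lemma letter_central: "j \<in> {1..n} \<Longrightarrow> monomial 1 [(j, 1)] \<in> res_central"
proof -
  assume j: "j \<in> {1..n}"
  have l: "[(j, 1)] \<in> reduced_words n" by (rule letter_reduced[OF j]) simp
  have "res0' (D \<star> monomial 1 [(j, 1)]) = res0' (monomial 1 [(j, 1)] \<star> D)"
    if D: "D \<in> Psi0_carrier n" for D
  proof -
    let ?\<beta> = "(\<lambda>_. - 1)(j := - 1 - 1 :: int)"
    have "res0' (monomial 1 [(j, 1)] \<star> D) = level_sum \<tau> ?\<beta> D"
      using level_sum_syl_one[OF additive_\<tau> j D, of "\<lambda>_. - 1"] \<tau>_\<delta>[OF j]
      unfolding res0_eq_level_sum
      by (simp add: letter_mult[OF j _ D] \<tau>_\<sigma> level_sum_def[of "\<lambda>x. 0"])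
    moreover have "(\<lambda>k. - 1 - total_exponent k [(j, 1)]) = ?\<beta>" by auto
    ultimately show ?thesis
      unfolding res0_eq_level_sum level_sum_mult_monomial_one[OF additive_\<tau> D l] by simp
  qed
  then show ?thesis using monomial_carrier[OF l] by (simp add: res_central_def)
qed

text \<open>With y the inverse of x = xi_j, write D y as x (y D y) and move x to the other end,
  where it cancels y.\<close>

lemma inverse_letter_central:
  assumes j: "j \<in> {1..n}"
  shows "monomial 1 [(j, - 1)] \<in> res_central"
proof -
  let ?x = "monomial 1 [(j, 1)] :: word \<Rightarrow> 'a" and ?y = "monomial 1 [(j, - 1)] :: word \<Rightarrow> 'a"
  have c: "?x \<in> Psi0_carrier n" "?y \<in> Psi0_carrier n"
    using monomial_carrier[OF letter_reduced[OF j, of 1]]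
      monomial_carrier[OF letter_reduced[OF j, of "- 1"]] by simp_all
  have xy: "?x \<star> (?y \<star> G) = G" "?y \<star> ?x = monomial 1 []" if "G \<in> Psi0_carrier n" for G
    using j c that by (simp_all add: letter_mult syl_carrier syl_syl_carrier syl_zero_carrier
        syl_monomial_one letter_reduced)
  have "res0' (D \<star> ?y) = res0' (?y \<star> D)" if D: "D \<in> Psi0_carrier n" for D
  proof -
    let ?D = "?y \<star> D"
    have D': "?D \<in> Psi0_carrier n" by (rule mult_carrier[OF c(2) D])
    have "res0' (D \<star> ?y) = res0' (?x \<star> (?D \<star> ?y))"
      using mult_assoc[OF c(1) D' c(2)] xy(1)[OF D] by simp
    also have "\<dots> = res0' (?D \<star> ?y \<star> ?x)"
      using letter_central[OF j] mult_carrier[OF D' c(2)] by (simp add: res_central_def)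
    also have "\<dots> = res0' ?D"
      using mult_assoc[OF D' c(2,1)] xy(2)[OF D] mult_one[OF D'] by simp
    finally show ?thesis .
  qed
  then show ?thesis using c(2) by (simp add: res_central_def)
qed

text \<open>Termwise, \<open>level_sum_act_monomial\<close> replaces the word sum of
  \<open>D w\<close> times w b by \<open>\<tau> (b * D w)\<close> for the words counted by the
  residue; this is the residue of b D.\<close>

lemma constant_central: "monomial b [] \<in> res_central"
proof -
  have c: "monomial b [] \<in> Psi0_carrier n" by (rule monomial_carrier) simp
  have "res0' (D \<star> monomial b []) = res0' (monomial b [] \<star> D)" if D: "D \<in> Psi0_carrier n" for D
  proof -
    let ?m = "\<lambda>_. - 1 :: int"
    define W where "W = {w. D w \<noteq> 0 \<and> (\<Sum>j\<in>{1..n}. ?m j) \<le> deg w}"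
    have letters: "fst ` set w \<subseteq> {1..n}" if "w \<in> W" for w
      using that carrier_letters[OF D] by (simp add: W_def)
    have fin: "finite W" unfolding W_def by (rule carrier_finite_support[OF D])
    have "deg_bounded n 0 (monomial b [] :: word \<Rightarrow> 'a)"
      using monomial_deg_bounded[of "[]" b] by simp
    then have "res0' (D \<star> monomial b [])
        = (\<Sum>w\<in>W. level_sum (\<lambda>x. \<tau> (D w * x)) ?m (act w (monomial b [])))"
      unfolding res0_eq_level_sum
      by (rule level_sum_mult[OF additive_\<tau> D c _ fin]) (use letters in \<open>auto simp: W_def\<close>)
    also have "\<dots> = (\<Sum>w\<in>W. if w \<in> level ?m then \<tau> (b * D w) else 0)"
      by (rule sum.cong) (simp_all add: level_sum_act_monomial[OF letters])
    also have "\<dots> = level_sum (\<lambda>x. \<tau> (b * x)) ?m D"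
      by (rule level_sum_eq[symmetric])
        (use fin deg_level[OF _ carrier_letters[OF D]] in \<open>auto simp: W_def\<close>)
    also have "\<dots> = res0' (\<lambda>w. b * D w)"
      unfolding res0_eq_level_sum by (rule level_sum_lmult[where \<phi> = \<tau>, symmetric, OF \<tau>_0 D])
    also have "(\<lambda>w. b * D w) = monomial b [] \<star> D"
      using monomial_mult[of "[]" _ D b] carrier_deg_bounded[OF D] by auto
    finally show ?thesis .
  qed
  then show ?thesis using c by (simp add: res_central_def)
qed

text \<open>The monomial is the product of the constant \<open>b\<close> with powers of single
  variables, all of which commute under the residue.\<close>

lemma monomial_central:
  assumes "w \<in> reduced_words n"
  shows "monomial b w \<in> res_central"
proof -
  have syl: "syl (j, e) G \<in> res_central" if j: "j \<in> {1..n}" and G: "G \<in> res_central" for j e G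
  proof (rule syl_closed_induct[where P = "\<lambda>H. H \<in> res_central", OF j _ G])
    show "G \<in> Psi0_carrier n" using G by (simp add: res_central_def)
    show "syl (j, 1) H \<in> res_central" "syl (j, - 1) H \<in> res_central"
      if "H \<in> Psi0_carrier n" "H \<in> res_central" for H
      using res_central_mult[OF letter_central[OF j] that(2)]
        res_central_mult[OF inverse_letter_central[OF j] that(2)]
      by (simp_all add: letter_mult[OF j _ that(1)])
  qed
  have "act w (monomial 1 []) \<in> res_central" if "fst ` set w \<subseteq> {1..n}" for w
    using that by (induction w) (auto simp: constant_central intro: syl)
  then have "monomial b [] \<star> act w (monomial 1 []) \<in> res_central"
    using assms by (intro res_central_mult constant_central) (simp add: reduced_words_def)
  moreover have "act w (monomial 1 []) = monomial 1 w"
    using assms by (simp add: act_monomial_one word_mult_Nil_reduced reduced_words_def)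
  moreover have "monomial b [] \<star> monomial 1 w = monomial b w"
    using monomial_mult[OF _ monomial_deg_bounded[OF assms], of "[]" b 1]
    by (auto simp: monomial_def)
  ultimately show ?thesis by simp
qed

lemma finite_support_central:
  assumes "finite W" "W \<subseteq> reduced_words n"
  shows "(\<lambda>w. if w \<in> W then E w else 0) \<in> res_central"
  using assms
proof (induction W)
  case empty
  have "(\<lambda>w. 0 :: 'a) = monomial 0 []" by (auto simp: monomial_def)
  then show ?case using constant_central[of 0] by simp
next
  case (insert v W)
  have "(\<lambda>w. if w \<in> insert v W then E w else 0)
      = (\<lambda>w. monomial (E v) v w + (if w \<in> W then E w else 0))"
    using insert(2) by (auto simp: monomial_def)
  then show ?case using res_central_add[OF monomial_central insert(3)] insert(4) by simp
qed

text \<open>Terms of sufficiently low degree do not contribute to the residue of a product, so that one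
  factor may be truncated to finitely many terms.\<close>

lemma res0_mult_commute:
  assumes D: "D \<in> Psi0_carrier n" and E: "E \<in> Psi0_carrier n"
  shows "res0' (D \<star> E) = res0' (E \<star> D)"
proof -
  obtain d e where d: "deg_bounded n d D" and e: "deg_bounded n e E"
    using carrier_deg_bounded D E by blast
  \<comment> \<open>Words counted by the residue have degree -n. The part of \<open>E\<close> below
    degree \<open>K\<close> yields products of degree at most -n - 1.\<close>
  define K where "K = - int n - d"
  define W where "W = {w. E w \<noteq> 0 \<and> K \<le> deg w}"
  define E1 where "E1 = (\<lambda>w. if w \<in> W then E w else 0)"
  define E2 where "E2 = (\<lambda>w. if w \<in> W then 0 else E w)"
  have c1: "E1 \<in> Psi0_carrier n"
    by (rule carrier_support_subset[OF E]) (simp add: E1_def split: if_splits)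
  have c2: "E2 \<in> Psi0_carrier n"
    by (rule carrier_support_subset[OF E]) (simp add: E2_def split: if_splits)
  have split: "E = (\<lambda>w. E1 w + E2 w)" by (auto simp: E1_def E2_def)
  have "finite W" "W \<subseteq> reduced_words n"
    using carrier_finite_support[OF E] e unfolding W_def deg_bounded_def by auto
  then have "E1 \<in> res_central" unfolding E1_def by (rule finite_support_central)
  then have E1: "res0' (D \<star> E1) = res0' (E1 \<star> D)" using D by (simp add: res_central_def)
  have "deg_bounded n (K - 1) E2"
    using e unfolding deg_bounded_def E2_def W_def by auto
  then have "deg_bounded n (d + (K - 1)) (D \<star> E2)" "deg_bounded n (K - 1 + d) (E2 \<star> D)"
    using mult_deg_bounded d by blast+
  then have "res0' (D \<star> E2) = 0" "res0' (E2 \<star> D) = 0"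
    unfolding res0_eq_level_sum by (auto intro!: level_sum_low simp: K_def)
  then show ?thesis
    using E1 D c1 c2 unfolding split
    by (simp add: mult_add_left_carrier mult_add_right_carrier res0_add mult_carrier)
qed

section \<open>Passage to the quotient\<close>

lemma Psi0_simps [simp]:
  "carrier (Psi0 n \<sigma> \<delta>) = Psi0_carrier n"
  "D \<otimes>\<^bsub>Psi0 n \<sigma> \<delta>\<^esub> E = D \<star> E"
  "\<one>\<^bsub>Psi0 n \<sigma> \<delta>\<^esub> = monomial 1 []"
  "\<zero>\<^bsub>Psi0 n \<sigma> \<delta>\<^esub> = (\<lambda>w. 0)"
  "D \<oplus>\<^bsub>Psi0 n \<sigma> \<delta>\<^esub> E = (\<lambda>w. D w + E w)"
  by (simp_all add: Psi0_def)

lemma a_inv_Psi0: "D \<in> Psi0_carrier n \<Longrightarrow> \<ominus>\<^bsub>Psi0 n \<sigma> \<delta>\<^esub> D = (\<lambda>w. - D w)"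
proof -
  assume D: "D \<in> Psi0_carrier n"
  interpret ring "Psi0 n \<sigma> \<delta>" by (rule ring_Psi0)
  show ?thesis
    using D by (intro minus_equality) (auto simp: carrier_uminus)
qed

lemma res0_uminus: "res0' (\<lambda>w. - D w) = - res0' D"
  unfolding res0_def by (simp add: additive.minus[OF additive_\<tau>] sum_negf)

lemma res0_minus:
  assumes "D \<in> Psi0_carrier n" "E \<in> Psi0_carrier n"
  shows "res0' (D \<ominus>\<^bsub>Psi0 n \<sigma> \<delta>\<^esub> E) = res0' D - res0' E"
  unfolding a_minus_def a_inv_Psi0[OF assms(2)] Psi0_simps
  using res0_add[OF assms(1) carrier_uminus[OF assms(2)]] by (simp add: res0_uminus)

text \<open>The radical of the bilinear form sending D, G to the residue of D G.\<close>

definition res_kernel :: "(word \<Rightarrow> 'a) set" where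
  "res_kernel = {G \<in> Psi0_carrier n. \<forall>D\<in>Psi0_carrier n. res0' (D \<star> G) = 0}"

text \<open>Absorption from the left is associativity. Absorption from the right moves the extra
  factor to the front by the trace property on series.\<close>

lemma ideal_res_kernel: "ideal res_kernel (Psi0 n \<sigma> \<delta>)"
proof -
  interpret ring "Psi0 n \<sigma> \<delta>" by (rule ring_Psi0)
  show ?thesis
  proof (rule idealI[OF ring_Psi0])
    show "subgroup res_kernel (add_monoid (Psi0 n \<sigma> \<delta>))"
    proof (rule add.subgroupI)
      show "res_kernel \<noteq> {}"
        using carrier_0 r_null by (auto simp: res_kernel_def res0_def)
      fix G assume G: "G \<in> res_kernel"
      then have c: "G \<in> Psi0_carrier n" by (simp add: res_kernel_def)
      have "res0' (D \<star> (\<lambda>w. - G w)) = 0" if D: "D \<in> Psi0_carrier n" for D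
        using G r_minus[of D G] a_inv_Psi0[OF c] a_inv_Psi0[OF mult_carrier[OF D c]] c D
        by (simp add: res_kernel_def res0_uminus)
      then show "\<ominus>\<^bsub>Psi0 n \<sigma> \<delta>\<^esub> G \<in> res_kernel"
        using c by (simp add: res_kernel_def a_inv_Psi0 carrier_uminus)
    next
      fix G H assume "G \<in> res_kernel" "H \<in> res_kernel"
      then show "G \<oplus>\<^bsub>Psi0 n \<sigma> \<delta>\<^esub> H \<in> res_kernel"
        by (simp add: res_kernel_def carrier_add mult_add_right_carrier res0_add mult_carrier)
    qed (auto simp: res_kernel_def)
  next
    fix G E assume G: "G \<in> res_kernel" and "E \<in> carrier (Psi0 n \<sigma> \<delta>)"
    then have c: "G \<in> Psi0_carrier n" "E \<in> Psi0_carrier n" by (auto simp: res_kernel_def)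
    have "res0' (D \<star> (E \<star> G)) = 0" if D: "D \<in> Psi0_carrier n" for D
      using G mult_carrier[OF D c(2)] by (simp add: res_kernel_def flip: mult_assoc[OF D c(2,1)])
    then show "E \<otimes>\<^bsub>Psi0 n \<sigma> \<delta>\<^esub> G \<in> res_kernel"
      using mult_carrier c by (simp add: res_kernel_def)
    have "res0' (D \<star> (G \<star> E)) = 0" if D: "D \<in> Psi0_carrier n" for D
    proof -
      have "res0' (D \<star> (G \<star> E)) = res0' (E \<star> (D \<star> G))"
        using res0_mult_commute[OF mult_carrier[OF D c(1)] c(2)] mult_assoc[OF D c] by simp
      also have "\<dots> = 0"
        using G mult_carrier[OF c(2) D] by (simp add: res_kernel_def flip: mult_assoc[OF c(2) D c(1)])
      finally show ?thesis .
    qed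
    then show "G \<otimes>\<^bsub>Psi0 n \<sigma> \<delta>\<^esub> E \<in> res_kernel"
      using mult_carrier c by (simp add: res_kernel_def)
  qed
qed

lemma xi_carrier: "j \<in> {1..n} \<Longrightarrow> (xi j :: word \<Rightarrow> 'a) \<in> Psi0_carrier n"
  unfolding xi_def by (rule monomial_carrier, rule letter_reduced) auto

lemma xi_mult_xi:
  "j \<in> {1..n} \<Longrightarrow> k \<in> {1..n} \<Longrightarrow> xi j \<star> xi k = monomial 1 (word_mult [(j, 1)] [(k, 1)])"
  using letter_mult[of j 1 "monomial 1 [(k, 1)]"] syl_monomial_one[of j "[(k, 1)]" 1]
    letter_reduced[of k 1] xi_carrier[of k] by (simp add: xi_def)

lemma Psi_ideal_generators:
  fixes k l
  defines "c \<equiv> xi k \<otimes>\<^bsub>Psi0 n \<sigma> \<delta>\<^esub> xi l \<ominus>\<^bsub>Psi0 n \<sigma> \<delta>\<^esub> xi l \<otimes>\<^bsub>Psi0 n \<sigma> \<delta>\<^esub> xi k"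
  assumes k: "k \<in> {1..n}" and l: "l \<in> {1..n}"
  shows "c \<in> res_kernel"
proof -
  interpret ring "Psi0 n \<sigma> \<delta>" by (rule ring_Psi0)
  let ?u = "\<lambda>k l. word_mult [(k, 1)] [(l, 1)]"
  have u: "?u k l \<in> reduced_words n" if "k \<in> {1..n}" "l \<in> {1..n}" for k l
    by (rule word_mult_reduced_words[OF _ letter_reduced[OF that(2)]]) (use that in auto)
  have kl: "xi k \<star> xi l \<in> Psi0_carrier n" "xi l \<star> xi k \<in> Psi0_carrier n"
    using xi_carrier k l by (auto intro: mult_carrier)
  have "res0' (D \<star> c) = 0" if D: "D \<in> Psi0_carrier n" for D
  proof -
    have "D \<otimes>\<^bsub>Psi0 n \<sigma> \<delta>\<^esub> c
        = D \<star> (xi k \<star> xi l) \<ominus>\<^bsub>Psi0 n \<sigma> \<delta>\<^esub> D \<star> (xi l \<star> xi k)"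
      unfolding c_def using kl D by (simp add: a_minus_def r_distr r_minus flip: Psi0_simps)
    then have "res0' (D \<star> c) = res0' (D \<star> (xi k \<star> xi l)) - res0' (D \<star> (xi l \<star> xi k))"
      using res0_minus[OF mult_carrier[OF D kl(1)] mult_carrier[OF D kl(2)]] by simp
    also have "\<dots> = 0"
      unfolding xi_mult_xi[OF k l] xi_mult_xi[OF l k] res0_eq_level_sum
        level_sum_mult_monomial_one[OF additive_\<tau> D u[OF k l]]
        level_sum_mult_monomial_one[OF additive_\<tau> D u[OF l k]]
      by (simp add: add.commute)
    finally show ?thesis .
  qed
  moreover have "c \<in> Psi0_carrier n"
    unfolding c_def using kl minus_closed by simp
  ultimately show ?thesis by (simp add: res_kernel_def)
qed

text \<open>The generated ideal is the least one containing the commutators and so lies in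
  \<open>res_kernel\<close>; its elements need not be described.\<close>

lemma ideal_Psi_ideal: "ideal (Psi_ideal n \<sigma> \<delta>) (Psi0 n \<sigma> \<delta>)"
  and Psi_ideal_subset: "Psi_ideal n \<sigma> \<delta> \<subseteq> res_kernel"
proof -
  interpret ring "Psi0 n \<sigma> \<delta>" by (rule ring_Psi0)
  let ?S = "{xi k \<otimes>\<^bsub>Psi0 n \<sigma> \<delta>\<^esub> xi l \<ominus>\<^bsub>Psi0 n \<sigma> \<delta>\<^esub> xi l \<otimes>\<^bsub>Psi0 n \<sigma> \<delta>\<^esub> xi k | k l.
          k \<in> {1..n} \<and> l \<in> {1..n}}"
  have S: "?S \<subseteq> res_kernel" using Psi_ideal_generators by blast
  then have "?S \<subseteq> carrier (Psi0 n \<sigma> \<delta>)" by (auto simp: res_kernel_def)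
  then show "ideal (Psi_ideal n \<sigma> \<delta>) (Psi0 n \<sigma> \<delta>)"
    unfolding Psi_ideal_def by (rule genideal_ideal)
  show "Psi_ideal n \<sigma> \<delta> \<subseteq> res_kernel"
    unfolding Psi_ideal_def by (rule genideal_minimal[OF ideal_res_kernel S])
qed

text \<open>Testing membership in the radical with the unit series gives vanishing residue, hence
  well-definedness on classes.\<close>

lemma res0_Psi_ideal: "G \<in> Psi_ideal n \<sigma> \<delta> \<Longrightarrow> G \<in> Psi0_carrier n \<and> res0' G = 0"
proof -
  assume "G \<in> Psi_ideal n \<sigma> \<delta>"
  then have G: "G \<in> res_kernel" using Psi_ideal_subset by blast
  then have c: "G \<in> Psi0_carrier n" by (simp add: res_kernel_def)
  have "res0' (monomial 1 [] \<star> G) = 0"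
    using G monomial_carrier[OF Nil_reduced_words, of 1] by (simp add: res_kernel_def)
  then show ?thesis
    using c ring.ring_simprules(12)[OF ring_Psi0, of G] by simp
qed

lemma Psi_class_iff:
  "D' \<in> Psi_class n \<sigma> \<delta> D \<longleftrightarrow> (\<exists>G\<in>Psi_ideal n \<sigma> \<delta>. D' = (\<lambda>w. G w + D w))"
  by (auto simp: Psi_class_def a_r_coset_def')

lemma res0_Psi_class: "D \<in> Psi0_carrier n \<Longrightarrow> D' \<in> Psi_class n \<sigma> \<delta> D \<Longrightarrow> res0' D' = res0' D"
  using res0_Psi_ideal by (auto simp: Psi_class_iff res0_add)

lemma res_Psi_class: "D \<in> Psi0_carrier n \<Longrightarrow> res n \<tau> (Psi_class n \<sigma> \<delta> D) = res0' D"
proof -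
  assume D: "D \<in> Psi0_carrier n"
  interpret ideal "Psi_ideal n \<sigma> \<delta>" "Psi0 n \<sigma> \<delta>" by (rule ideal_Psi_ideal)
  have "D \<in> Psi_class n \<sigma> \<delta> D"
    using a_rcos_self[of D] D by (simp add: Psi_class_def)
  then have "res0' D \<in> res0' ` Psi_class n \<sigma> \<delta> D" by (rule imageI)
  moreover have "res0' ` Psi_class n \<sigma> \<delta> D \<subseteq> {res0' D}"
    using res0_Psi_class[OF D] by blast
  ultimately have "res0' ` Psi_class n \<sigma> \<delta> D = {res0' D}" by blast
  then show ?thesis by (simp add: res_def)
qed

section \<open>Operations on classes and the explicit residue formula\<close>

lemma ring_Psi: "ring (Psi n \<sigma> \<delta>)"
  unfolding Psi_def by (rule ideal.quotient_is_ring[OF ideal_Psi_ideal])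

lemma Psi_carrierE:
  assumes "X \<in> carrier (Psi n \<sigma> \<delta>)"
  obtains D where "D \<in> Psi0_carrier n" "X = Psi_class n \<sigma> \<delta> D"
  using assms by (auto simp: Psi_def FactRing_def A_RCOSETS_def' Psi_class_def)

lemma Psi_class_carrier: "D \<in> Psi0_carrier n \<Longrightarrow> Psi_class n \<sigma> \<delta> D \<in> carrier (Psi n \<sigma> \<delta>)"
  by (auto simp: Psi_def FactRing_def A_RCOSETS_def' Psi_class_def)

lemma Psi_class_add:
  assumes "D \<in> Psi0_carrier n" "E \<in> Psi0_carrier n"
  shows "Psi_class n \<sigma> \<delta> D \<oplus>\<^bsub>Psi n \<sigma> \<delta>\<^esub> Psi_class n \<sigma> \<delta> E
    = Psi_class n \<sigma> \<delta> (\<lambda>w. D w + E w)"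
  using assms abelian_subgroup.a_rcos_sum[OF abelian_subgroupI3[OF ideal.axioms(1)[OF ideal_Psi_ideal]],
      of D E] ring.is_abelian_group[OF ring_Psi0]
  by (simp add: Psi_def FactRing_def Psi_class_def)

lemma Psi_class_mult:
  assumes "D \<in> Psi0_carrier n" "E \<in> Psi0_carrier n"
  shows "Psi_class n \<sigma> \<delta> D \<otimes>\<^bsub>Psi n \<sigma> \<delta>\<^esub> Psi_class n \<sigma> \<delta> E = Psi_class n \<sigma> \<delta> (D \<star> E)"
  using assms ideal.rcoset_mult_add[OF ideal_Psi_ideal, of D E]
  by (simp add: Psi_def FactRing_def Psi_class_def)

text \<open>A single row is determined by its total exponents, so the row with all entries -1 is the
  only one whose word the residue counts.\<close>

lemma res_array_series:
  fixes a :: "int list list \<Rightarrow> 'a"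
  assumes a: "\<And>i. a i \<noteq> 0 \<Longrightarrow> is_array n 1 N i"
  shows "res0' (array_series n a) = \<tau> (a [replicate n (- 1)])"
proof -
  let ?m = "replicate n (- 1 :: int)"
  define w where "w = array_word n [?m]"
  \<comment> \<open>Each variable owns exactly one column, and dropping syllables with exponent 0
    does not change totals. Columns are numbered from 1, list positions from 0.\<close>
  have total: "total_exponent j (array_word n [row]) = row ! (j - 1)"
    if "length row = n" "j \<in> {1..n}" for row j
  proof -
    have "total_exponent j (zip xs row) = (\<Sum>k<length row. if xs ! k = j then row ! k else 0)"
      if "length xs = length row" for xs row
      using that
      by (induction xs row rule: list_induct2)
        (simp_all add: sum.lessThan_Suc_shift del: sum.lessThan_Suc cong: if_cong)
    from this[of "[1..<Suc n]" row] have "total_exponent j (zip [1..<Suc n] row)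
        = (\<Sum>k<n. if [1..<Suc n] ! k = j then row ! k else 0)"
      using that(1) by simp
    also have "\<dots> = (\<Sum>k<n. if k = j - 1 then row ! k else 0)"
      by (rule sum.cong) (use that(2) in \<open>auto simp del: upt_Suc\<close>)
    also have "\<dots> = row ! (j - 1)" using that(2) by (subst sum.delta) auto
    finally show ?thesis by (simp add: array_word_def word_mult_bounds(4) del: upt_Suc)
  qed
  have unique: "i = [?m]" if i: "a i \<noteq> 0" "array_word n i \<in> level (\<lambda>_. - 1)" for i
  proof -
    obtain row where row: "i = [row]" "length row = n"
      using a[OF i(1)] by (auto simp: is_array_def length_Suc_conv)
    have "row ! k = - 1" if "k < n" for k
      using total[OF row(2), of "Suc k"] i(2) that by (simp add: row level_def)
    then show ?thesis using row by (simp add: list_eq_iff_nth_eq)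
  qed
  have w: "w \<in> level (\<lambda>_. - 1)"
  proof -
    have "total_exponent j w = - 1" if j: "j \<in> {1..n}" for j
    proof -
      have "j - 1 < n" using j by auto
      then show ?thesis unfolding w_def using total[OF _ j, of ?m] by simp
    qed
    then show ?thesis unfolding level_def by blast
  qed
  have val: "array_series n a u = (if u = w then a [?m] else 0)" if "u \<in> level (\<lambda>_. - 1)" for u
  proof -
    let ?I = "{i. a i \<noteq> 0 \<and> array_word n i = u}"
    have single: "I = (if P then {x} else {})" if "I \<subseteq> {x}" "x \<in> I \<longleftrightarrow> P"
      for I and x :: "int list list" and P
      using that by (cases P) auto
    have "?I \<subseteq> {[?m]}"
      using unique that by blast
    moreover have "[?m] \<in> ?I \<longleftrightarrow> u = w \<and> a [?m] \<noteq> 0"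
      unfolding w_def by blast
    ultimately have "?I = (if u = w \<and> a [?m] \<noteq> 0 then {[?m]} else {})"
      by (rule single)
    then show ?thesis unfolding array_series_def by simp
  qed
  have "res0' (array_series n a) = (\<Sum>u\<in>{w}. if u \<in> level (\<lambda>_. - 1) then \<tau> (array_series n a u) else 0)"
    unfolding res0_eq_level_sum using val by (intro level_sum_eq) (auto split: if_splits)
  then show ?thesis using w val[OF w] by simp
qed

end

text \<open>Scaling is left multiplication by a constant, so ideals of series are closed under
  it.\<close>

lemma (in complex_algebra) scale_eq_mult: "scale c x = scale c 1 * x"
  by (simp flip: scale_mult_left)

theorem theorem4p4:
  fixes scale :: "complex \<Rightarrow> 'a::{ring,monoid_mult} \<Rightarrow> 'a"
    and \<sigma> :: "'a \<Rightarrow> 'a" and \<delta> :: "nat \<Rightarrow> 'a \<Rightarrow> 'a" and \<tau> :: "'a \<Rightarrow> complex" and n :: nat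
  assumes "complex_algebra scale"
    and "1 \<le> n"
    and "algebra_automorphism scale \<sigma>"
    and "\<forall>j\<in>{1..n}. twisted_derivation scale \<sigma> (\<delta> j)"
    and "\<forall>j\<in>{1..n}. \<forall>k\<in>{1..n}. \<delta> j \<circ> \<delta> k = \<delta> k \<circ> \<delta> j"
    and "3 \<le> n \<Longrightarrow> \<forall>j\<in>{1..n}. \<delta> j \<circ> \<sigma> = \<sigma> \<circ> \<delta> j"
    and "twisted_trace scale (\<sigma> ^^ n) \<tau>"
    and "\<tau> \<circ> \<sigma> = \<tau>"
    and "\<forall>j\<in>{1..n}. \<tau> \<circ> \<delta> j = (\<lambda>x. 0)"
  shows
    "ring (Psi0 n \<sigma> \<delta>) \<and> ring (Psi n \<sigma> \<delta>) \<and>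
     (\<forall>D \<in> carrier (Psi0 n \<sigma> \<delta>). \<forall>D' \<in> Psi_class n \<sigma> \<delta> D. res0 n \<tau> D' = res0 n \<tau> D) \<and>
     (\<forall>D \<in> carrier (Psi0 n \<sigma> \<delta>). res n \<tau> (Psi_class n \<sigma> \<delta> D) = res0 n \<tau> D) \<and>
     (\<forall>a N. (\<forall>i. a i \<noteq> 0 \<longrightarrow> is_array n 1 N i) \<longrightarrow>
        res n \<tau> (Psi_class n \<sigma> \<delta> (array_series n a)) = \<tau> (a [replicate n (-1)])) \<and>
     (\<forall>X \<in> carrier (Psi n \<sigma> \<delta>). \<forall>Y \<in> carrier (Psi n \<sigma> \<delta>).
        res n \<tau> (X \<oplus>\<^bsub>Psi n \<sigma> \<delta>\<^esub> Y) = res n \<tau> X + res n \<tau> Y) \<and>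
     (\<forall>c. \<forall>X \<in> carrier (Psi n \<sigma> \<delta>).
        Psi_scale n scale \<sigma> \<delta> c X \<in> carrier (Psi n \<sigma> \<delta>) \<and>
        res n \<tau> (Psi_scale n scale \<sigma> \<delta> c X) = c * res n \<tau> X) \<and>
     (\<forall>X \<in> carrier (Psi n \<sigma> \<delta>). \<forall>Y \<in> carrier (Psi n \<sigma> \<delta>).
        res n \<tau> (X \<otimes>\<^bsub>Psi n \<sigma> \<delta>\<^esub> Y) = res n \<tau> (Y \<otimes>\<^bsub>Psi n \<sigma> \<delta>\<^esub> X))"
proof -
  interpret complex_algebra scale by fact
  have lin: "Vector_Spaces.linear scale (*) \<tau>" using assms(7) by (simp add: twisted_trace_def)
  interpret twisted_trace_system n \<sigma> \<delta> \<tau>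
  proof
    show "\<sigma> (x + y) = \<sigma> x + \<sigma> y" "\<sigma> (x * y) = \<sigma> x * \<sigma> y" "\<sigma> 1 = 1" "bij \<sigma>" for x y
      using assms(3) by (auto simp: algebra_automorphism_def Vector_Spaces.linear_iff)
    show "\<delta> j (x + y) = \<delta> j x + \<delta> j y" "\<delta> j (x * y) = \<delta> j x * y + \<sigma> x * \<delta> j y"
      if "j \<in> {1..n}" for j x y
      using assms(4) that by (auto simp: twisted_derivation_def Vector_Spaces.linear_iff)
    show "\<tau> (x + y) = \<tau> x + \<tau> y" for x y using lin by (simp add: Vector_Spaces.linear_iff)
    show "\<tau> (x * y) = \<tau> ((\<sigma> ^^ n) y * x)" for x y
      using assms(7) by (simp add: twisted_trace_def)
    show "\<tau> (\<sigma> x) = \<tau> x" for x using assms(8) by (metis comp_apply)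
    show "\<tau> (\<delta> j x) = 0" if "j \<in> {1..n}" for j x using assms(9) that by (metis comp_apply)
    show "\<delta> j (\<delta> k x) = \<delta> k (\<delta> j x)" if "j \<in> {1..n}" "k \<in> {1..n}" for j k x
      using assms(5) that by (metis comp_apply)
    show "\<delta> j (\<sigma> x) = \<sigma> (\<delta> j x)" if "3 \<le> n" "j \<in> {1..n}" for j x
      using assms(6) that by (metis comp_apply)
  qed
  have scale_0: "scale c 0 = 0" for c by (rule scale_zero_right)
  have scaled: "(\<lambda>w. scale c (D w)) \<in> Psi0_carrier n" if "D \<in> Psi0_carrier n" for c D
    using carrier_support_subset[OF that] by (metis scale_0)
  have res_scaled: "res0 n \<tau> (\<lambda>w. scale c (D w)) = c * res0 n \<tau> D" if "D \<in> Psi0_carrier n" for c D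
  proof -
    let ?U = "{u. D u \<noteq> 0 \<and> u \<in> level (\<lambda>_. - 1)}"
    have "res0 n \<tau> (\<lambda>w. scale c (D w))
        = (\<Sum>u\<in>?U. if u \<in> level (\<lambda>_. - 1) then \<tau> (scale c (D u)) else 0)"
      unfolding res0_eq_level_sum using finite_level[OF that] by (intro level_sum_eq) auto
    also have "\<dots> = (\<Sum>u\<in>?U. c * \<tau> (D u))"
      using lin by (intro sum.cong) (auto simp: Vector_Spaces.linear_iff)
    also have "\<dots> = c * res0 n \<tau> D"
      by (simp add: res0_eq_level_sum level_sum_def sum_distrib_left)
    finally show ?thesis .
  qed
  \<comment> \<open>\<open>Psi_scale\<close> is a union over all representatives and is a single
    class only if their multiples are congruent. Two representatives differ by an ideal element,
    whose multiple is its product with the constant series \<open>scale c 1\<close>.\<close>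
  have Psi_scale: "Psi_scale n scale \<sigma> \<delta> c (Psi_class n \<sigma> \<delta> D) = Psi_class n \<sigma> \<delta> (\<lambda>w. scale c (D w))"
    if D: "D \<in> Psi0_carrier n" for c D
  proof -
    interpret I: ideal "Psi_ideal n \<sigma> \<delta>" "Psi0 n \<sigma> \<delta>" by (rule ideal_Psi_ideal)
    have "Psi_class n \<sigma> \<delta> (\<lambda>w. scale c (D' w)) = Psi_class n \<sigma> \<delta> (\<lambda>w. scale c (D w))"
      if D': "D' \<in> Psi_class n \<sigma> \<delta> D" for D'
    proof -
      obtain G where G: "G \<in> Psi_ideal n \<sigma> \<delta>" "D' = (\<lambda>w. G w + D w)"
        using D' unfolding Psi_class_iff by blast
      have m: "monomial (scale c 1) [] \<in> Psi0_carrier n" by (rule monomial_carrier) simp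
      obtain d where "deg_bounded n d G"
        using res0_Psi_ideal[OF G(1)] carrier_deg_bounded by blast
      then have "monomial (scale c 1) [] \<star> G = (\<lambda>w. scale c (G w))"
        using monomial_mult[of "[]" d G "scale c 1"] by (simp flip: scale_eq_mult)
      then have "(\<lambda>w. scale c (G w)) \<in> Psi_ideal n \<sigma> \<delta>"
        using I.I_l_closed[OF G(1)] m by force
      then have "(\<lambda>w. scale c (D' w)) \<in> Psi_class n \<sigma> \<delta> (\<lambda>w. scale c (D w))"
        unfolding Psi_class_iff G(2) by (auto simp: scale_right_distrib)
      then show ?thesis
        unfolding Psi_class_def
        by (rule I.a_repr_independence[symmetric]) (simp add: scaled[OF D], rule I.a_subgroup)
    qed
    moreover have "D \<in> Psi_class n \<sigma> \<delta> D"
      using I.a_rcos_self[of D] D by (simp add: Psi_class_def)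
    ultimately show ?thesis unfolding Psi_scale_def by blast
  qed
  show ?thesis
  proof (intro conjI ballI allI impI)
    show "ring (Psi0 n \<sigma> \<delta>)" by (rule ring_Psi0)
    show "ring (Psi n \<sigma> \<delta>)" by (rule ring_Psi)
  next
    fix D D' assume "D \<in> carrier (Psi0 n \<sigma> \<delta>)" "D' \<in> Psi_class n \<sigma> \<delta> D"
    then show "res0 n \<tau> D' = res0 n \<tau> D" using res0_Psi_class by simp
  next
    fix D assume "D \<in> carrier (Psi0 n \<sigma> \<delta>)"
    then show "res n \<tau> (Psi_class n \<sigma> \<delta> D) = res0 n \<tau> D" using res_Psi_class by simp
  next
    fix a :: "int list list \<Rightarrow> 'a" and N
    assume a: "\<forall>i. a i \<noteq> 0 \<longrightarrow> is_array n 1 N i"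
    then have "array_series n a \<in> Psi0_carrier n"
      unfolding Psi0_carrier_def
      by (intro CollectI exI[of _ a] conjI refl exI[of _ "1 :: nat"] exI[of _ N]) auto
    then show "res n \<tau> (Psi_class n \<sigma> \<delta> (array_series n a)) = \<tau> (a [replicate n (- 1)])"
      using res_array_series[of a N] a by (simp add: res_Psi_class)
  next
    fix X Y assume "X \<in> carrier (Psi n \<sigma> \<delta>)" "Y \<in> carrier (Psi n \<sigma> \<delta>)"
    then obtain D E where c: "D \<in> Psi0_carrier n" "E \<in> Psi0_carrier n"
      and XY: "X = Psi_class n \<sigma> \<delta> D" "Y = Psi_class n \<sigma> \<delta> E"
      by (metis Psi_carrierE)
    show "res n \<tau> (X \<oplus>\<^bsub>Psi n \<sigma> \<delta>\<^esub> Y) = res n \<tau> X + res n \<tau> Y"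
      using c by (simp add: XY Psi_class_add res_Psi_class carrier_add res0_add)
    show "res n \<tau> (X \<otimes>\<^bsub>Psi n \<sigma> \<delta>\<^esub> Y) = res n \<tau> (Y \<otimes>\<^bsub>Psi n \<sigma> \<delta>\<^esub> X)"
      using c res0_mult_commute[OF c] by (simp add: XY Psi_class_mult res_Psi_class mult_carrier)
  next
    fix c X assume "X \<in> carrier (Psi n \<sigma> \<delta>)"
    then obtain D where D: "D \<in> Psi0_carrier n" and X: "X = Psi_class n \<sigma> \<delta> D"
      by (rule Psi_carrierE)
    show "Psi_scale n scale \<sigma> \<delta> c X \<in> carrier (Psi n \<sigma> \<delta>)"
      using D by (simp add: X Psi_scale Psi_class_carrier scaled)
    show "res n \<tau> (Psi_scale n scale \<sigma> \<delta> c X) = c * res n \<tau> X"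
      using D by (simp add: X Psi_scale res_Psi_class scaled res_scaled)
  qed
qed

end
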